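(* Consider the stable $GI/GI/1$ feedback queue ($\rho=\lambda b/q<1$) with service time distribution $G$, where the tagged customer finds the system empty upon arrival and has sojourn time $U$. (a) If $G$ is regularly varying, $\overline G(x)=L(x)/x^{\alpha+1}$ with $\alpha>0$ and slowly varying function $L$, then, as $x\to\infty$, $$\mathbb{P}\big((1+m^{(0)}_{K-1})\,\sigma>x\big)\ \sim\ \frac{qL(x)}{x^{\alpha+1}}\sum_{k=0}^\infty p^k\left(\frac{1-(p+r^k\lambda b)}{1-r}\right)^{\alpha+1},$$ where $r=p+\lambda b$, $m^{(0)}_k=\frac{1-r^k}{1-r}\lambda b$ for $k\ge0$, and $K$ is independent of $\sigma$ with $\mathbb{P}(K=k)=qp^{k-1}$, $k\ge1$. (b) Under the assumption in (a), if the input stream is Poisson with parameter $\lambda$, then, as $x\to\infty$, $$\mathbb{P}(U>x)\ \sim\ C\,L(x)\,x^{-(\alpha+1)},\qquad C=\frac{q(1+p)}{(1-r)^{\alpha+1}(1-rp)}\sum_{k=0}^\infty p^k\big(1-(p+r^k\lambda b)\big)^{\alpha+1}.$$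
   Context: $GI/GI/1$ feedback queue: exogenous customers arrive to a single server as a renewal process with i.i.d. inter-arrival times of finite mean $a>0$; $\lambda=1/a$. Customers are served in the order of their (external and internal) arrivals to the queue. All service times are i.i.d. with distribution $G$ on the nonnegative half-line with finite mean $b>0$, independent of the arrival process; $\sigma$ denotes a random variable with distribution $G$ and $\overline G=1-G$. A customer completing a service returns to the end of the queue for another service with probability $p\in(0,1)$ or leaves the system with probability $q=1-p$, independently of everything else. Stability means $\rho=\lambda b/q<1$ (equivalently $r=p+\lambda b<1$). The tagged customer arrives at time $0$ and finds the system empty; $U$ is the time from its arrival until its final departure from the system (after a geometric number of services). A function $L$ is slowly varying if $L(cx)/L(x)\to1$ as $x\to\infty$ for every $c>0$. $f(x)\sim g(x)$ means $f(x)/g(x)\to1$ as $x\to\infty$. *)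

theory Defs
  imports "HOL-Probability.Probability" "HOL-Library.Landau_Symbols"
begin

definition slowly_varying :: "(real \<Rightarrow> real) \<Rightarrow> bool" where
  "slowly_varying L \<longleftrightarrow> (\<forall>c>0. ((\<lambda>x. L (c * x) / L x) \<longlongrightarrow> 1) at_top)"

text \<open>
  Sample-path description of the single-server feedback queue. Customers are numbered
  0, 1, 2, ... in the order of their external arrivals; customer 0 is the tagged one and
  arrives at time 0 to the empty system, and \<open>t n\<close> is the time between the external
  arrivals of customers \<open>n\<close> and \<open>n + 1\<close>.
\<close>

definition arrival_time :: "(nat \<Rightarrow> real) \<Rightarrow> nat \<Rightarrow> real" where
  "arrival_time t n = (\<Sum>i<n. t i)"

definition arrived :: "(nat \<Rightarrow> real) \<Rightarrow> real \<Rightarrow> nat" where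
  "arrived t u = card {n. arrival_time t n \<le> u}"

text \<open>
  A state \<open>(u, n, cs)\<close> describes the system immediately after a service completion (and the
  possible return of the served customer): \<open>u\<close> is the current time, \<open>n\<close> the number of customers
  that have entered from outside so far, \<open>cs\<close> the customers present, first in line first.
  \<open>serve t s f\<close> performs the next service, of length \<open>s\<close>, after which the customer returns to
  the end of the queue iff \<open>f\<close> holds. If nobody is present, the server first waits for the
  next external arrival, customer \<open>n\<close>. Customers arriving from outside during a service (or
  exactly at its end) join the queue ahead of the returning customer.
\<close>

fun serve :: "(nat \<Rightarrow> real) \<Rightarrow> real \<Rightarrow> bool \<Rightarrow> real \<times> nat \<times> nat list \<Rightarrow> real \<times> nat \<times> nat list" where
  "serve t s f (u, n, c # cs) =
     (let u' = u + s; n' = arrived t u'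
      in (u', n', cs @ [n..<n'] @ (if f then [c] else [])))"
| "serve t s f (u, n, []) =
     (let u' = arrival_time t n + s; n' = arrived t u'
      in (u', n', [Suc n..<n'] @ (if f then [n] else [])))"

text \<open>
  Service lengths \<open>s k\<close> and return decisions \<open>f k\<close> are numbered in the order in which the
  server performs the services.
\<close>

primrec queue_state ::
  "(nat \<Rightarrow> real) \<Rightarrow> (nat \<Rightarrow> real) \<Rightarrow> (nat \<Rightarrow> bool) \<Rightarrow> nat \<Rightarrow> real \<times> nat \<times> nat list" where
  "queue_state t s f 0 = (0, 1, [0])"
| "queue_state t s f (Suc k) = serve t (s k) (f k) (queue_state t s f k)"

definition clock :: "real \<times> nat \<times> nat list \<Rightarrow> real" where
  "clock st = fst st"

definition present :: "real \<times> nat \<times> nat list \<Rightarrow> nat set" where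
  "present st = set (snd (snd st))"

text \<open>
  Time of the final departure of the tagged customer. Should it never leave (a null event in
  the model below), the value is irrelevant.
\<close>

definition sojourn_time :: "(nat \<Rightarrow> real) \<Rightarrow> (nat \<Rightarrow> real) \<Rightarrow> (nat \<Rightarrow> bool) \<Rightarrow> real" where
  "sojourn_time t s f =
     clock (queue_state t s f (LEAST k. 0 \<notin> present (queue_state t s f k)))"

datatype input = Interarrival nat | Service nat | Feedback nat

text \<open>
  The joint independence of all inter-arrival times, service times and return decisions is
  expressed for one family of real random variables, with decisions coded by their indicators.
\<close>

locale feedback_queue = prob_space M
  for M :: "'a measure" +
  fixes T S :: "nat \<Rightarrow> 'a \<Rightarrow> real" and F :: "nat \<Rightarrow> 'a \<Rightarrow> bool"
    and H G :: "real measure" and a b p :: real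
  assumes indep: "indep_vars (\<lambda>_. borel)
      (\<lambda>i. case i of Interarrival n \<Rightarrow> T n | Service n \<Rightarrow> S n
                   | Feedback n \<Rightarrow> (\<lambda>\<omega>. of_bool (F n \<omega>))) UNIV"
    and interarrival_distr: "\<And>n. distr M borel (T n) = H"
    and interarrival_nonneg: "AE x in H. 0 \<le> x"
    and interarrival_integrable: "integrable H (\<lambda>x. x)"
    and interarrival_mean: "(\<integral>x. x \<partial>H) = a" "0 < a"
    and service_distr: "\<And>n. distr M borel (S n) = G"
    and service_nonneg: "AE x in G. 0 \<le> x"
    and service_integrable: "integrable G (\<lambda>x. x)"
    and service_mean: "(\<integral>x. x \<partial>G) = b" "0 < b"
    and feedback_prob: "\<And>n. prob {\<omega> \<in> space M. F n \<omega>} = p" "0 < p" "p < 1"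

definition m0 :: "real \<Rightarrow> real \<Rightarrow> real \<Rightarrow> nat \<Rightarrow> real" where
  "m0 r lam b k = (1 - r ^ k) / (1 - r) * lam * b"

end

theory Submission
  imports Defs "HOL-Real_Asymp.Real_Asymp"
begin

text \<open>
  Write \<open>r = p + \<lambda> b\<close> and \<open>\<tau> = \<alpha> + 1\<close>, and let \<open>m\<^sub>j\<close> be the quantity denoted \<open>m0 r \<lambda> b j\<close>.

  Both asymptotics are instances of the principle of one big jump: a quantity built from many
  independent regularly varying variables is large because one of them is, while all the others
  take their mean values.

  For part (a) the big jump is \<open>\<sigma>\<close> itself. Given \<open>K = k + 1\<close> the event reads
  \<open>\<sigma> > x / (1 + m\<^sub>k)\<close>, whose probability is about \<open>(1 + m\<^sub>k)\<^sup>\<tau>\<close> times the tail of \<open>G\<close> at \<open>x\<close>.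
  Since the \<open>m\<^sub>k\<close> are bounded, Tannery's theorem permits summation over \<open>k\<close>
  (\<open>scaled_service_tail\<close>), and \<open>1 + m\<^sub>k = (1 - (p + r\<^sup>k \<lambda> b)) / (1 - r)\<close>.

  For part (b) the sojourn of the tagged customer is cut into rounds. A round starts when the
  tagged customer is last in line; it consists of the services of the customers in front and of
  the service of the tagged customer. By the memorylessness of the Poisson stream, the triples
  (length of a service, number of external arrivals during it, return decision) are independent
  and identically distributed over the successive services (\<open>distr_services\<close>). Hence the pair
  \<open>(W\<^sub>j, X\<^sub>j)\<close> of the time elapsed and the number of customers in front after \<open>j\<close> rounds is a Markov
  chain, and the tagged customer leaves at the end of each round with probability \<open>1 - p\<close>,
  independently of the chain (\<open>prob_leaves\<close>). So the probability that the sojourn time exceeds \<open>x\<close>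
  is the sum over \<open>k\<close> of \<open>(1 - p) p\<^sup>k\<close> times the probability of \<open>W\<^sub>k\<^sub>+\<^sub>1 > x\<close>.

  The tails of all linear functionals \<open>W\<^sub>j + c X\<^sub>j\<close> are found together, by induction on \<open>j\<close>
  (\<open>chain_tail\<close>). One more round adds to \<open>W\<^sub>j\<close> the sum of about \<open>X\<^sub>j\<close> independent weights
  ``length of the service plus \<open>c\<close> times the number of customers it leaves behind''. Such a
  weight has mean \<open>b + c r\<close> and tail \<open>(1 + c \<lambda>)\<^sup>\<tau>\<close> times that of \<open>G\<close>, because a service of the
  large length \<open>y\<close> meets about \<open>\<lambda> y\<close> arrivals (\<open>weight_tail\<close>). There are two ways for
  \<open>W\<^sub>j\<^sub>+\<^sub>1 + c X\<^sub>j\<^sub>+\<^sub>1\<close> to be large: the past is large, so that \<open>W\<^sub>j + (b + c r) X\<^sub>j\<close> exceeds \<open>x\<close> by the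
  law of large numbers, or one of the \<open>X\<^sub>j + 1\<close> new services is large. With \<open>m\<^sub>j\<close> the mean
  of \<open>X\<^sub>j\<close> this gives the recursion
  \<open>C\<^sub>j\<^sub>+\<^sub>1(c) = C\<^sub>j(b + c r) + (m\<^sub>j + 1) (1 + c \<lambda>)\<^sup>\<tau>\<close> for the limiting constants. The analytic heart
  is \<open>random_sum_tail\<close>, which needs a bound for the tail of a sum of \<open>n\<close> weights that is linear
  in \<open>n\<close> and uniform in the level (\<open>sum_tail_bound\<close>).

  Finally the tails of \<open>W\<^sub>j\<close> grow at most like \<open>\<theta>\<^sup>j\<close> for every \<open>\<theta> > 1\<close> (\<open>chain_tail_bound\<close>), which
  justifies summation over \<open>k\<close> once more. Unrolled, \<open>C\<^sub>k\<^sub>+\<^sub>1(0)\<close> is the sum over \<open>i \<le> k\<close> of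
  \<open>(m\<^sub>k\<^sub>-\<^sub>i + 1) (1 + m\<^sub>i)\<^sup>\<tau>\<close>, so that the sum over \<open>k\<close> is a Cauchy product of the sum in (a) with the
  elementary sum of \<open>p\<^sup>j (m\<^sub>j + 1)\<close>, which equals \<open>(1 + p) / (1 - r p)\<close> (\<open>tail_const_sum\<close>).
\<close>

section \<open>Regularly varying tails\<close>

text \<open>
  The usual way to turn bounds with a slack \<open>\<delta>\<close> into a limit: for each fixed \<open>\<delta>\<close> the bounds
  converge along \<open>F\<close>, and their limits close up as \<open>\<delta>\<close> tends to \<open>0\<close>.
\<close>

lemma tendsto_sandwich_approx:
  fixes f :: "'a \<Rightarrow> real" and l u :: "real \<Rightarrow> 'a \<Rightarrow> real" and L U :: "real \<Rightarrow> real"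
  assumes low: "\<forall>\<^sub>F \<delta> in at_right 0. (\<forall>\<^sub>F x in F. l \<delta> x \<le> f x) \<and> (l \<delta> \<longlongrightarrow> L \<delta>) F"
    and up: "\<forall>\<^sub>F \<delta> in at_right 0. (\<forall>\<^sub>F x in F. f x \<le> u \<delta> x) \<and> (u \<delta> \<longlongrightarrow> U \<delta>) F"
    and L: "(L \<longlongrightarrow> y) (at_right 0)" and U: "(U \<longlongrightarrow> y) (at_right 0)"
  shows "(f \<longlongrightarrow> y) F"
proof (rule order_tendstoI)
  fix a assume "a < y"
  have "\<forall>\<^sub>F \<delta> in at_right 0. a < L \<delta> \<and> (\<forall>\<^sub>F x in F. l \<delta> x \<le> f x) \<and> (l \<delta> \<longlongrightarrow> L \<delta>) F"
    using order_tendstoD(1)[OF L \<open>a < y\<close>] low by eventually_elim auto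
  then obtain \<delta> where \<delta>: "a < L \<delta>" "\<forall>\<^sub>F x in F. l \<delta> x \<le> f x" "(l \<delta> \<longlongrightarrow> L \<delta>) F"
    using eventually_happens' [OF trivial_limit_at_right_real] by blast
  show "\<forall>\<^sub>F x in F. a < f x"
    using order_tendstoD(1)[OF \<delta>(3,1)] \<delta>(2) by eventually_elim auto
next
  fix a assume "y < a"
  have "\<forall>\<^sub>F \<delta> in at_right 0. U \<delta> < a \<and> (\<forall>\<^sub>F x in F. f x \<le> u \<delta> x) \<and> (u \<delta> \<longlongrightarrow> U \<delta>) F"
    using order_tendstoD(2)[OF U \<open>y < a\<close>] up by eventually_elim auto
  then obtain \<delta> where \<delta>: "U \<delta> < a" "\<forall>\<^sub>F x in F. f x \<le> u \<delta> x" "(u \<delta> \<longlongrightarrow> U \<delta>) F"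
    using eventually_happens' [OF trivial_limit_at_right_real] by blast
  show "\<forall>\<^sub>F x in F. f x < a"
    using order_tendstoD(2)[OF \<delta>(3,1)] \<delta>(2) by eventually_elim auto
qed

lemma borel_measurable_antimono:
  fixes f :: "real \<Rightarrow> real"
  assumes "antimono f"
  shows "f \<in> borel_measurable borel"
proof -
  have "mono (\<lambda>x. - f x)" using assms by (simp add: mono_def antimono_def)
  then have "(\<lambda>x. - (- f x)) \<in> borel_measurable borel"
    by (intro borel_measurable_uminus borel_measurable_mono)
  then show ?thesis by simp
qed

lemma eventually_at_right_0I:
  fixes e :: real
  assumes "0 < e" "\<And>\<delta>. 0 < \<delta> \<Longrightarrow> \<delta> < e \<Longrightarrow> P \<delta>"
  shows "\<forall>\<^sub>F \<delta> in at_right 0. P \<delta>"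
  using assms by (auto simp: eventually_at_right_field)

text \<open>
  A positive tail of index \<open>- \<tau>\<close>. The index is beyond \<open>1\<close>, so that a random variable with such a
  tail has a finite mean, and even a moment of some order above \<open>1\<close>.
\<close>

locale regularly_varying_tail =
  fixes g :: "real \<Rightarrow> real" and \<tau> :: real
  assumes tail_antimono: "x \<le> y \<Longrightarrow> g y \<le> g x"
    and tail_pos: "0 < g x"
    and tail_le_1: "g x \<le> 1"
    and tail_scale: "0 < c \<Longrightarrow> ((\<lambda>x. g (c * x) / g x) \<longlongrightarrow> c powr - \<tau>) at_top"
    and index_gt_1: "1 < \<tau>"
begin

lemma eventually_scale_le:
  assumes "0 < c" "c powr - \<tau> < B"
  shows "\<forall>\<^sub>F x in at_top. g (c * x) \<le> B * g x"
  using order_tendstoD(2)[OF tail_scale[OF assms(1)] assms(2)]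
proof eventually_elim
  case (elim x)
  then show ?case
    using tail_pos[of x] by (simp add: field_simps)
qed

lemma eventually_scale_ge:
  assumes "0 < c" "B < c powr - \<tau>"
  shows "\<forall>\<^sub>F x in at_top. B * g x \<le> g (c * x)"
  using order_tendstoD(1)[OF tail_scale[OF assms(1)] assms(2)]
proof eventually_elim
  case (elim x)
  then show ?case
    using tail_pos[of x] by (simp add: field_simps)
qed

text \<open>
  Scaling costs a bounded factor uniformly in \<open>x \<ge> 0\<close>: for large \<open>x\<close> by regular variation, and for
  the remaining \<open>x\<close> because the tail is at least \<open>g x0\<close> there.
\<close>

lemma scale_bounded:
  assumes "0 < c"
  obtains B where "0 < B" "\<And>x. 0 \<le> x \<Longrightarrow> g (c * x) \<le> B * g x"
proof -
  define B0 where "B0 = c powr - \<tau> + 1"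
  have "0 < B0" by (auto simp: B0_def intro!: add_nonneg_pos)
  from eventually_scale_le[OF assms, of B0] obtain x0 where
    x0: "\<And>x. x0 \<le> x \<Longrightarrow> g (c * x) \<le> B0 * g x"
    by (auto simp: B0_def eventually_at_top_linorder)
  define B where "B = max B0 (1 / g x0)"
  show thesis
  proof
    show "0 < B" using \<open>0 < B0\<close> by (simp add: B_def)
    fix x :: real assume "0 \<le> x"
    show "g (c * x) \<le> B * g x"
    proof (cases "x0 \<le> x")
      case True
      have "B0 * g x \<le> B * g x"
        using tail_pos[of x] by (intro mult_right_mono) (auto simp: B_def)
      with x0[OF True] show ?thesis by linarith
    next
      case False
      then have "g x0 \<le> g x" by (intro tail_antimono) auto
      then have "1 \<le> 1 / g x0 * g x" using tail_pos[of x0] by (simp add: field_simps)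
      also have "\<dots> \<le> B * g x"
        using tail_pos[of x] by (intro mult_right_mono) (auto simp: B_def)
      finally show ?thesis using tail_le_1[of "c * x"] by linarith
    qed
  qed
qed

lemma powr_scale_tendsto_1:
  "((\<lambda>\<delta>. (1 - \<delta>) powr - \<tau>) \<longlongrightarrow> 1) (at_right 0)"
  "((\<lambda>\<delta>. (1 + \<delta>) powr - \<tau>) \<longlongrightarrow> 1) (at_right 0)"
proof -
  have "((\<lambda>\<delta>::real. (1 - \<delta>) powr - \<tau>) \<longlongrightarrow> (1 - 0) powr - \<tau>) (at_right 0)"
    by (intro tendsto_intros) auto
  then show "((\<lambda>\<delta>. (1 - \<delta>) powr - \<tau>) \<longlongrightarrow> 1) (at_right 0)" by simp
  have "((\<lambda>\<delta>::real. (1 + \<delta>) powr - \<tau>) \<longlongrightarrow> (1 + 0) powr - \<tau>) (at_right 0)"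
    by (intro tendsto_intros) auto
  then show "((\<lambda>\<delta>. (1 + \<delta>) powr - \<tau>) \<longlongrightarrow> 1) (at_right 0)" by simp
qed

text \<open>
  A shift by a constant is eventually smaller than a scaling by \<open>1 \<plusminus> \<delta>\<close>, so it does not affect a
  regularly varying tail.
\<close>

lemma tail_shift: "((\<lambda>x. g (x - y) / g x) \<longlongrightarrow> 1) at_top"
proof (rule tendsto_sandwich_approx)
  show "\<forall>\<^sub>F \<delta> in at_right 0. (\<forall>\<^sub>F x in at_top. g ((1 + \<delta>) * x) / g x \<le> g (x - y) / g x) \<and>
      ((\<lambda>x. g ((1 + \<delta>) * x) / g x) \<longlongrightarrow> (1 + \<delta>) powr - \<tau>) at_top"
  proof (rule eventually_at_right_0I[of 1], safe)
    fix \<delta> :: real assume \<delta>: "0 < \<delta>" "\<delta> < 1"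
    show "\<forall>\<^sub>F x in at_top. g ((1 + \<delta>) * x) / g x \<le> g (x - y) / g x"
      using eventually_ge_at_top[of "\<bar>y\<bar> / \<delta>"]
    proof eventually_elim
      case (elim x)
      then have "x - y \<le> (1 + \<delta>) * x" using \<delta> by (simp add: field_simps)
      then show ?case using tail_pos[of x] by (intro divide_right_mono tail_antimono) auto
    qed
    show "((\<lambda>x. g ((1 + \<delta>) * x) / g x) \<longlongrightarrow> (1 + \<delta>) powr - \<tau>) at_top"
      using \<delta> by (intro tail_scale) auto
  qed auto
  show "\<forall>\<^sub>F \<delta> in at_right 0. (\<forall>\<^sub>F x in at_top. g (x - y) / g x \<le> g ((1 - \<delta>) * x) / g x) \<and>
      ((\<lambda>x. g ((1 - \<delta>) * x) / g x) \<longlongrightarrow> (1 - \<delta>) powr - \<tau>) at_top"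
  proof (rule eventually_at_right_0I[of 1], safe)
    fix \<delta> :: real assume \<delta>: "0 < \<delta>" "\<delta> < 1"
    show "\<forall>\<^sub>F x in at_top. g (x - y) / g x \<le> g ((1 - \<delta>) * x) / g x"
      using eventually_ge_at_top[of "\<bar>y\<bar> / \<delta>"]
    proof eventually_elim
      case (elim x)
      then have "(1 - \<delta>) * x \<le> x - y" using \<delta> by (simp add: field_simps)
      then show ?case using tail_pos[of x] by (intro divide_right_mono tail_antimono) auto
    qed
    show "((\<lambda>x. g ((1 - \<delta>) * x) / g x) \<longlongrightarrow> (1 - \<delta>) powr - \<tau>) at_top"
      using \<delta> by (intro tail_scale) auto
  qed auto
qed (use powr_scale_tendsto_1 in auto)

text \<open>
  One half of Potter's bounds. Doubling the argument eventually divides \<open>g\<close> by more than \<open>2 powr s\<close>,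
  and every positive number is reached from a bounded interval by repeated doubling.
\<close>

lemma tail_le_powr:
  assumes "0 < s" "s < \<tau>"
  obtains B where "0 < B" "\<And>x. 0 < x \<Longrightarrow> g x \<le> B * x powr - s"
proof -
  have "(2::real) powr - \<tau> < 2 powr - s" using assms by simp
  from eventually_scale_le[OF _ this] obtain x1 where
    x1: "\<And>x. x1 \<le> x \<Longrightarrow> g (2 * x) \<le> 2 powr - s * g x"
    by (auto simp: eventually_at_top_linorder)
  define x0 where "x0 = max 1 x1"
  define B where "B = (2 * x0) powr s"
  have x0: "1 \<le> x0" "x1 \<le> x0" by (auto simp: x0_def)
  have start: "g x \<le> B * x powr - s" if "0 < x" "x \<le> 2 * x0" for x
  proof -
    have "x powr s \<le> B" unfolding B_def using that assms by (intro powr_mono2) auto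
    then have "1 \<le> B * x powr - s" using that by (simp add: powr_minus field_simps)
    then show ?thesis using tail_le_1[of x] by linarith
  qed
  have "\<forall>x. 0 < x \<longrightarrow> x \<le> 2 ^ n * x0 \<longrightarrow> g x \<le> B * x powr - s" for n
  proof (induction n)
    case 0
    then show ?case using start x0 by auto
  next
    case (Suc n)
    show ?case
    proof (intro allI impI)
      fix x assume x: "0 < x" "x \<le> 2 ^ Suc n * x0"
      show "g x \<le> B * x powr - s"
      proof (cases "x \<le> 2 * x0")
        case True
        then show ?thesis using start x by auto
      next
        case False
        have "g x = g (2 * (x / 2))" by simp
        also have "\<dots> \<le> 2 powr - s * g (x / 2)" using False x0 by (intro x1) auto
        also have "\<dots> \<le> 2 powr - s * (B * (x / 2) powr - s)"
          using Suc x by (intro mult_left_mono) auto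
        also have "\<dots> = B * x powr - s" using x by (simp add: powr_divide)
        finally show ?thesis .
      qed
    qed
  qed
  moreover have "\<exists>n. x \<le> 2 ^ n * x0" for x
  proof -
    obtain n where "x < 2 ^ n" using real_arch_pow[of 2 x] by auto
    also have "(2::real) ^ n * 1 \<le> 2 ^ n * x0" using x0 by (intro mult_left_mono) auto
    finally show ?thesis by (auto intro: less_imp_le)
  qed
  ultimately have "g x \<le> B * x powr - s" if "0 < x" for x using that by blast
  moreover have "0 < B" using x0 by (simp add: B_def)
  ultimately show thesis by (rule that[rotated])
qed

text \<open>
  The other half of Potter's bounds, by the same doubling argument with any exponent above \<open>\<tau>\<close>. It
  shows that whatever decays faster than every power is negligible against the tail.
\<close>

lemma tail_ge_powr:
  obtains B \<beta> where "0 < B" "0 < \<beta>" "\<And>x. 1 \<le> x \<Longrightarrow> B * x powr - \<beta> \<le> g x"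
proof -
  define \<beta> where "\<beta> = \<tau> + 1"
  have \<beta>: "0 < \<beta>" "\<tau> < \<beta>" using index_gt_1 by (auto simp: \<beta>_def)
  then have "(2::real) powr - \<beta> < 2 powr - \<tau>" by simp
  from eventually_scale_ge[OF _ this] obtain x1 where
    x1: "\<And>x. x1 \<le> x \<Longrightarrow> 2 powr - \<beta> * g x \<le> g (2 * x)"
    by (auto simp: eventually_at_top_linorder)
  define x0 where "x0 = max 1 x1"
  define B where "B = g (2 * x0)"
  have x0: "1 \<le> x0" "x1 \<le> x0" by (auto simp: x0_def)
  have "0 < B" by (simp add: B_def tail_pos)
  have start: "B * x powr - \<beta> \<le> g x" if "1 \<le> x" "x \<le> 2 * x0" for x
  proof -
    have "1 \<le> x powr \<beta>" using that \<beta> by (intro ge_one_powr_ge_zero) auto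
    then have "x powr - \<beta> \<le> 1" by (simp add: powr_minus inverse_le_1_iff)
    then have "B * x powr - \<beta> \<le> B * 1" using \<open>0 < B\<close> by (intro mult_left_mono) auto
    also have "\<dots> \<le> g x" unfolding B_def using that by (simp add: tail_antimono)
    finally show ?thesis .
  qed
  have "\<forall>x. 1 \<le> x \<longrightarrow> x \<le> 2 ^ n * x0 \<longrightarrow> B * x powr - \<beta> \<le> g x" for n
  proof (induction n)
    case 0
    then show ?case using start x0 by auto
  next
    case (Suc n)
    show ?case
    proof (intro allI impI)
      fix x assume x: "1 \<le> x" "x \<le> 2 ^ Suc n * x0"
      show "B * x powr - \<beta> \<le> g x"
      proof (cases "x \<le> 2 * x0")
        case True
        then show ?thesis using start x by auto
      next
        case False
        have "B * x powr - \<beta> = 2 powr - \<beta> * (B * (x / 2) powr - \<beta>)" using x by (simp add: powr_divide)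
        also have "\<dots> \<le> 2 powr - \<beta> * g (x / 2)"
          using Suc x False x0 by (intro mult_left_mono) auto
        also have "\<dots> \<le> g (2 * (x / 2))" using False x0 by (intro x1) auto
        finally show ?thesis by simp
      qed
    qed
  qed
  moreover have "\<exists>n. x \<le> 2 ^ n * x0" for x
  proof -
    obtain n where "x < 2 ^ n" using real_arch_pow[of 2 x] by auto
    also have "(2::real) ^ n * 1 \<le> 2 ^ n * x0" using x0 by (intro mult_left_mono) auto
    finally show ?thesis by (auto intro: less_imp_le)
  qed
  ultimately have "B * x powr - \<beta> \<le> g x" if "1 \<le> x" for x using that by blast
  then show thesis using \<open>0 < B\<close> \<beta>(1) by (intro that[of B \<beta>]) auto
qed

lemma exp_negligible:
  assumes "0 < \<theta>"
  shows "((\<lambda>x. exp (- \<theta> * x) / g x) \<longlongrightarrow> 0) at_top"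
proof -
  obtain B \<beta> where B: "0 < B" "0 < \<beta>" "\<And>x. 1 \<le> x \<Longrightarrow> B * x powr - \<beta> \<le> g x"
    using tail_ge_powr by blast
  obtain n :: nat where n: "\<beta> \<le> real n" using real_arch_simple by blast
  have "((\<lambda>x::real. (x ^ n / exp x)) \<longlongrightarrow> 0) at_top" by (rule tendsto_power_div_exp_0)
  then have "((\<lambda>x. ((\<theta> * x) ^ n / exp (\<theta> * x))) \<longlongrightarrow> 0) at_top"
    by (rule filterlim_compose) (intro filterlim_tendsto_pos_mult_at_top[OF tendsto_const assms filterlim_ident])
  then have lim: "((\<lambda>x. (\<theta> * x) ^ n / exp (\<theta> * x) / (B * \<theta> ^ n)) \<longlongrightarrow> 0) at_top"
    by (rule tendsto_divide_zero)
  show ?thesis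
  proof (rule tendsto_sandwich[OF _ _ tendsto_const lim])
    show "\<forall>\<^sub>F x in at_top. 0 \<le> exp (- \<theta> * x) / g x"
      using tail_pos by (intro always_eventually allI divide_nonneg_pos) auto
    show "\<forall>\<^sub>F x in at_top. exp (- \<theta> * x) / g x \<le> (\<theta> * x) ^ n / exp (\<theta> * x) / (B * \<theta> ^ n)"
      using eventually_ge_at_top[of 1]
    proof eventually_elim
      case (elim x)
      have "x powr \<beta> \<le> x powr real n" using elim n by (intro powr_mono) auto
      then have "B * x powr - real n \<le> B * x powr - \<beta>"
        using B elim by (intro mult_left_mono) (auto intro!: powr_mono n)
      with B(3)[OF elim] have "B * x powr - real n \<le> g x" by linarith
      moreover have "0 < B * x powr - real n" using B elim by simp
      ultimately have "exp (- \<theta> * x) / g x \<le> exp (- \<theta> * x) / (B * x powr - real n)"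
        using B(1) elim by (intro divide_left_mono mult_pos_pos tail_pos) auto
      also have "\<dots> = (\<theta> * x) ^ n / exp (\<theta> * x) / (B * \<theta> ^ n)"
        using elim assms by (simp add: exp_minus powr_minus powr_realpow field_simps)
      finally show ?case .
    qed
  qed
qed

end

section \<open>Sums of a fixed number of heavy-tailed variables\<close>

text \<open>
  The constant \<open>d\<close> compares the tail of the variables with the reference tail \<open>g\<close>; it appears as the
  weights of services below have tails proportional to the tail of the service times.
\<close>

locale iid_heavy_tail = prob_space M + regularly_varying_tail g \<tau>
  for M :: "'a measure" and g :: "real \<Rightarrow> real" and \<tau> :: real +
  fixes Y :: "nat \<Rightarrow> 'a \<Rightarrow> real" and \<mu> d :: real
  assumes indep_Y: "indep_vars (\<lambda>_. borel) Y UNIV"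
    and ident_Y: "\<And>i. distr M borel (Y i) = distr M borel (Y 0)"
    and nonneg_Y: "0 \<le> Y i \<omega>"
    and integrable_Y: "integrable M (Y 0)"
    and mean_Y: "expectation (Y 0) = \<mu>"
    and tail_Y: "((\<lambda>x. prob {\<omega> \<in> space M. x < Y 0 \<omega>} / g x) \<longlongrightarrow> d) at_top"
begin

lemma measurable_Y [measurable]: "Y i \<in> borel_measurable M"
  using indep_Y by (auto simp: indep_vars_def)

lemma mean_nonneg: "0 \<le> \<mu>"
  unfolding mean_Y[symmetric] using nonneg_Y by (intro integral_nonneg_AE) auto

lemma prob_Y_eq: "prob {\<omega> \<in> space M. x < Y i \<omega>} = prob {\<omega> \<in> space M. x < Y 0 \<omega>}"
proof -
  have "prob {\<omega> \<in> space M. x < Y j \<omega>} = measure (distr M borel (Y j)) {x<..}" for j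
    by (subst measure_distr) (auto intro!: arg_cong[where f=prob])
  then show ?thesis using ident_Y[of i] by simp
qed

lemma prob_Y_tail_scale:
  assumes "0 < c"
  shows "((\<lambda>x. prob {\<omega> \<in> space M. c * x < Y i \<omega>} / g x) \<longlongrightarrow> d * c powr - \<tau>) at_top"
proof -
  have "filterlim (\<lambda>x. c * x) at_top at_top"
    by (rule filterlim_tendsto_pos_mult_at_top[OF tendsto_const assms filterlim_ident])
  from filterlim_compose[OF tail_Y this]
  have "((\<lambda>x. prob {\<omega> \<in> space M. c * x < Y 0 \<omega>} / g (c * x) * (g (c * x) / g x))
      \<longlongrightarrow> d * c powr - \<tau>) at_top"
    by (intro tendsto_mult tail_scale assms)
  moreover have "prob {\<omega> \<in> space M. c * x < Y 0 \<omega>} / g (c * x) * (g (c * x) / g x) =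
      prob {\<omega> \<in> space M. c * x < Y i \<omega>} / g x" for x
    using tail_pos[of "c * x"] prob_Y_eq[of "c * x" i] by simp
  ultimately show ?thesis by (simp only:)
qed

lemma prob_Y_le_tail:
  obtains B where "0 < B" "\<And>i x. 0 \<le> x \<Longrightarrow> prob {\<omega> \<in> space M. x < Y i \<omega>} \<le> B * g x"
proof -
  have "\<forall>\<^sub>F x in at_top. prob {\<omega> \<in> space M. x < Y 0 \<omega>} / g x < \<bar>d\<bar> + 1"
    by (rule order_tendstoD(2)[OF tail_Y]) auto
  then obtain x0 where x0: "\<And>x. x0 \<le> x \<Longrightarrow> prob {\<omega> \<in> space M. x < Y 0 \<omega>} / g x < \<bar>d\<bar> + 1"
    by (auto simp: eventually_at_top_linorder)
  define B where "B = max (\<bar>d\<bar> + 1) (1 / g x0)"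
  show thesis
  proof
    show "0 < B" by (auto simp: B_def less_max_iff_disj intro!: disjI1 add_nonneg_pos)
    fix i and x :: real assume "0 \<le> x"
    have "prob {\<omega> \<in> space M. x < Y 0 \<omega>} \<le> B * g x"
    proof (cases "x0 \<le> x")
      case True
      then have "prob {\<omega> \<in> space M. x < Y 0 \<omega>} \<le> (\<bar>d\<bar> + 1) * g x"
        using x0[of x] tail_pos[of x] by (simp add: field_simps)
      also have "\<dots> \<le> B * g x" using tail_pos[of x] by (intro mult_right_mono) (auto simp: B_def)
      finally show ?thesis .
    next
      case False
      then have "g x0 \<le> g x" by (intro tail_antimono) auto
      then have "1 \<le> 1 / g x0 * g x" using tail_pos[of x0] by (simp add: field_simps)
      also have "\<dots> \<le> B * g x"
        using tail_pos[of x] by (intro mult_right_mono) (auto simp: B_def)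
      finally show ?thesis using prob_le_1[of "{\<omega> \<in> space M. x < Y 0 \<omega>}"] by linarith
    qed
    then show "prob {\<omega> \<in> space M. x < Y i \<omega>} \<le> B * g x" by (simp add: prob_Y_eq[of x i])
  qed
qed

lemma tail_tendsto_0: "(g \<longlongrightarrow> 0) at_top"
proof -
  obtain B where B: "0 < B" "\<And>x. 0 < x \<Longrightarrow> g x \<le> B * x powr - 1"
    using tail_le_powr[of 1] index_gt_1 by auto
  have "((\<lambda>x::real. B * x powr - 1) \<longlongrightarrow> B * 0) at_top"
    by (intro tendsto_intros tendsto_neg_powr filterlim_ident) auto
  then have lim: "((\<lambda>x::real. B * x powr - 1) \<longlongrightarrow> 0) at_top" by (simp only: mult_zero_right)
  have "\<forall>\<^sub>F x in at_top. g x \<le> B * x powr - 1"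
    using eventually_gt_at_top[of 0] by eventually_elim (rule B)
  moreover have "\<forall>\<^sub>F x in at_top. 0 \<le> g x"
    by (intro always_eventually allI less_imp_le tail_pos)
  ultimately show ?thesis
    by (intro tendsto_sandwich[OF _ _ tendsto_const lim])
qed

lemma prob_Y_sq_negligible:
  assumes "0 < c"
  shows "((\<lambda>x. (prob {\<omega> \<in> space M. c * x < Y 0 \<omega>})\<^sup>2 / g x) \<longlongrightarrow> 0) at_top"
proof -
  have "((\<lambda>x. (prob {\<omega> \<in> space M. c * x < Y 0 \<omega>} / g x)\<^sup>2 * g x) \<longlongrightarrow> (d * c powr - \<tau>)\<^sup>2 * 0) at_top"
    by (intro tendsto_intros prob_Y_tail_scale assms tail_tendsto_0)
  moreover have "(prob {\<omega> \<in> space M. c * x < Y 0 \<omega>} / g x)\<^sup>2 * g x =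
      (prob {\<omega> \<in> space M. c * x < Y 0 \<omega>})\<^sup>2 / g x" for x
    using tail_pos[of x] by (simp add: power2_eq_square)
  ultimately show ?thesis by (simp only: mult_zero_right)
qed

lemma prob_two_large:
  assumes "i \<noteq> j"
  shows "prob {\<omega> \<in> space M. x < Y i \<omega> \<and> x < Y j \<omega>} = (prob {\<omega> \<in> space M. x < Y 0 \<omega>})\<^sup>2"
proof -
  have "prob (\<Inter>k\<in>{i, j}. Y k -` {x<..} \<inter> space M) = (\<Prod>k\<in>{i, j}. prob (Y k -` {x<..} \<inter> space M))"
    by (rule indep_varsD[OF indep_Y]) auto
  also have "(\<Inter>k\<in>{i, j}. Y k -` {x<..} \<inter> space M) = {\<omega> \<in> space M. x < Y i \<omega> \<and> x < Y j \<omega>}"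
    by auto
  also have "(\<Prod>k\<in>{i, j}. prob (Y k -` {x<..} \<inter> space M)) =
      prob {\<omega> \<in> space M. x < Y i \<omega>} * prob {\<omega> \<in> space M. x < Y j \<omega>}"
    using assms by (simp add: vimage_def Int_def conj_commute)
  finally show ?thesis by (simp add: prob_Y_eq[of x i] prob_Y_eq[of x j] power2_eq_square)
qed

text \<open>
  The lower Bonferroni inequality: events that two variables are large cost only squared
  probabilities.
\<close>

lemma prob_some_large:
  "real n * prob {\<omega> \<in> space M. x < Y 0 \<omega>} - (real n)\<^sup>2 * (prob {\<omega> \<in> space M. x < Y 0 \<omega>})\<^sup>2
    \<le> prob {\<omega> \<in> space M. \<exists>i<n. x < Y i \<omega>}"
proof (induction n)
  case 0
  then show ?case by simp
next
  case (Suc n)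
  define P where "P = prob {\<omega> \<in> space M. x < Y 0 \<omega>}"
  let ?A = "{\<omega> \<in> space M. \<exists>i<n. x < Y i \<omega>}" and ?B = "{\<omega> \<in> space M. x < Y n \<omega>}"
  have "prob (?A \<inter> ?B) \<le> prob (\<Union>i\<in>{..<n}. {\<omega> \<in> space M. x < Y i \<omega> \<and> x < Y n \<omega>})"
    by (intro finite_measure_mono) auto
  also have "\<dots> \<le> (\<Sum>i\<in>{..<n}. prob {\<omega> \<in> space M. x < Y i \<omega> \<and> x < Y n \<omega>})"
    by (intro finite_measure_subadditive_finite) auto
  also have "\<dots> = real n * P\<^sup>2"
    by (simp add: prob_two_large P_def)
  finally have inter: "prob (?A \<inter> ?B) \<le> real n * P\<^sup>2" .
  have "prob {\<omega> \<in> space M. \<exists>i<Suc n. x < Y i \<omega>} = prob (?A \<union> ?B)"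
    by (intro arg_cong[where f=prob]) (auto simp: less_Suc_eq)
  also have "\<dots> = prob ?A + prob ?B - prob (?A \<inter> ?B)"
    by (intro measure_Un3) (auto simp: fmeasurable_eq_sets)
  also have "prob ?B = P" unfolding P_def by (rule prob_Y_eq)
  finally have "prob {\<omega> \<in> space M. \<exists>i<Suc n. x < Y i \<omega>} \<ge> real n * P - (real n)\<^sup>2 * P\<^sup>2 + P - real n * P\<^sup>2"
    using Suc inter by (simp add: P_def)
  moreover have "real n * P - (real n)\<^sup>2 * P\<^sup>2 + P - real n * P\<^sup>2 - (real (Suc n) * P - (real (Suc n))\<^sup>2 * P\<^sup>2)
      = (real n + 1) * P\<^sup>2"
    by (simp add: power2_eq_square algebra_simps)
  moreover have "0 \<le> (real n + 1) * P\<^sup>2" by simp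
  ultimately show ?case unfolding P_def by linarith
qed

text \<open>
  One big jump, pathwise: unless two of the \<open>n\<close> variables exceed \<open>\<delta> x / n\<close>, all but one of them
  contribute at most \<open>\<delta> x\<close> together.
\<close>

lemma sum_large_imp:
  assumes "0 < \<delta>" "\<delta> < 1" "0 < x" "x < (\<Sum>i<n. Y i \<omega>)"
  shows "(\<exists>i<n. (1 - \<delta>) * x < Y i \<omega>) \<or>
    (\<exists>i<n. \<exists>j<n. i \<noteq> j \<and> \<delta> / real n * x < Y i \<omega> \<and> \<delta> / real n * x < Y j \<omega>)"
proof (rule ccontr)
  assume "\<not> ?thesis"
  then have 1: "\<And>i. i < n \<Longrightarrow> Y i \<omega> \<le> (1 - \<delta>) * x"
    and 2: "\<And>i j. i < n \<Longrightarrow> j < n \<Longrightarrow> i \<noteq> j \<Longrightarrow> Y i \<omega> \<le> \<delta> / real n * x \<or> Y j \<omega> \<le> \<delta> / real n * x"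
    by (meson not_le_imp_less)+
  have "0 < n" using assms by (cases n) auto
  have "(\<Sum>i<n. Y i \<omega>) \<le> x"
  proof (cases "\<forall>i<n. Y i \<omega> \<le> \<delta> / real n * x")
    case True
    then have "(\<Sum>i<n. Y i \<omega>) \<le> (\<Sum>i<n. \<delta> / real n * x)" by (intro sum_mono) auto
    also have "\<dots> = \<delta> * x" using \<open>0 < n\<close> by simp
    also have "\<dots> \<le> 1 * x" using assms by (intro mult_right_mono) auto
    finally show ?thesis by simp
  next
    case False
    then obtain k where k: "k < n" "\<not> Y k \<omega> \<le> \<delta> / real n * x" by auto
    have "(\<Sum>i<n. Y i \<omega>) = Y k \<omega> + (\<Sum>i\<in>{..<n} - {k}. Y i \<omega>)"
      using k by (subst sum.remove[of _ k]) auto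
    also have "(\<Sum>i\<in>{..<n} - {k}. Y i \<omega>) \<le> (\<Sum>i\<in>{..<n} - {k}. \<delta> / real n * x)"
      using 2[OF k(1)] k(2) by (intro sum_mono) fastforce
    also have "\<dots> \<le> (\<Sum>i\<in>{..<n}. \<delta> / real n * x)"
      using assms by (intro sum_mono2) auto
    also have "\<dots> = \<delta> * x" using \<open>0 < n\<close> by simp
    also have "Y k \<omega> \<le> (1 - \<delta>) * x" using 1 k by auto
    finally show ?thesis by (simp add: algebra_simps)
  qed
  with assms show False by simp
qed

text \<open>
  By independence two large variables occur with a probability of squared order, so that only one
  of the \<open>n\<close> variables is responsible for a large sum.
\<close>

lemma fixed_sum_tail:
  fixes n :: nat
  shows "((\<lambda>x. prob {\<omega> \<in> space M. x < (\<Sum>i<n. Y i \<omega>)} / g x) \<longlongrightarrow> real n * d) at_top"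
proof (cases "n = 0")
  case True
  have "\<forall>\<^sub>F x in at_top. prob {\<omega> \<in> space M. x < (\<Sum>i<n. Y i \<omega>)} / g x = 0"
    using eventually_ge_at_top[of 0] by eventually_elim (simp add: True)
  then show ?thesis using True by (simp add: tendsto_eventually)
next
  case False
  let ?P = "\<lambda>x. prob {\<omega> \<in> space M. x < Y 0 \<omega>}"
  (* The factor 1 gives the lower bound the syntactic form of the scaling lemmas. *)
  let ?l = "\<lambda>x. real n * (?P (1 * x) / g x) - (real n)\<^sup>2 * ((?P (1 * x))\<^sup>2 / g x)"
  let ?u = "\<lambda>\<delta> x. real n * (?P ((1 - \<delta>) * x) / g x) + (real n)\<^sup>2 * ((?P (\<delta> / real n * x))\<^sup>2 / g x)"
  let ?U = "\<lambda>\<delta>. real n * (d * (1 - \<delta>) powr - \<tau>) + (real n)\<^sup>2 * 0"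
  have upper: "prob {\<omega> \<in> space M. x < (\<Sum>i<n. Y i \<omega>)} / g x \<le> ?u \<delta> x"
    if \<delta>: "0 < \<delta>" "\<delta> < 1" and x: "0 < x" for \<delta> x
  proof -
    let ?J = "{(i, j). i < n \<and> j < n \<and> i \<noteq> j}"
    let ?E = "\<lambda>(i, j). {\<omega> \<in> space M. \<delta> / real n * x < Y i \<omega> \<and> \<delta> / real n * x < Y j \<omega>}"
    have sub: "?J \<subseteq> {..<n} \<times> {..<n}" by auto
    then have fin: "finite ?J" by (rule finite_subset) auto
    have "card ?J \<le> n * n" using card_mono[OF _ sub] by simp
    then have card: "real (card ?J) \<le> (real n)\<^sup>2"
      unfolding power2_eq_square of_nat_mult[symmetric] of_nat_le_iff .
    have "prob {\<omega> \<in> space M. x < (\<Sum>i<n. Y i \<omega>)} \<le>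
        prob ((\<Union>i\<in>{..<n}. {\<omega> \<in> space M. (1 - \<delta>) * x < Y i \<omega>}) \<union> (\<Union>ij\<in>?J. ?E ij))"
    proof (intro finite_measure_mono subsetI)
      fix \<omega> assume "\<omega> \<in> {\<omega> \<in> space M. x < (\<Sum>i<n. Y i \<omega>)}"
      then have \<omega>: "\<omega> \<in> space M" "x < (\<Sum>i<n. Y i \<omega>)" by auto
      from sum_large_imp[OF \<delta> x \<omega>(2)]
      consider (one) i where "i < n" "(1 - \<delta>) * x < Y i \<omega>"
        | (two) i j where "i < n" "j < n" "i \<noteq> j"
            "\<delta> / real n * x < Y i \<omega>" "\<delta> / real n * x < Y j \<omega>"
        by blast
      then show "\<omega> \<in> (\<Union>i\<in>{..<n}. {\<omega> \<in> space M. (1 - \<delta>) * x < Y i \<omega>}) \<union> (\<Union>ij\<in>?J. ?E ij)"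
      proof cases
        case one
        with \<omega> show ?thesis by (intro UnI1 UN_I[of i]) auto
      next
        case two
        with \<omega> show ?thesis by (intro UnI2 UN_I[of "(i, j)"]) auto
      qed
    next
      show "(\<Union>i\<in>{..<n}. {\<omega> \<in> space M. (1 - \<delta>) * x < Y i \<omega>}) \<union> (\<Union>ij\<in>?J. ?E ij) \<in> events"
        by (intro sets.Un sets.finite_UN fin) auto
    qed
    also have "\<dots> \<le> prob (\<Union>i\<in>{..<n}. {\<omega> \<in> space M. (1 - \<delta>) * x < Y i \<omega>}) + prob (\<Union>ij\<in>?J. ?E ij)"
      using fin by (intro measure_Un_le) (auto intro!: sets.finite_UN)
    also have "prob (\<Union>i\<in>{..<n}. {\<omega> \<in> space M. (1 - \<delta>) * x < Y i \<omega>})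
        \<le> (\<Sum>i\<in>{..<n}. prob {\<omega> \<in> space M. (1 - \<delta>) * x < Y i \<omega>})"
      by (intro finite_measure_subadditive_finite) auto
    also have "\<dots> = real n * ?P ((1 - \<delta>) * x)"
      by (subst sum.cong[OF refl prob_Y_eq]) simp
    also have "prob (\<Union>ij\<in>?J. ?E ij) \<le> (\<Sum>ij\<in>?J. prob (?E ij))"
      using fin by (intro finite_measure_subadditive_finite) auto
    also have "\<dots> = (\<Sum>ij\<in>?J. (?P (\<delta> / real n * x))\<^sup>2)"
      by (intro sum.cong refl) (auto simp: prob_two_large)
    also have "\<dots> \<le> (real n)\<^sup>2 * (?P (\<delta> / real n * x))\<^sup>2"
      using card by (simp add: mult_right_mono)
    finally have "prob {\<omega> \<in> space M. x < (\<Sum>i<n. Y i \<omega>)} / g x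
        \<le> (real n * ?P ((1 - \<delta>) * x) + (real n)\<^sup>2 * (?P (\<delta> / real n * x))\<^sup>2) / g x"
      using tail_pos[of x] by (intro divide_right_mono) auto
    then show ?thesis by (simp add: add_divide_distrib)
  qed
  have upper_lim: "(?u \<delta> \<longlongrightarrow> ?U \<delta>) at_top" if "0 < \<delta>" "\<delta> < 1" for \<delta>
    using that False by (intro tendsto_intros prob_Y_tail_scale prob_Y_sq_negligible) auto
  have lower_lim0: "((\<lambda>x. real n * (?P (1 * x) / g x) - (real n)\<^sup>2 * ((?P (1 * x))\<^sup>2 / g x))
        \<longlongrightarrow> real n * (d * 1 powr - \<tau>) - (real n)\<^sup>2 * 0) at_top"
      by (intro tendsto_intros prob_Y_tail_scale prob_Y_sq_negligible) auto
  then have lower_lim: "(?l \<longlongrightarrow> real n * d) at_top" by simp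
  have lower: "real n * (?P (1 * x) / g x) - (real n)\<^sup>2 * ((?P (1 * x))\<^sup>2 / g x)
        \<le> prob {\<omega> \<in> space M. x < (\<Sum>i<n. Y i \<omega>)} / g x" for x
    proof -
      have "real n * ?P x - (real n)\<^sup>2 * (?P x)\<^sup>2 \<le> prob {\<omega> \<in> space M. \<exists>i<n. x < Y i \<omega>}"
        by (rule prob_some_large)
      also have "\<dots> \<le> prob {\<omega> \<in> space M. x < (\<Sum>i<n. Y i \<omega>)}"
      proof (intro finite_measure_mono subsetI)
        fix \<omega> assume "\<omega> \<in> {\<omega> \<in> space M. \<exists>i<n. x < Y i \<omega>}"
        then obtain i where i: "i < n" "x < Y i \<omega>" "\<omega> \<in> space M" by auto
        have "Y i \<omega> \<le> (\<Sum>i<n. Y i \<omega>)" using i nonneg_Y by (intro member_le_sum) auto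
        with i show "\<omega> \<in> {\<omega> \<in> space M. x < (\<Sum>i<n. Y i \<omega>)}" by auto
      qed auto
      finally have "(real n * ?P x - (real n)\<^sup>2 * (?P x)\<^sup>2) / g x \<le> prob {\<omega> \<in> space M. x < (\<Sum>i<n. Y i \<omega>)} / g x"
        using tail_pos[of x] by (intro divide_right_mono) auto
      then show ?thesis by (simp add: diff_divide_distrib)
    qed
  have "(?U \<longlongrightarrow> real n * (d * 1) + (real n)\<^sup>2 * 0) (at_right 0)"
    by (intro tendsto_intros powr_scale_tendsto_1)
  then have U: "(?U \<longlongrightarrow> real n * d) (at_right 0)" by simp
  show ?thesis
  proof (rule tendsto_sandwich_approx[where l="\<lambda>_. ?l" and u="?u" and L="\<lambda>_. real n * d" and U="?U"])
    show "\<forall>\<^sub>F \<delta> in at_right 0. (\<forall>\<^sub>F x in at_top.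
        prob {\<omega> \<in> space M. x < (\<Sum>i<n. Y i \<omega>)} / g x \<le> ?u \<delta> x) \<and> (?u \<delta> \<longlongrightarrow> ?U \<delta>) at_top"
      by (intro eventually_at_right_0I[of 1] conjI upper_lim
          eventually_mono[OF eventually_gt_at_top[of 0]] upper) auto
    show "\<forall>\<^sub>F \<delta>::real in at_right 0. (\<forall>\<^sub>F x in at_top.
        ?l x \<le> prob {\<omega> \<in> space M. x < (\<Sum>i<n. Y i \<omega>)} / g x) \<and> (?l \<longlongrightarrow> real n * d) at_top"
      by (intro always_eventually allI conjI lower lower_lim)
  qed (intro tendsto_const U)+
qed

text \<open>
  Markov's inequality for the exponential of the sum, which factorises by independence. The function
  \<open>\<phi>\<close> is a truncation in one application and a multiple of \<open>- id\<close> in the other.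
\<close>

lemma chernoff:
  assumes [measurable]: "\<phi> \<in> borel_measurable borel"
    and mgf: "(\<integral>\<^sup>+\<omega>. ennreal (exp (\<phi> (Y 0 \<omega>))) \<partial>M) \<le> ennreal (exp c)"
  shows "prob {\<omega> \<in> space M. real n * c + y \<le> (\<Sum>i<n. \<phi> (Y i \<omega>))} \<le> exp (- y)"
proof -
  have same: "(\<integral>\<^sup>+\<omega>. ennreal (exp (\<phi> (Y i \<omega>))) \<partial>M) = (\<integral>\<^sup>+\<omega>. ennreal (exp (\<phi> (Y 0 \<omega>))) \<partial>M)" for i
  proof -
    have "(\<integral>\<^sup>+\<omega>. ennreal (exp (\<phi> (Y j \<omega>))) \<partial>M) = (\<integral>\<^sup>+v. ennreal (exp (\<phi> v)) \<partial>distr M borel (Y j))" for j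
      by (subst nn_integral_distr) auto
    then show ?thesis using ident_Y[of i] by simp
  qed
  let ?Z = "\<lambda>\<omega>. \<Sum>i<n. \<phi> (Y i \<omega>)"
  have ind: "indep_vars (\<lambda>_. borel) (\<lambda>i \<omega>. ennreal (exp (\<phi> (Y i \<omega>)))) {..<n}"
    by (rule indep_vars_compose2[OF indep_vars_subset[OF indep_Y]]) auto
  have "(\<integral>\<^sup>+\<omega>. ennreal (exp (?Z \<omega>)) \<partial>M) = (\<integral>\<^sup>+\<omega>. (\<Prod>i<n. ennreal (exp (\<phi> (Y i \<omega>)))) \<partial>M)"
    by (intro nn_integral_cong) (simp add: exp_sum prod_ennreal)
  also have "\<dots> = (\<Prod>i<n. \<integral>\<^sup>+\<omega>. ennreal (exp (\<phi> (Y i \<omega>))) \<partial>M)"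
    by (rule indep_vars_nn_integral) (use ind in auto)
  also have "\<dots> \<le> (\<Prod>i<n. ennreal (exp c))"
    by (intro prod_mono_ennreal) (metis same mgf)
  also have "\<dots> = ennreal (exp (real n * c))"
    by (simp add: ennreal_power exp_of_nat_mult)
  finally have le: "(\<integral>\<^sup>+\<omega>. ennreal (exp (?Z \<omega>)) \<partial>M) \<le> ennreal (exp (real n * c))" .
  have "emeasure M {\<omega> \<in> space M. real n * c + y \<le> ?Z \<omega>} \<le>
      emeasure M {\<omega> \<in> space M. 1 \<le> ennreal (exp (- (real n * c + y))) * ennreal (exp (?Z \<omega>))}"
  proof (intro emeasure_mono subsetI)
    fix \<omega> assume "\<omega> \<in> {\<omega> \<in> space M. real n * c + y \<le> ?Z \<omega>}"
    then have "\<omega> \<in> space M" "1 \<le> exp (- (real n * c + y)) * exp (?Z \<omega>)"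
      by (auto simp flip: exp_add)
    then show "\<omega> \<in> {\<omega> \<in> space M. 1 \<le> ennreal (exp (- (real n * c + y))) * ennreal (exp (?Z \<omega>))}"
      by (simp flip: ennreal_mult)
  qed auto
  also have "\<dots> \<le> ennreal (exp (- (real n * c + y))) * (\<integral>\<^sup>+\<omega>. ennreal (exp (?Z \<omega>)) * indicator (space M) \<omega> \<partial>M)"
    by (intro nn_integral_Markov_inequality) auto
  also have "(\<integral>\<^sup>+\<omega>. ennreal (exp (?Z \<omega>)) * indicator (space M) \<omega> \<partial>M) = (\<integral>\<^sup>+\<omega>. ennreal (exp (?Z \<omega>)) \<partial>M)"
    by (intro nn_integral_cong) auto
  also have "ennreal (exp (- (real n * c + y))) * \<dots> \<le> ennreal (exp (- (real n * c + y))) * ennreal (exp (real n * c))"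
    by (intro mult_left_mono le) auto
  also have "\<dots> = ennreal (exp (- y))"
    by (simp flip: ennreal_mult exp_add)
  finally show ?thesis
    by (simp add: emeasure_eq_measure)
qed

text \<open>
  The variables are nonnegative, so their Laplace transform \<open>L \<theta> = E (exp (- \<theta> Y))\<close> exists for
  \<open>\<theta> > 0\<close>, and \<open>(1 - L \<theta>) / \<theta>\<close> tends to the mean as \<open>\<theta>\<close> decreases to \<open>0\<close>. A small \<open>\<theta>\<close> therefore makes
  the Chernoff bound exponentially small.
\<close>

lemma lower_deviation:
  assumes "0 < \<epsilon>"
  shows "(\<lambda>n. prob {\<omega> \<in> space M. (\<Sum>i<n. Y i \<omega>) \<le> (\<mu> - \<epsilon>) * real n}) \<longlonglongrightarrow> 0"
proof -
  have "(\<lambda>k. expectation (\<lambda>\<omega>. real (Suc k) * (1 - exp (- Y 0 \<omega> / real (Suc k))))) \<longlonglongrightarrow> expectation (Y 0)"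
  proof (rule integral_dominated_convergence)
    show "AE \<omega> in M. (\<lambda>k. real (Suc k) * (1 - exp (- Y 0 \<omega> / real (Suc k)))) \<longlonglongrightarrow> Y 0 \<omega>"
    proof (intro AE_I2)
      fix \<omega>
      have "(\<lambda>k. real k * (1 - exp (- Y 0 \<omega> / real k))) \<longlonglongrightarrow> Y 0 \<omega>" by real_asymp
      then show "(\<lambda>k. real (Suc k) * (1 - exp (- Y 0 \<omega> / real (Suc k)))) \<longlonglongrightarrow> Y 0 \<omega>"
        by (rule LIMSEQ_Suc)
    qed
    show "AE \<omega> in M. norm (real (Suc k) * (1 - exp (- Y 0 \<omega> / real (Suc k)))) \<le> Y 0 \<omega>" for k
    proof (intro AE_I2)
      fix \<omega>
      have "1 + (- Y 0 \<omega> / real (Suc k)) \<le> exp (- Y 0 \<omega> / real (Suc k))" by (rule exp_ge_add_one_self)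
      then have "1 - exp (- Y 0 \<omega> / real (Suc k)) \<le> Y 0 \<omega> / real (Suc k)" by simp
      then have "real (Suc k) * (1 - exp (- Y 0 \<omega> / real (Suc k))) \<le> real (Suc k) * (Y 0 \<omega> / real (Suc k))"
        by (rule mult_left_mono) auto
      moreover have "0 \<le> real (Suc k) * (1 - exp (- Y 0 \<omega> / real (Suc k)))"
        using nonneg_Y[of 0 \<omega>] by (intro mult_nonneg_nonneg) auto
      ultimately show "norm (real (Suc k) * (1 - exp (- Y 0 \<omega> / real (Suc k)))) \<le> Y 0 \<omega>" by simp
    qed
  qed (use integrable_Y in auto)
  from order_tendstoD(1)[OF this, of "\<mu> - \<epsilon> / 2"] assms
  obtain k where "\<mu> - \<epsilon> / 2 < expectation (\<lambda>\<omega>. real (Suc k) * (1 - exp (- Y 0 \<omega> / real (Suc k))))"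
    by (auto simp: mean_Y eventually_sequentially)
  moreover define \<theta> where "\<theta> = 1 / real (Suc k)"
  ultimately have \<theta>: "0 < \<theta>" and k: "\<mu> - \<epsilon> / 2 < expectation (\<lambda>\<omega>. 1 / \<theta> * (1 - exp (- \<theta> * Y 0 \<omega>)))"
    by auto
  have int: "integrable M (\<lambda>\<omega>. exp (- \<theta> * Y 0 \<omega>))"
    using \<theta> nonneg_Y by (intro integrable_const_bound[of _ 1]) auto
  have "expectation (\<lambda>\<omega>. 1 / \<theta> * (1 - exp (- \<theta> * Y 0 \<omega>))) = 1 / \<theta> * (1 - expectation (\<lambda>\<omega>. exp (- \<theta> * Y 0 \<omega>)))"
    using int by (subst integral_mult_right_zero, subst Bochner_Integration.integral_diff) (auto simp: prob_space)
  with k \<theta> have "expectation (\<lambda>\<omega>. exp (- \<theta> * Y 0 \<omega>)) \<le> 1 + (- \<theta> * (\<mu> - \<epsilon> / 2))"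
    by (simp add: field_simps)
  also have "\<dots> \<le> exp (- \<theta> * (\<mu> - \<epsilon> / 2))" by (rule exp_ge_add_one_self)
  finally have "(\<integral>\<^sup>+\<omega>. ennreal (exp (- \<theta> * Y 0 \<omega>)) \<partial>M) \<le> ennreal (exp (- \<theta> * (\<mu> - \<epsilon> / 2)))"
    using int by (subst nn_integral_eq_integral) auto
  then have bound: "prob {\<omega> \<in> space M. real n * (- \<theta> * (\<mu> - \<epsilon> / 2)) + real n * (\<theta> * \<epsilon> / 2) \<le> (\<Sum>i<n. - \<theta> * Y i \<omega>)}
      \<le> exp (- (real n * (\<theta> * \<epsilon> / 2)))" for n
    by (intro chernoff) auto
  have "{\<omega> \<in> space M. (\<Sum>i<n. Y i \<omega>) \<le> (\<mu> - \<epsilon>) * real n} =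
      {\<omega> \<in> space M. real n * (- \<theta> * (\<mu> - \<epsilon> / 2)) + real n * (\<theta> * \<epsilon> / 2) \<le> (\<Sum>i<n. - \<theta> * Y i \<omega>)}" for n
  proof -
    have "(real n * (- \<theta> * (\<mu> - \<epsilon> / 2)) + real n * (\<theta> * \<epsilon> / 2) \<le> (\<Sum>i<n. - \<theta> * Y i \<omega>)) \<longleftrightarrow>
        \<theta> * (\<Sum>i<n. Y i \<omega>) \<le> \<theta> * ((\<mu> - \<epsilon>) * real n)" for \<omega>
      by (simp add: sum_negf sum_distrib_left[symmetric] algebra_simps)
    then show ?thesis using \<theta> by simp
  qed
  with bound have bound': "prob {\<omega> \<in> space M. (\<Sum>i<n. Y i \<omega>) \<le> (\<mu> - \<epsilon>) * real n}
      \<le> exp (- (real n * (\<theta> * \<epsilon> / 2)))" for n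
    by metis
  have *: "(\<lambda>n. exp (- (real n * c))) \<longlonglongrightarrow> 0" if "0 < c" for c :: real
    using that by real_asymp
  have lim: "(\<lambda>n. exp (- (real n * (\<theta> * \<epsilon> / 2)))) \<longlonglongrightarrow> 0"
    by (rule *) (use \<theta> assms in simp)
  show ?thesis
  proof (rule tendsto_sandwich)
    show "\<forall>\<^sub>F n in sequentially. prob {\<omega> \<in> space M. (\<Sum>i<n. Y i \<omega>) \<le> (\<mu> - \<epsilon>) * real n}
        \<le> exp (- (real n * (\<theta> * \<epsilon> / 2)))"
      by (intro always_eventually allI bound')
    show "\<forall>\<^sub>F n in sequentially. 0 \<le> prob {\<omega> \<in> space M. (\<Sum>i<n. Y i \<omega>) \<le> (\<mu> - \<epsilon>) * real n}"
      by simp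
  qed (rule tendsto_const lim)+
qed

end

section \<open>A tail bound linear in the number of summands\<close>

text \<open>
  A substitute for a Taylor expansion of the exponential of a truncated variable. It starts from
  \<open>exp u \<le> 1 + u exp u\<close>. For \<open>y \<le> sqrt x\<close> the factor \<open>exp u\<close> is close to \<open>1\<close> in the application. For
  larger \<open>y\<close> it is at most \<open>x powr \<gamma>\<close>, and the surplus of the moment of order \<open>1 + \<eta>\<close> over the first
  moment gains the factor \<open>x powr (\<eta> / 2)\<close>.
\<close>

lemma exp_truncated_le:
  fixes y s z \<gamma> \<eta> x :: real
  assumes "0 \<le> y" "0 < s" "1 \<le> x" "0 < \<eta>" "0 \<le> z" and z: "exp (s * z) \<le> x powr \<gamma>"
  shows "exp (s * min y z) \<le> 1 + s * (exp (s * sqrt x) * y + x powr (\<gamma> - \<eta> / 2) * y powr (1 + \<eta>))"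
proof -
  have *: "exp u \<le> 1 + u * exp u" for u :: real
  proof -
    have "(1 + - u) * exp u \<le> exp (- u) * exp u"
      by (intro mult_right_mono exp_ge_add_one_self) auto
    also have "\<dots> = 1" by (simp flip: exp_add)
    finally show ?thesis by (simp add: algebra_simps)
  qed
  have m: "0 \<le> min y z" "min y z \<le> y" "min y z \<le> z" using assms by auto
  have le: "s * min y z * exp (s * min y z) \<le> s * (y * v)" if "exp (s * min y z) \<le> v" for v
    unfolding mult.assoc using assms m that by (intro mult_mono) auto
  show ?thesis
  proof (cases "y \<le> sqrt x")
    case True
    then have "exp (s * min y z) \<le> exp (s * sqrt x)" using assms by (auto simp: min_def)
    from le[OF this] have "s * min y z * exp (s * min y z) \<le> s * (y * exp (s * sqrt x))" .
    also have "\<dots> \<le> s * (exp (s * sqrt x) * y + x powr (\<gamma> - \<eta> / 2) * y powr (1 + \<eta>))"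
      using assms by (intro mult_left_mono) (auto simp: mult.commute)
    finally show ?thesis using *[of "s * min y z"] by linarith
  next
    case False
    then have y: "sqrt x < y" "0 < y" using assms by (auto intro: le_less_trans[of _ "sqrt x"])
    have "exp (s * min y z) \<le> exp (s * z)" using assms by auto
    also note z
    finally have "s * min y z * exp (s * min y z) \<le> s * (y * x powr \<gamma>)" by (rule le)
    also have "x powr (\<eta> / 2) \<le> y powr \<eta>"
    proof -
      have "x powr (\<eta> / 2) = (sqrt x) powr \<eta>"
        using assms by (simp add: powr_half_sqrt[symmetric] powr_powr)
      also have "\<dots> \<le> y powr \<eta>" using assms y by (intro powr_mono2) auto
      finally show ?thesis .
    qed
    then have "x powr \<gamma> * y \<le> x powr (\<gamma> - \<eta> / 2) * y powr (1 + \<eta>)"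
    proof -
      have "x powr \<gamma> * y = x powr (\<gamma> - \<eta> / 2) * y * x powr (\<eta> / 2)"
        using assms by (simp add: powr_add[symmetric])
      also have "\<dots> \<le> x powr (\<gamma> - \<eta> / 2) * y * y powr \<eta>"
        using \<open>x powr (\<eta> / 2) \<le> y powr \<eta>\<close> y by (intro mult_left_mono) auto
      also have "\<dots> = x powr (\<gamma> - \<eta> / 2) * y powr (1 + \<eta>)"
        using y by (simp add: powr_add)
      finally show ?thesis .
    qed
    then have "s * (y * x powr \<gamma>) \<le> s * (exp (s * sqrt x) * y + x powr (\<gamma> - \<eta> / 2) * y powr (1 + \<eta>))"
      using assms by (intro mult_left_mono) (auto simp: mult.commute intro: add_increasing)
    finally show ?thesis using *[of "s * min y z"] by linarith
  qed
qed

context iid_heavy_tail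
begin

text \<open>
  The tail is below \<open>x powr - s\<close> for some \<open>s > 1 + \<eta> > 1\<close>, so the tail probabilities of
  \<open>Y powr (1 + \<eta>)\<close> are summable.
\<close>

lemma moment_beyond_mean:
  obtains \<eta> where "0 < \<eta>" "integrable M (\<lambda>\<omega>. Y 0 \<omega> powr (1 + \<eta>))"
proof -
  define s where "s = (1 + \<tau>) / 2"
  define \<eta> where "\<eta> = (s - 1) / 2"
  have s: "1 < s" "s < \<tau>" using index_gt_1 by (auto simp: s_def)
  then have \<eta>: "0 < \<eta>" "1 + \<eta> < s" by (auto simp: \<eta>_def field_simps)
  obtain B where B: "0 < B" "\<And>x. 0 < x \<Longrightarrow> g x \<le> B * x powr - s"
    using tail_le_powr[of s] s by auto
  obtain B' where B': "0 < B'" "\<And>i x. 0 \<le> x \<Longrightarrow> prob {\<omega> \<in> space M. x < Y i \<omega>} \<le> B' * g x"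
    using prob_Y_le_tail by blast
  (* Rounding up makes the expectation a sum of tail probabilities. *)
  define N where "N \<omega> = nat \<lceil>Y 0 \<omega> powr (1 + \<eta>)\<rceil>" for \<omega>
  have [measurable]: "N \<in> measurable M (count_space UNIV)" unfolding N_def by measurable
  have "prob {\<omega> \<in> space M. t < N \<omega>} \<le> max (B' * B) 1 * (if t = 0 then 1 else real t powr (- s / (1 + \<eta>)))" for t
  proof (cases "t = 0")
    case True
    then show ?thesis by (auto intro: order_trans[OF prob_le_1])
  next
    case False
    define x where "x = real t powr (1 / (1 + \<eta>))"
    have x: "0 < x" using False by (simp add: x_def)
    have "{\<omega> \<in> space M. t < N \<omega>} \<subseteq> {\<omega> \<in> space M. x < Y 0 \<omega>}"
    proof safe
      fix \<omega> assume "t < N \<omega>"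
      then have "real t < Y 0 \<omega> powr (1 + \<eta>)" unfolding N_def by linarith
      then have "x < (Y 0 \<omega> powr (1 + \<eta>)) powr (1 / (1 + \<eta>))"
        unfolding x_def using \<eta> by (intro powr_less_mono2) auto
      then show "x < Y 0 \<omega>" using \<eta> nonneg_Y[of 0 \<omega>] by (simp add: powr_powr)
    qed
    then have "prob {\<omega> \<in> space M. t < N \<omega>} \<le> prob {\<omega> \<in> space M. x < Y 0 \<omega>}"
      by (intro finite_measure_mono) auto
    also have "\<dots> \<le> B' * g x" using x by (intro B') auto
    also have "\<dots> \<le> B' * (B * x powr - s)" using x B B' by (intro mult_left_mono) auto
    also have "x powr - s = real t powr (- s / (1 + \<eta>))" by (simp add: x_def powr_powr)
    also have "B' * (B * real t powr (- s / (1 + \<eta>))) \<le> max (B' * B) 1 * real t powr (- s / (1 + \<eta>))"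
      unfolding mult.assoc[symmetric] by (intro mult_right_mono) auto
    finally show ?thesis using False by simp
  qed
  then have le: "emeasure M {\<omega> \<in> space M. t < N \<omega>} \<le>
      ennreal (max (B' * B) 1 * (if t = 0 then 1 else real t powr (- s / (1 + \<eta>))))" for t
    by (simp add: emeasure_eq_measure)
  have "- s / (1 + \<eta>) < - 1" using \<eta> by (simp add: field_simps)
  then have "summable (\<lambda>t. real t powr (- s / (1 + \<eta>)))" by (simp add: summable_real_powr_iff)
  then have "summable (\<lambda>t. if t = 0 then 1 else real t powr (- s / (1 + \<eta>)))"
    by (rule summable_cong[THEN iffD1, rotated]) (auto simp: eventually_sequentially intro!: exI[of _ 1])
  then have summ: "summable (\<lambda>t. max (B' * B) 1 * (if t = 0 then 1 else real t powr (- s / (1 + \<eta>))))"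
    by (rule summable_mult)
  have "(\<integral>\<^sup>+\<omega>. ennreal (Y 0 \<omega> powr (1 + \<eta>)) \<partial>M) \<le> (\<integral>\<^sup>+\<omega>. of_nat (N \<omega>) \<partial>M)"
    unfolding N_def ennreal_of_nat_eq_real_of_nat
    by (intro nn_integral_mono ennreal_leI) linarith
  also have "\<dots> = (\<Sum>t. emeasure M {\<omega> \<in> space M. t < N \<omega>})"
    by (rule nn_integral_nat_function) measurable
  also have "\<dots> \<le> (\<Sum>t. ennreal (max (B' * B) 1 * (if t = 0 then 1 else real t powr (- s / (1 + \<eta>)))))"
    by (intro suminf_le le) auto
  also have "\<dots> < \<infinity>"
    using summ by (subst suminf_ennreal2) (auto intro!: mult_nonneg_nonneg)
  finally have "integrable M (\<lambda>\<omega>. Y 0 \<omega> powr (1 + \<eta>))"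
    by (intro integrableI_bounded) auto
  with \<eta> show thesis by (intro that)
qed

text \<open>
  With the parameter \<open>s = \<beta> ln x / x\<close> the Chernoff bound at level \<open>x\<close> is the power \<open>x powr - \<beta>\<close>. The
  moment generating function at this \<open>s\<close> exists only for truncated variables. Truncation at \<open>x / A\<close>
  keeps the exponential below \<open>x powr (\<beta> / A)\<close>, and a large \<open>A\<close> makes this exponent small against \<open>\<eta>\<close>.
  The correction to the linear term then vanishes, leaving room for any \<open>m\<close> above the mean.
\<close>

lemma truncated_mgf_le:
  assumes m: "\<mu> < m" and \<beta>: "0 < \<beta>"
  obtains A where "0 < A"
    "\<forall>\<^sub>F x in at_top. (\<integral>\<^sup>+\<omega>. ennreal (exp (\<beta> * ln x / x * min (Y 0 \<omega>) (x / A))) \<partial>M)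
      \<le> ennreal (exp (\<beta> * ln x / x * m))"
proof -
  obtain \<eta> where \<eta>: "0 < \<eta>" and int: "integrable M (\<lambda>\<omega>. Y 0 \<omega> powr (1 + \<eta>))"
    using moment_beyond_mean by blast
  define K where "K = expectation (\<lambda>\<omega>. Y 0 \<omega> powr (1 + \<eta>))"
  (* This makes \<beta> / A = \<eta> / 4, half of the exponent gained in exp_truncated_le. *)
  define A where "A = 4 * \<beta> / \<eta>"
  have "0 < A" using \<beta> \<eta> by (simp add: A_def)
  moreover have "\<forall>\<^sub>F x in at_top. (\<integral>\<^sup>+\<omega>. ennreal (exp (\<beta> * ln x / x * min (Y 0 \<omega>) (x / A))) \<partial>M)
      \<le> ennreal (exp (\<beta> * ln x / x * m))"
  proof -
    have "((\<lambda>x::real. \<beta> * ln x / x * sqrt x) \<longlongrightarrow> 0) at_top" using \<beta> by real_asymp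
    then have "((\<lambda>x. exp (\<beta> * ln x / x * sqrt x)) \<longlongrightarrow> exp 0) at_top" by (rule tendsto_exp)
    moreover have "((\<lambda>x::real. x powr (\<eta> / 4 - \<eta> / 2)) \<longlongrightarrow> 0) at_top"
      using \<eta> by (intro tendsto_neg_powr filterlim_ident) auto
    ultimately have "((\<lambda>x. exp (\<beta> * ln x / x * sqrt x) * \<mu> + x powr (\<eta> / 4 - \<eta> / 2) * K) \<longlongrightarrow>
        exp 0 * \<mu> + 0 * K) at_top"
      by (intro tendsto_add tendsto_mult tendsto_const)
    then have "\<forall>\<^sub>F x in at_top. exp (\<beta> * ln x / x * sqrt x) * \<mu> + x powr (\<eta> / 4 - \<eta> / 2) * K < m"
      by (rule order_tendstoD) (simp add: m)
    with eventually_gt_at_top[of 1] show ?thesis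
    proof eventually_elim
      case (elim x)
      define s where "s = \<beta> * ln x / x"
      have "0 < s" using elim \<beta> by (simp add: s_def)
      have "exp (s * (x / A)) = x powr (\<eta> / 4)"
        using elim \<beta> \<eta> by (simp add: s_def A_def powr_def)
      then have pt: "exp (s * min (Y 0 \<omega>) (x / A)) \<le>
          1 + s * (exp (s * sqrt x) * Y 0 \<omega> + x powr (\<eta> / 4 - \<eta> / 2) * Y 0 \<omega> powr (1 + \<eta>))" for \<omega>
        using elim \<open>0 < s\<close> \<eta> \<open>0 < A\<close> nonneg_Y by (intro exp_truncated_le) auto
      have int': "integrable M (\<lambda>\<omega>. 1 + s * (exp (s * sqrt x) * Y 0 \<omega> + x powr (\<eta> / 4 - \<eta> / 2) * Y 0 \<omega> powr (1 + \<eta>)))"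
        using int integrable_Y by auto
      have "(\<integral>\<^sup>+\<omega>. ennreal (exp (s * min (Y 0 \<omega>) (x / A))) \<partial>M) \<le>
          (\<integral>\<^sup>+\<omega>. ennreal (1 + s * (exp (s * sqrt x) * Y 0 \<omega> + x powr (\<eta> / 4 - \<eta> / 2) * Y 0 \<omega> powr (1 + \<eta>))) \<partial>M)"
        by (intro nn_integral_mono ennreal_leI pt)
      also have "\<dots> = ennreal (expectation (\<lambda>\<omega>. 1 + s * (exp (s * sqrt x) * Y 0 \<omega> + x powr (\<eta> / 4 - \<eta> / 2) * Y 0 \<omega> powr (1 + \<eta>))))"
        using int' \<open>0 < s\<close> nonneg_Y by (intro nn_integral_eq_integral) (auto intro!: add_nonneg_nonneg mult_nonneg_nonneg)
      also have "expectation (\<lambda>\<omega>. 1 + s * (exp (s * sqrt x) * Y 0 \<omega> + x powr (\<eta> / 4 - \<eta> / 2) * Y 0 \<omega> powr (1 + \<eta>)))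
          = 1 + s * (exp (s * sqrt x) * \<mu> + x powr (\<eta> / 4 - \<eta> / 2) * K)"
        using int integrable_Y by (simp add: K_def mean_Y prob_space)
      also have "\<dots> \<le> 1 + s * m"
        using elim \<open>0 < s\<close> by (intro add_left_mono mult_left_mono) (simp_all add: s_def)
      also have "\<dots> \<le> exp (s * m)" by (rule exp_ge_add_one_self)
      finally show ?case by (simp add: s_def ennreal_leI)
    qed
  qed
  ultimately show thesis by (rule that)
qed

text \<open>
  If the sum exceeds \<open>m n + x\<close>, then either some variable exceeds \<open>x / A\<close>, which has a probability
  of order \<open>n g x\<close>, or the sum of the truncated variables deviates. The latter has a probability of at
  most \<open>x powr - \<beta>\<close>, uniformly in \<open>n\<close>, which is below the tail for a suitable \<open>\<beta>\<close>. In contrast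
  to \<open>fixed_sum_tail\<close> the bound can be integrated over a random number \<open>n\<close> of finite mean.
\<close>

lemma sum_tail_bound:
  assumes "\<mu> < m"
  obtains B where "0 < B"
    "\<And>n x. 0 \<le> x \<Longrightarrow> prob {\<omega> \<in> space M. m * real n + x < (\<Sum>i<n. Y i \<omega>)} \<le> B * real n * g x"
proof -
  obtain B0 \<beta> where B0: "0 < B0" "0 < \<beta>" "\<And>x. 1 \<le> x \<Longrightarrow> B0 * x powr - \<beta> \<le> g x"
    using tail_ge_powr by blast
  obtain A where A: "0 < A"
    "\<forall>\<^sub>F x in at_top. (\<integral>\<^sup>+\<omega>. ennreal (exp (\<beta> * ln x / x * min (Y 0 \<omega>) (x / A))) \<partial>M)
      \<le> ennreal (exp (\<beta> * ln x / x * m))"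
    using truncated_mgf_le[OF assms B0(2)] by blast
  from eventually_conj[OF A(2) eventually_gt_at_top[of 1]] obtain x0 where
    x0: "\<And>x. x0 \<le> x \<Longrightarrow> (\<integral>\<^sup>+\<omega>. ennreal (exp (\<beta> * ln x / x * min (Y 0 \<omega>) (x / A))) \<partial>M)
      \<le> ennreal (exp (\<beta> * ln x / x * m))" "\<And>x. x0 \<le> x \<Longrightarrow> 1 < x"
    by (auto simp: eventually_at_top_linorder)
  obtain B1 where B1: "0 < B1" "\<And>i x. 0 \<le> x \<Longrightarrow> prob {\<omega> \<in> space M. x < Y i \<omega>} \<le> B1 * g x"
    using prob_Y_le_tail by blast
  obtain B2 where B2: "0 < B2" "\<And>x. 0 \<le> x \<Longrightarrow> g (1 / A * x) \<le> B2 * g x"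
    using scale_bounded[of "1 / A"] A(1) by auto
  (* The second entry makes the bound trivial for x below x0. *)
  define B where "B = max (B1 * B2 + 1 / B0) (1 / g x0)"
  show thesis
  proof
    show "0 < B" using B0 B1 B2 by (auto simp: B_def less_max_iff_disj intro!: disjI1 add_pos_pos)
    fix n :: nat and x :: real assume "0 \<le> x"
    show "prob {\<omega> \<in> space M. m * real n + x < (\<Sum>i<n. Y i \<omega>)} \<le> B * real n * g x"
    proof (cases "n = 0")
      case True
      then show ?thesis using \<open>0 \<le> x\<close> by simp
    next
      case False
      show ?thesis
      proof (cases "x0 \<le> x")
        case True
        define s where "s = \<beta> * ln x / x"
        have x: "1 < x" by (rule x0(2)[OF True])
        then have s: "0 < s" using B0 by (simp add: s_def)
        have "prob {\<omega> \<in> space M. m * real n + x < (\<Sum>i<n. Y i \<omega>)} \<le>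
            prob ((\<Union>i\<in>{..<n}. {\<omega> \<in> space M. x / A < Y i \<omega>}) \<union>
              {\<omega> \<in> space M. real n * (s * m) + s * x \<le> (\<Sum>i<n. s * min (Y i \<omega>) (x / A))})"
        proof (intro finite_measure_mono subsetI)
          fix \<omega> assume \<omega>: "\<omega> \<in> {\<omega> \<in> space M. m * real n + x < (\<Sum>i<n. Y i \<omega>)}"
          show "\<omega> \<in> (\<Union>i\<in>{..<n}. {\<omega> \<in> space M. x / A < Y i \<omega>}) \<union>
              {\<omega> \<in> space M. real n * (s * m) + s * x \<le> (\<Sum>i<n. s * min (Y i \<omega>) (x / A))}"
          proof (cases "\<forall>i<n. Y i \<omega> \<le> x / A")
            case True
            then have "(\<Sum>i<n. s * min (Y i \<omega>) (x / A)) = (\<Sum>i<n. s * Y i \<omega>)"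
              by (intro sum.cong) auto
            also have "\<dots> = s * (\<Sum>i<n. Y i \<omega>)" by (simp add: sum_distrib_left)
            also have "\<dots> \<ge> s * (m * real n + x)" using \<omega> s by (intro mult_left_mono) auto
            finally show ?thesis using \<omega> by (simp add: algebra_simps)
          qed (use \<omega> in \<open>auto simp: not_le\<close>)
        qed auto
        also have "\<dots> \<le> prob (\<Union>i\<in>{..<n}. {\<omega> \<in> space M. x / A < Y i \<omega>}) +
            prob {\<omega> \<in> space M. real n * (s * m) + s * x \<le> (\<Sum>i<n. s * min (Y i \<omega>) (x / A))}"
          by (intro measure_Un_le) auto
        also have "prob (\<Union>i\<in>{..<n}. {\<omega> \<in> space M. x / A < Y i \<omega>}) \<le> (\<Sum>i\<in>{..<n}. prob {\<omega> \<in> space M. x / A < Y i \<omega>})"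
          by (intro finite_measure_subadditive_finite) auto
        also have "\<dots> \<le> (\<Sum>i\<in>{..<n}. B1 * (B2 * g x))"
        proof (intro sum_mono)
          fix i
          have "prob {\<omega> \<in> space M. x / A < Y i \<omega>} \<le> B1 * g (x / A)"
            using x A by (intro B1) auto
          also have "\<dots> \<le> B1 * (B2 * g x)"
            using B2(2)[of x] x B1 by (intro mult_left_mono) auto
          finally show "prob {\<omega> \<in> space M. x / A < Y i \<omega>} \<le> B1 * (B2 * g x)" .
        qed
        also have "\<dots> = real n * (B1 * B2 * g x)" by simp
        also have "prob {\<omega> \<in> space M. real n * (s * m) + s * x \<le> (\<Sum>i<n. s * min (Y i \<omega>) (x / A))} \<le> exp (- (s * x))"
          using x0(1)[OF True] by (intro chernoff) (auto simp: s_def)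
        also have "exp (- (s * x)) = x powr - \<beta>" using x by (simp add: s_def powr_def)
        also have "x powr - \<beta> \<le> 1 / B0 * g x"
          using B0 x by (simp add: field_simps)
        also have "\<dots> \<le> real n * (1 / B0 * g x)"
          using False B0 tail_pos[of x] by (simp add: field_simps)
        finally have "prob {\<omega> \<in> space M. m * real n + x < (\<Sum>i<n. Y i \<omega>)} \<le> (B1 * B2 + 1 / B0) * (real n * g x)"
          by (simp add: algebra_simps)
        also have "\<dots> \<le> B * (real n * g x)"
          using tail_pos[of x] by (intro mult_right_mono) (auto simp: B_def)
        finally show ?thesis by (simp add: mult.assoc)
      next
        case False
        then have "g x0 \<le> g x" by (intro tail_antimono) auto
        then have "1 \<le> 1 / g x0 * g x" using tail_pos[of x0] by (simp add: field_simps)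
        also have "\<dots> \<le> real n * (1 / g x0 * g x)"
          using \<open>n \<noteq> 0\<close> tail_pos[of x0] tail_pos[of x] by (simp add: field_simps)
        also have "\<dots> \<le> real n * (B * g x)"
          using tail_pos[of x] by (intro mult_left_mono mult_right_mono) (auto simp: B_def)
        finally show ?thesis
          using prob_le_1[of "{\<omega> \<in> space M. m * real n + x < (\<Sum>i<n. Y i \<omega>)}"]
          unfolding mult.assoc mult.left_commute[of B] by linarith
      qed
    qed
  qed
qed

end

section \<open>Sums of random length started from a random level\<close>

context regularly_varying_tail
begin

text \<open>
  Think of \<open>h n t\<close> as the probability that the sum of \<open>n\<close> fresh variables of mean \<open>\<mu>\<close> and one
  exceptional variable exceeds \<open>t\<close>; then the integral is the probability that \<open>W\<close> plus a sum of
  random length \<open>X\<close> exceeds \<open>x\<close>. Since \<open>W\<close> and \<open>X\<close> may be dependent, the past enters through the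
  tails of all combinations \<open>W + c X\<close>.
  
  Where \<open>W + (\<mu> + \<delta>) X \<le> (1 - \<delta>) x\<close>, a fresh sum must overshoot its mean by \<open>\<delta> x\<close>; there the uniform
  bound dominates, and the limit is that of a single big fresh variable, of which there are \<open>X + 1\<close>.
  Where \<open>W + (\<mu> - \<delta>) X > (1 + \<delta>) x\<close>, the fresh sum reaches the level with probability close to \<open>1\<close>
  by the law of large numbers. The remaining outcomes have a probability that vanishes relative to
  \<open>g x\<close> as \<open>\<delta>\<close> decreases to \<open>0\<close>, by continuity of \<open>C\<close>.
\<close>

lemma random_sum_tail:
  fixes N :: "'b measure" and W :: "'b \<Rightarrow> real" and X :: "'b \<Rightarrow> nat"
    and h :: "nat \<Rightarrow> real \<Rightarrow> real" and C :: "real \<Rightarrow> real"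
  assumes "prob_space N"
    and W [measurable]: "W \<in> borel_measurable N" and X [measurable]: "X \<in> measurable N (count_space UNIV)"
    and X_int: "integrable N (\<lambda>\<omega>. real (X \<omega>))"
    and h_range: "\<And>n t. 0 \<le> h n t" "\<And>n t. h n t \<le> 1"
    and h_antimono: "\<And>n s t. s \<le> t \<Longrightarrow> h n t \<le> h n s"
    and h_neg: "\<And>n t. t < 0 \<Longrightarrow> h n t = 1"
    and h_tail: "\<And>n y. ((\<lambda>x. h n (x - y) / g x) \<longlongrightarrow> (real n + 1) * d) at_top"
    and h_upper: "\<And>m. \<mu> < m \<Longrightarrow> \<exists>B. \<forall>n. \<forall>x\<ge>0. h n (m * real n + x) \<le> B * (real n + 1) * g x"
    and h_lower: "\<And>m. m < \<mu> \<Longrightarrow> (\<lambda>n. h n (m * real n)) \<longlonglongrightarrow> 1"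
    and \<mu>: "0 < \<mu>"
    and linear_tail: "\<And>c. 0 \<le> c \<Longrightarrow>
      ((\<lambda>x. measure N {\<omega> \<in> space N. x < W \<omega> + c * real (X \<omega>)} / g x) \<longlongrightarrow> C c) at_top"
    and C_cont: "isCont C \<mu>"
  shows "((\<lambda>x. (\<integral>\<omega>. h (X \<omega>) (x - W \<omega>) \<partial>N) / g x) \<longlongrightarrow>
      C \<mu> + ((\<integral>\<omega>. real (X \<omega>) \<partial>N) + 1) * d) at_top"
proof -
  interpret N: prob_space N by fact
  let ?Z = "\<lambda>c \<omega>. W \<omega> + c * real (X \<omega>)"
  let ?E = "(\<integral>\<omega>. real (X \<omega>) \<partial>N)"
  have h_meas [measurable]: "h n \<in> borel_measurable borel" for n
    by (intro borel_measurable_antimono antimonoI h_antimono)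
  have [measurable]: "(\<lambda>\<omega>. h (X \<omega>) (x - W \<omega>)) \<in> borel_measurable N" for x
    by (rule measurable_compose_countable[OF _ X]) measurable
  have h_int: "integrable N (\<lambda>\<omega>. h (X \<omega>) (x - W \<omega>) * indicat_real A \<omega>)" if [measurable]: "A \<in> sets N" for x A
    using h_range by (intro N.integrable_const_bound[of _ 1]) (auto simp: indicator_def)
  have h_int1: "integrable N (\<lambda>\<omega>. h (X \<omega>) (x - W \<omega>))" for x
    using h_range by (intro N.integrable_const_bound[of _ 1]) auto

  define small where "small \<delta> x = {\<omega> \<in> space N. ?Z (\<mu> + \<delta>) \<omega> \<le> (1 - \<delta>) * x}" for \<delta> x
  have [measurable]: "small \<delta> x \<in> sets N" for \<delta> x unfolding small_def by measurable
  have middle: "((\<lambda>x. \<integral>\<omega>. h (X \<omega>) (x - W \<omega>) * indicat_real (small \<delta> x) \<omega> / g x \<partial>N) \<longlongrightarrow> (?E + 1) * d) at_top"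
    if \<delta>: "0 < \<delta>" "\<delta> < 1" for \<delta>
  proof -
    obtain B where B: "\<And>n x. 0 \<le> x \<Longrightarrow> h n ((\<mu> + \<delta>) * real n + x) \<le> B * (real n + 1) * g x"
      using h_upper[of "\<mu> + \<delta>"] \<delta> by auto
    obtain B' where B': "0 < B'" "\<And>x. 0 \<le> x \<Longrightarrow> g (\<delta> * x) \<le> B' * g x"
      using scale_bounded[OF \<delta>(1)] by auto
    have "((\<lambda>x. \<integral>\<omega>. h (X \<omega>) (x - W \<omega>) * indicat_real (small \<delta> x) \<omega> / g x \<partial>N)
        \<longlongrightarrow> (\<integral>\<omega>. (real (X \<omega>) + 1) * d \<partial>N)) at_top"
    proof (rule integral_dominated_convergence_at_top)
      show "integrable N (\<lambda>\<omega>. \<bar>B\<bar> * B' * (real (X \<omega>) + 1))" using X_int by simp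
      show "\<forall>\<^sub>F x in at_top. AE \<omega> in N. norm (h (X \<omega>) (x - W \<omega>) * indicat_real (small \<delta> x) \<omega> / g x)
          \<le> \<bar>B\<bar> * B' * (real (X \<omega>) + 1)"
        using eventually_gt_at_top[of 0]
      proof (eventually_elim, intro AE_I2)
        fix x :: real and \<omega> assume x: "0 < x"
        show "norm (h (X \<omega>) (x - W \<omega>) * indicat_real (small \<delta> x) \<omega> / g x) \<le> \<bar>B\<bar> * B' * (real (X \<omega>) + 1)"
        proof (cases "\<omega> \<in> small \<delta> x")
          case True
          then have "(\<mu> + \<delta>) * real (X \<omega>) + \<delta> * x \<le> x - W \<omega>"
            by (simp add: small_def algebra_simps)
          then have "h (X \<omega>) (x - W \<omega>) \<le> h (X \<omega>) ((\<mu> + \<delta>) * real (X \<omega>) + \<delta> * x)"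
            by (rule h_antimono)
          also have "\<dots> \<le> B * (real (X \<omega>) + 1) * g (\<delta> * x)" using \<delta> x by (intro B) auto
          also have "\<dots> \<le> \<bar>B\<bar> * (real (X \<omega>) + 1) * g (\<delta> * x)"
            using tail_pos[of "\<delta> * x"] by (intro mult_right_mono) auto
          also have "\<dots> \<le> \<bar>B\<bar> * (real (X \<omega>) + 1) * (B' * g x)"
            using B'(2)[of x] x by (intro mult_left_mono) auto
          finally have "h (X \<omega>) (x - W \<omega>) / g x \<le> \<bar>B\<bar> * B' * (real (X \<omega>) + 1)"
            using tail_pos[of x] by (simp add: field_simps)
          then show ?thesis using True h_range tail_pos[of x] by simp
        next
          case False
          then show ?thesis using B' by simp
        qed
      qed
      show "AE \<omega> in N. ((\<lambda>x. h (X \<omega>) (x - W \<omega>) * indicat_real (small \<delta> x) \<omega> / g x)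
          \<longlongrightarrow> (real (X \<omega>) + 1) * d) at_top"
      proof (intro AE_I2)
        fix \<omega> assume "\<omega> \<in> space N"
        have "\<forall>\<^sub>F x in at_top. h (X \<omega>) (x - W \<omega>) / g x = h (X \<omega>) (x - W \<omega>) * indicat_real (small \<delta> x) \<omega> / g x"
          using eventually_ge_at_top[of "?Z (\<mu> + \<delta>) \<omega> / (1 - \<delta>)"]
        proof eventually_elim
          case (elim x)
          then have "\<omega> \<in> small \<delta> x" using \<delta> \<open>\<omega> \<in> space N\<close> by (simp add: small_def field_simps)
          then show ?case by simp
        qed
        from tendsto_cong[OF this] h_tail[of "X \<omega>" "W \<omega>"]
        show "((\<lambda>x. h (X \<omega>) (x - W \<omega>) * indicat_real (small \<delta> x) \<omega> / g x)
          \<longlongrightarrow> (real (X \<omega>) + 1) * d) at_top" by simp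
      qed
    qed auto
    also have "(\<integral>\<omega>. (real (X \<omega>) + 1) * d \<partial>N) = (?E + 1) * d"
      using X_int by (simp add: N.prob_space)
    finally show ?thesis .
  qed

  let ?P = "\<lambda>c x. measure N {\<omega> \<in> space N. x < ?Z c \<omega>}"
  have P_scale: "((\<lambda>x. ?P c (a * x) / g x) \<longlongrightarrow> C c * a powr - \<tau>) at_top" if "0 \<le> c" "0 < a" for c a
  proof -
    have "filterlim (\<lambda>x. a * x) at_top at_top"
      by (rule filterlim_tendsto_pos_mult_at_top[OF tendsto_const that(2) filterlim_ident])
    from filterlim_compose[OF linear_tail[OF that(1)] this]
    have "((\<lambda>x. ?P c (a * x) / g (a * x) * (g (a * x) / g x)) \<longlongrightarrow> C c * a powr - \<tau>) at_top"
      by (intro tendsto_mult tail_scale that)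
    moreover have "?P c (a * x) / g (a * x) * (g (a * x) / g x) = ?P c (a * x) / g x" for x
      using tail_pos[of "a * x"] by simp
    ultimately show ?thesis by (simp only:)
  qed
  let ?J = "\<lambda>x. \<integral>\<omega>. h (X \<omega>) (x - W \<omega>) \<partial>N"
  let ?mid = "\<lambda>\<delta> x. \<integral>\<omega>. h (X \<omega>) (x - W \<omega>) * indicat_real (small \<delta> x) \<omega> / g x \<partial>N"
  have upper: "?J x / g x \<le> ?mid \<delta> x + ?P (\<mu> + \<delta>) ((1 - \<delta>) * x) / g x" for \<delta> x
  proof -
    let ?A = "{\<omega> \<in> space N. (1 - \<delta>) * x < ?Z (\<mu> + \<delta>) \<omega>}"
    have "?J x \<le> (\<integral>\<omega>. h (X \<omega>) (x - W \<omega>) * indicat_real (small \<delta> x) \<omega> + indicat_real ?A \<omega> \<partial>N)"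
    proof (rule integral_mono)
      show "integrable N (\<lambda>\<omega>. h (X \<omega>) (x - W \<omega>) * indicat_real (small \<delta> x) \<omega> + indicat_real ?A \<omega>)"
        using h_int[of "small \<delta> x" x] by (intro Bochner_Integration.integrable_add) (auto simp: N.emeasure_eq_measure)
      show "h (X \<omega>) (x - W \<omega>) \<le> h (X \<omega>) (x - W \<omega>) * indicat_real (small \<delta> x) \<omega> + indicat_real ?A \<omega>"
        if "\<omega> \<in> space N" for \<omega>
        using that h_range(2)[of "X \<omega>" "x - W \<omega>"] by (cases "\<omega> \<in> small \<delta> x") (auto simp: small_def)
    qed (rule h_int1)
    also have "\<dots> = (\<integral>\<omega>. h (X \<omega>) (x - W \<omega>) * indicat_real (small \<delta> x) \<omega> \<partial>N) + ?P (\<mu> + \<delta>) ((1 - \<delta>) * x)"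
      using h_int[of "small \<delta> x" x] by (subst Bochner_Integration.integral_add) (auto simp: N.emeasure_eq_measure)
    finally have "?J x / g x \<le> ((\<integral>\<omega>. h (X \<omega>) (x - W \<omega>) * indicat_real (small \<delta> x) \<omega> \<partial>N) + ?P (\<mu> + \<delta>) ((1 - \<delta>) * x)) / g x"
      using tail_pos[of x] by (intro divide_right_mono) auto
    then show ?thesis by (simp add: add_divide_distrib)
  qed
  have lower: "\<forall>\<^sub>F x in at_top. ?mid \<delta> x + (1 - \<delta>) * (?P (\<mu> - \<delta>) ((1 + \<delta>) * x) / g x) \<le> ?J x / g x"
    if \<delta>: "0 < \<delta>" "\<delta> < \<mu>" for \<delta>
  proof -
    obtain n0 where n0: "\<And>n. n0 \<le> n \<Longrightarrow> 1 - \<delta> < h n ((\<mu> - \<delta>) * real n)"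
      using order_tendstoD(1)[OF h_lower[of "\<mu> - \<delta>"], of "1 - \<delta>"] \<delta>
      by (auto simp: eventually_sequentially)
    show ?thesis
      using eventually_gt_at_top[of 0] eventually_gt_at_top[of "(\<mu> - \<delta>) * real n0 / \<delta>"]
    proof eventually_elim
      case (elim x)
      let ?A = "{\<omega> \<in> space N. (1 + \<delta>) * x < ?Z (\<mu> - \<delta>) \<omega>}"
      (* For X \<ge> n0 the law of large numbers applies. For smaller X the past alone exceeds the level,
         since x was chosen large against n0. *)
      have big: "1 - \<delta> \<le> h (X \<omega>) (x - W \<omega>)" if "\<omega> \<in> ?A" for \<omega>
      proof -
        have *: "x - W \<omega> \<le> (\<mu> - \<delta>) * real (X \<omega>) - \<delta> * x"
          using that by (simp add: algebra_simps)
        show ?thesis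
        proof (cases "n0 \<le> X \<omega>")
          case True
          have "0 < \<delta> * x" using \<delta> elim by simp
          with * have "x - W \<omega> \<le> (\<mu> - \<delta>) * real (X \<omega>)" by linarith
          from h_antimono[OF this, of "X \<omega>"] n0[OF True] show ?thesis by simp
        next
          case False
          then have "(\<mu> - \<delta>) * real (X \<omega>) \<le> (\<mu> - \<delta>) * real n0" using \<delta> by (intro mult_left_mono) auto
          also have "\<dots> < \<delta> * x" using elim \<delta> by (simp add: field_simps)
          finally show ?thesis using * \<delta> by (simp add: h_neg)
        qed
      qed
      have disj: "\<omega> \<notin> small \<delta> x" if "\<omega> \<in> ?A" for \<omega>
      proof
        assume "\<omega> \<in> small \<delta> x"
        then have "?Z (\<mu> + \<delta>) \<omega> \<le> (1 - \<delta>) * x" by (simp add: small_def)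
        moreover have "?Z (\<mu> - \<delta>) \<omega> \<le> ?Z (\<mu> + \<delta>) \<omega>"
          using \<delta> by (intro add_left_mono mult_right_mono) auto
        moreover have "(1 - \<delta>) * x < (1 + \<delta>) * x" using \<delta> elim by simp
        ultimately show False using that by auto
      qed
      have "(\<integral>\<omega>. h (X \<omega>) (x - W \<omega>) * indicat_real (small \<delta> x) \<omega> \<partial>N) + (1 - \<delta>) * ?P (\<mu> - \<delta>) ((1 + \<delta>) * x) =
          (\<integral>\<omega>. h (X \<omega>) (x - W \<omega>) * indicat_real (small \<delta> x) \<omega> + (1 - \<delta>) * indicat_real ?A \<omega> \<partial>N)"
        using h_int[of "small \<delta> x" x] by (subst Bochner_Integration.integral_add) (auto simp: N.emeasure_eq_measure)
      also have "\<dots> \<le> ?J x"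
      proof (rule integral_mono)
        show "integrable N (\<lambda>\<omega>. h (X \<omega>) (x - W \<omega>) * indicat_real (small \<delta> x) \<omega> + (1 - \<delta>) * indicat_real ?A \<omega>)"
          using h_int[of "small \<delta> x" x] by (intro Bochner_Integration.integrable_add) (auto simp: N.emeasure_eq_measure)
        show "h (X \<omega>) (x - W \<omega>) * indicat_real (small \<delta> x) \<omega> + (1 - \<delta>) * indicat_real ?A \<omega> \<le> h (X \<omega>) (x - W \<omega>)"
          for \<omega>
        proof (cases "\<omega> \<in> ?A")
          case True
          with disj[OF True] big[OF True] show ?thesis by simp
        next
          case False
          then have z: "indicat_real ?A \<omega> = 0" by (rule indicator_simps(2))
          show ?thesis unfolding z using h_range(1)[of "X \<omega>" "x - W \<omega>"] by (cases "\<omega> \<in> small \<delta> x") auto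
        qed
      qed (rule h_int1)
      finally have "((\<integral>\<omega>. h (X \<omega>) (x - W \<omega>) * indicat_real (small \<delta> x) \<omega> \<partial>N) + (1 - \<delta>) * ?P (\<mu> - \<delta>) ((1 + \<delta>) * x)) / g x
          \<le> ?J x / g x"
        using tail_pos[of x] by (intro divide_right_mono) auto
      then show ?case by (simp add: add_divide_distrib)
    qed
  qed
  have C_lim: "((\<lambda>\<delta>. C (\<mu> + \<delta>)) \<longlongrightarrow> C \<mu>) (at_right 0)" "((\<lambda>\<delta>. C (\<mu> - \<delta>)) \<longlongrightarrow> C \<mu>) (at_right 0)"
  proof -
    have "((\<lambda>\<delta>. \<mu> + \<delta>) \<longlongrightarrow> \<mu> + 0) (at_right 0)" "((\<lambda>\<delta>. \<mu> - \<delta>) \<longlongrightarrow> \<mu> - 0) (at_right 0)"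
      by (intro tendsto_intros)+
    from this[simplified, THEN isCont_tendsto_compose[OF C_cont]] show
      "((\<lambda>\<delta>. C (\<mu> + \<delta>)) \<longlongrightarrow> C \<mu>) (at_right 0)" "((\<lambda>\<delta>. C (\<mu> - \<delta>)) \<longlongrightarrow> C \<mu>) (at_right 0)"
      by auto
  qed
  let ?u = "\<lambda>\<delta> x. ?mid \<delta> x + ?P (\<mu> + \<delta>) ((1 - \<delta>) * x) / g x"
  let ?U = "\<lambda>\<delta>. (?E + 1) * d + C (\<mu> + \<delta>) * (1 - \<delta>) powr - \<tau>"
  let ?l = "\<lambda>\<delta> x. ?mid \<delta> x + (1 - \<delta>) * (?P (\<mu> - \<delta>) ((1 + \<delta>) * x) / g x)"
  let ?L = "\<lambda>\<delta>. (?E + 1) * d + (1 - \<delta>) * (C (\<mu> - \<delta>) * (1 + \<delta>) powr - \<tau>)"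
  show ?thesis
  proof (rule tendsto_sandwich_approx[where l="?l" and u="?u" and L="?L" and U="?U"])
    show "\<forall>\<^sub>F \<delta> in at_right 0. (\<forall>\<^sub>F x in at_top. ?l \<delta> x \<le> ?J x / g x) \<and> (?l \<delta> \<longlongrightarrow> ?L \<delta>) at_top"
    proof (rule eventually_at_right_0I)
      show "0 < min 1 \<mu>" using \<mu> by simp
      fix \<delta> :: real assume \<delta>: "0 < \<delta>" "\<delta> < min 1 \<mu>"
      have "(?l \<delta> \<longlongrightarrow> ?L \<delta>) at_top"
        using \<delta> by (intro tendsto_add tendsto_mult tendsto_const middle P_scale) auto
      with lower[of \<delta>] \<delta> show "(\<forall>\<^sub>F x in at_top. ?l \<delta> x \<le> ?J x / g x) \<and> (?l \<delta> \<longlongrightarrow> ?L \<delta>) at_top"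
        by auto
    qed
    show "\<forall>\<^sub>F \<delta> in at_right 0. (\<forall>\<^sub>F x in at_top. ?J x / g x \<le> ?u \<delta> x) \<and> (?u \<delta> \<longlongrightarrow> ?U \<delta>) at_top"
    proof (rule eventually_at_right_0I)
      show "0 < (1::real)" by simp
      fix \<delta> :: real assume \<delta>: "0 < \<delta>" "\<delta> < 1"
      have "(?u \<delta> \<longlongrightarrow> ?U \<delta>) at_top"
        using \<delta> \<mu> by (intro tendsto_add middle P_scale) auto
      then show "(\<forall>\<^sub>F x in at_top. ?J x / g x \<le> ?u \<delta> x) \<and> (?u \<delta> \<longlongrightarrow> ?U \<delta>) at_top"
        by (intro conjI always_eventually allI upper)
    qed
    have "(?L \<longlongrightarrow> (?E + 1) * d + (1 - 0) * (C \<mu> * 1)) (at_right 0)"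
      by (intro tendsto_add tendsto_mult tendsto_diff tendsto_const tendsto_ident_at C_lim powr_scale_tendsto_1)
    then show "(?L \<longlongrightarrow> C \<mu> + (?E + 1) * d) (at_right 0)" by (simp add: add.commute)
    have "(?U \<longlongrightarrow> (?E + 1) * d + C \<mu> * 1) (at_right 0)"
      by (intro tendsto_add tendsto_mult tendsto_const C_lim powr_scale_tendsto_1)
    then show "(?U \<longlongrightarrow> C \<mu> + (?E + 1) * d) (at_right 0)" by (simp add: add.commute)
  qed
qed

end

section \<open>Poisson arrivals during one service\<close>

definition poisson_weight :: "real \<Rightarrow> nat \<Rightarrow> real" where
  "poisson_weight m k = exp (- m) * m ^ k / fact k"

text \<open>
  The joint law of the length \<open>s\<close> of a service and of the number of external arrivals during it,
  which is Poisson with mean \<open>lam * s\<close> given \<open>s\<close>.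
\<close>

definition job_law :: "real \<Rightarrow> real measure \<Rightarrow> (real \<times> nat) measure" where
  "job_law lam G = density (G \<Otimes>\<^sub>M count_space UNIV) (\<lambda>(s, k). ennreal (poisson_weight (lam * s) k))"

lemma poisson_weight_nonneg: "0 \<le> m \<Longrightarrow> 0 \<le> poisson_weight m k"
  by (simp add: poisson_weight_def)

lemma measurable_poisson_weight [measurable]:
  assumes [measurable]: "f \<in> borel_measurable N" "k \<in> measurable N (count_space UNIV)"
  shows "(\<lambda>x. poisson_weight (f x) (k x)) \<in> borel_measurable N"
  unfolding poisson_weight_def by measurable

lemma poisson_exp_moment:
  assumes "0 \<le> m"
  shows "(\<Sum>k. ennreal (poisson_weight m k) * ennreal (exp (\<theta> * real k))) = ennreal (exp (m * (exp \<theta> - 1)))"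
proof -
  have "(\<lambda>k. (m * exp \<theta>) ^ k /\<^sub>R fact k) sums exp (m * exp \<theta>)" by (rule exp_converges)
  from sums_mult[OF this, of "exp (- m)"]
  have "(\<lambda>k. poisson_weight m k * exp (\<theta> * real k)) sums exp (m * (exp \<theta> - 1))"
    by (simp add: poisson_weight_def power_mult_distrib exp_of_nat2_mult exp_add[symmetric]
        divide_inverse algebra_simps)
  then have "(\<Sum>k. ennreal (poisson_weight m k * exp (\<theta> * real k))) = ennreal (exp (m * (exp \<theta> - 1)))"
    using assms by (intro suminf_ennreal_eq) (auto simp: poisson_weight_nonneg)
  then show ?thesis using assms by (simp add: ennreal_mult poisson_weight_nonneg)
qed

lemma poisson_weight_total: "0 \<le> m \<Longrightarrow> (\<Sum>k. ennreal (poisson_weight m k)) = 1"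
  using poisson_exp_moment[of m 0] by simp

lemma poisson_mean:
  assumes "0 \<le> m"
  shows "(\<Sum>k. ennreal (poisson_weight m k) * of_nat k) = ennreal m"
proof -
  have "(\<lambda>k. m ^ k /\<^sub>R fact k) sums exp m" by (rule exp_converges)
  from sums_mult[OF this, of "m * exp (- m)"]
  have "(\<lambda>k. poisson_weight m (Suc k) * real (Suc k)) sums m"
    by (simp add: poisson_weight_def exp_minus field_simps del: of_nat_Suc)
  then have "(\<lambda>k. poisson_weight m k * real k) sums m"
    by (subst (asm) sums_Suc_iff) simp
  then have "(\<Sum>k. ennreal (poisson_weight m k * real k)) = ennreal m"
    using assms by (intro suminf_ennreal_eq) (auto simp: poisson_weight_nonneg)
  then show ?thesis
    using assms by (simp add: ennreal_mult poisson_weight_nonneg ennreal_of_nat_eq_real_of_nat)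
qed

locale service_time_law = prob_space G for G :: "real measure" +
  fixes lam b :: real
  assumes sets_G [measurable_cong, simp]: "sets G = sets borel"
    and G_nonneg: "AE s in G. 0 \<le> s"
    and G_integrable: "integrable G (\<lambda>s. s)"
    and G_mean: "(\<integral>s. s \<partial>G) = b"
    and lam_pos: "0 < lam" and b_pos: "0 < b"
begin

abbreviation "J \<equiv> job_law lam G"

lemma space_G [simp]: "space G = UNIV"
  using sets_eq_imp_space_eq[OF sets_G] by simp

lemma sets_job_law [measurable_cong, simp]: "sets J = sets (borel \<Otimes>\<^sub>M count_space UNIV)"
  unfolding job_law_def sets_density by (rule sets_pair_measure_cong) auto

lemma space_job_law [simp]: "space J = UNIV"
  using sets_eq_imp_space_eq[OF sets_job_law] by (simp add: space_pair_measure)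

lemma sets_job_lawI:
  "Measurable.pred (borel \<Otimes>\<^sub>M count_space UNIV) P \<Longrightarrow> {x. P x} \<in> sets (borel \<Otimes>\<^sub>M count_space UNIV)"
  by (simp add: pred_def space_pair_measure)

lemma nn_integral_job_law:
  assumes [measurable]: "\<phi> \<in> borel_measurable (borel \<Otimes>\<^sub>M count_space UNIV)"
  shows "(\<integral>\<^sup>+x. \<phi> x \<partial>J) = (\<integral>\<^sup>+s. (\<Sum>k. ennreal (poisson_weight (lam * s) k) * \<phi> (s, k)) \<partial>G)"
proof -
  interpret C: sigma_finite_measure "count_space (UNIV :: nat set)"
    by (rule sigma_finite_measure_count_space)
  have "(\<integral>\<^sup>+x. \<phi> x \<partial>J) = (\<integral>\<^sup>+x. (case x of (s, k) \<Rightarrow> ennreal (poisson_weight (lam * s) k)) * \<phi> x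
      \<partial>(G \<Otimes>\<^sub>M count_space UNIV))"
    unfolding job_law_def by (subst nn_integral_density) (auto cong: measurable_cong_sets sets_pair_measure_cong)
  also have "\<dots> = (\<integral>\<^sup>+s. \<integral>\<^sup>+k. ennreal (poisson_weight (lam * s) k) * \<phi> (s, k) \<partial>count_space UNIV \<partial>G)"
    by (subst C.nn_integral_fst[symmetric]) (auto cong: measurable_cong_sets sets_pair_measure_cong)
  finally show ?thesis by (simp add: nn_integral_count_space_nat)
qed

text \<open>
  The Poisson weights are meaningful only for a nonnegative mean, and negative lengths form a null
  set.
\<close>

lemma nn_integral_job_law_cong:
  assumes [measurable]: "\<phi> \<in> borel_measurable (borel \<Otimes>\<^sub>M count_space UNIV)"
    and eq: "\<And>s. 0 \<le> s \<Longrightarrow> (\<Sum>k. ennreal (poisson_weight (lam * s) k) * \<phi> (s, k)) = \<psi> s"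
  shows "(\<integral>\<^sup>+x. \<phi> x \<partial>J) = (\<integral>\<^sup>+s. \<psi> s \<partial>G)"
  unfolding nn_integral_job_law[OF assms(1)] using G_nonneg
  by (intro nn_integral_cong_AE) (auto simp: eq)

lemma nn_integral_job_law_fst:
  assumes [measurable]: "\<psi> \<in> borel_measurable borel"
  shows "(\<integral>\<^sup>+x. \<psi> (fst x) \<partial>J) = (\<integral>\<^sup>+s. \<psi> s \<partial>G)"
  using lam_pos by (intro nn_integral_job_law_cong) (auto simp: poisson_weight_total)

lemma prob_space_job_law: "prob_space J"
proof
  show "emeasure J (space J) = 1"
    using nn_integral_job_law_fst[of "\<lambda>_. 1"] emeasure_space_1 by simp
qed

sublocale J: prob_space J by (rule prob_space_job_law)

lemma emeasure_job_law_fst: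
  assumes [measurable]: "A \<in> sets borel"
  shows "emeasure J {x. fst x \<in> A} = emeasure G A"
proof -
  have "emeasure J {x. fst x \<in> A} = (\<integral>\<^sup>+x. indicator A (fst x) \<partial>J)"
    by (subst nn_integral_indicator[symmetric])
      (auto intro!: nn_integral_cong sets_job_lawI simp: indicator_def)
  also have "\<dots> = emeasure G A" by (subst nn_integral_job_law_fst) auto
  finally show ?thesis .
qed

lemma AE_job_law_nonneg: "AE x in J. 0 \<le> fst x"
proof (rule AE_I')
  have "emeasure J {x. fst x \<in> {..<0}} = 0"
    using G_nonneg by (subst emeasure_job_law_fst) (auto simp: AE_iff_measurable[OF _ refl] not_le lessThan_def)
  then show "{x. fst x \<in> {..<0}} \<in> null_sets J"
    by (intro null_setsI) (auto intro!: sets_job_lawI)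
qed auto

lemma job_law_mean_arrivals: "(\<integral>\<^sup>+x. of_nat (snd x) \<partial>J) = ennreal (lam * b)"
proof -
  have "(\<integral>\<^sup>+x. of_nat (snd x) \<partial>J) = (\<integral>\<^sup>+s. ennreal (lam * s) \<partial>G)"
    using lam_pos by (intro nn_integral_job_law_cong) (auto simp: poisson_mean)
  also have "\<dots> = ennreal (lam * b)"
    using G_integrable G_mean G_nonneg lam_pos by (subst nn_integral_eq_integral) auto
  finally show ?thesis .
qed

text \<open>
  Chernoff's bound given the length of the service. The excess \<open>\<delta>\<close> in the rate absorbs the second
  order term of \<open>exp \<theta>\<close>, so that the bound does not depend on the length.
\<close>

lemma many_arrivals:
  assumes "0 < \<theta>" and \<theta>: "exp \<theta> - 1 \<le> (1 + \<delta>) * \<theta>"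
  shows "J.prob {x. (1 + \<delta>) * lam * fst x + y \<le> real (snd x)} \<le> exp (- \<theta> * y)"
proof -
  let ?f = "\<lambda>x::real \<times> nat. exp (\<theta> * real (snd x)) * exp (- \<theta> * (1 + \<delta>) * lam * fst x)"
  have "(\<integral>\<^sup>+x. ennreal (?f x) \<partial>J) = (\<integral>\<^sup>+s. ennreal (exp (lam * s * (exp \<theta> - 1)) * exp (- \<theta> * (1 + \<delta>) * lam * s)) \<partial>G)"
  proof (rule nn_integral_job_law_cong)
    fix s :: real assume "0 \<le> s"
    with lam_pos have "0 \<le> lam * s" by simp
    from poisson_exp_moment[OF this, of \<theta>]
    show "(\<Sum>k. ennreal (poisson_weight (lam * s) k) * ennreal (?f (s, k))) =
        ennreal (exp (lam * s * (exp \<theta> - 1)) * exp (- \<theta> * (1 + \<delta>) * lam * s))"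
      by (simp add: ennreal_mult mult.assoc[symmetric])
  qed measurable
  also have "\<dots> \<le> (\<integral>\<^sup>+s. 1 \<partial>G)"
  proof (rule nn_integral_mono_AE, use G_nonneg in eventually_elim)
    case (elim s)
    have "lam * s * (exp \<theta> - 1) \<le> lam * s * ((1 + \<delta>) * \<theta>)"
      using \<theta> elim lam_pos by (intro mult_left_mono) auto
    then have "exp (lam * s * (exp \<theta> - 1) + - \<theta> * (1 + \<delta>) * lam * s) \<le> 1"
      by (simp add: algebra_simps)
    then show ?case by (simp add: exp_add[symmetric])
  qed
  also have "\<dots> = 1" using emeasure_space_1 by simp
  finally have le1: "(\<integral>\<^sup>+x. ennreal (?f x) \<partial>J) \<le> 1" .
  let ?A = "{x \<in> space J. (1 + \<delta>) * lam * fst x + y \<le> real (snd x)}"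
  have "emeasure J ?A \<le> emeasure J {x \<in> space J. 1 \<le> ennreal (exp (- \<theta> * y)) * ennreal (?f x)}"
  proof (intro emeasure_mono subsetI)
    fix x assume "x \<in> ?A"
    then have "\<theta> * ((1 + \<delta>) * lam * fst x + y) \<le> \<theta> * real (snd x)"
      using assms(1) by (intro mult_left_mono) auto
    then have "1 \<le> exp (- \<theta> * y) * ?f x" by (simp add: exp_add[symmetric] algebra_simps)
    then show "x \<in> {x \<in> space J. 1 \<le> ennreal (exp (- \<theta> * y)) * ennreal (?f x)}"
      by (simp flip: ennreal_mult)
  qed measurable
  also have "\<dots> \<le> ennreal (exp (- \<theta> * y)) * (\<integral>\<^sup>+x. ennreal (?f x) * indicator (space J) x \<partial>J)"
    by (intro nn_integral_Markov_inequality) measurable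
  also have "\<dots> \<le> ennreal (exp (- \<theta> * y)) * 1"
    using le1 by (intro mult_left_mono) auto
  finally show ?thesis by (simp add: J.emeasure_eq_measure)
qed

text \<open>
  Chernoff's bound in the other direction, integrated only over services longer than \<open>y\<close>. The right
  hand side keeps the probability of such a service, so that the conditional probability of few
  arrivals during a long service is exponentially small.
\<close>

lemma few_arrivals:
  assumes "0 < \<theta>" and \<kappa>: "(1 - \<delta>) * \<theta> + \<kappa> / lam \<le> 1 - exp (- \<theta>)" and "0 < \<kappa>"
  shows "J.prob {x. y < fst x \<and> real (snd x) \<le> (1 - \<delta>) * lam * fst x} \<le> exp (- \<kappa> * y) * J.prob {x. y < fst x}"
proof -
  let ?f = "\<lambda>x::real \<times> nat. exp (- \<theta> * real (snd x)) * (exp (\<theta> * (1 - \<delta>) * lam * fst x) * indicat_real {y<..} (fst x))"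
  have "(\<integral>\<^sup>+x. ennreal (?f x) \<partial>J) = (\<integral>\<^sup>+s. ennreal (exp (lam * s * (exp (- \<theta>) - 1)) * (exp (\<theta> * (1 - \<delta>) * lam * s) * indicat_real {y<..} s)) \<partial>G)"
  proof (rule nn_integral_job_law_cong)
    fix s :: real assume "0 \<le> s"
    with lam_pos have "0 \<le> lam * s" by simp
    from poisson_exp_moment[OF this, of "- \<theta>"]
    show "(\<Sum>k. ennreal (poisson_weight (lam * s) k) * ennreal (?f (s, k))) =
        ennreal (exp (lam * s * (exp (- \<theta>) - 1)) * (exp (\<theta> * (1 - \<delta>) * lam * s) * indicat_real {y<..} s))"
      by (simp add: ennreal_mult mult.assoc[symmetric])
  qed measurable
  also have "\<dots> \<le> (\<integral>\<^sup>+s. ennreal (exp (- \<kappa> * y)) * indicator {y<..} s \<partial>G)"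
  proof (rule nn_integral_mono_AE, use G_nonneg in eventually_elim)
    case (elim s)
    show ?case
    proof (cases "y < s")
      case True
      have "lam * s * ((1 - \<delta>) * \<theta> + \<kappa> / lam) \<le> lam * s * (1 - exp (- \<theta>))"
        using \<kappa> elim lam_pos by (intro mult_left_mono) auto
      then have "lam * s * (exp (- \<theta>) - 1) + \<theta> * (1 - \<delta>) * lam * s \<le> - (\<kappa> * s)"
        using lam_pos by (simp add: algebra_simps)
      also have "\<dots> \<le> - \<kappa> * y" using True assms(3) by simp
      finally show ?thesis using True by (simp add: exp_add[symmetric])
    qed simp
  qed
  also have "\<dots> = ennreal (exp (- \<kappa> * y)) * (\<integral>\<^sup>+x. indicator {y<..} (fst x) \<partial>J)"
    by (subst nn_integral_cmult) (auto simp: nn_integral_job_law_fst)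
  also have "(\<integral>\<^sup>+x. indicator {y<..} (fst x) \<partial>J) = (\<integral>\<^sup>+x. indicator {x. y < fst x} x \<partial>J)"
    by (intro nn_integral_cong) (auto simp: indicator_def)
  also have "\<dots> = emeasure J {x. y < fst x}"
    by (rule nn_integral_indicator) (auto intro!: sets_job_lawI)
  finally have le: "(\<integral>\<^sup>+x. ennreal (?f x) \<partial>J) \<le> ennreal (exp (- \<kappa> * y)) * emeasure J {x. y < fst x}" .
  have "emeasure J {x. y < fst x \<and> real (snd x) \<le> (1 - \<delta>) * lam * fst x} =
      (\<integral>\<^sup>+x. indicator {x. y < fst x \<and> real (snd x) \<le> (1 - \<delta>) * lam * fst x} x \<partial>J)"
    by (intro nn_integral_indicator[symmetric]) (auto intro!: sets_job_lawI)
  also have "\<dots> \<le> (\<integral>\<^sup>+x. ennreal (?f x) \<partial>J)"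
  proof (rule nn_integral_mono)
    fix x :: "real \<times> nat"
    show "indicator {x. y < fst x \<and> real (snd x) \<le> (1 - \<delta>) * lam * fst x} x \<le> ennreal (?f x)"
    proof (cases "y < fst x \<and> real (snd x) \<le> (1 - \<delta>) * lam * fst x")
      case True
      then have "\<theta> * real (snd x) \<le> \<theta> * ((1 - \<delta>) * lam * fst x)"
        using assms(1) by (intro mult_left_mono) auto
      then show ?thesis using True by (simp add: exp_add[symmetric] algebra_simps)
    qed simp
  qed
  also note le
  finally show ?thesis
    by (simp add: J.emeasure_eq_measure ennreal_mult[symmetric] measure_nonneg)
qed

end

section \<open>The weight of a single service\<close>

text \<open>
  A service is described by its length, the number of external arrivals during it and the decision
  whether the served customer returns. These data determine the length of the line after the service
  from that before it.
\<close>

type_synonym service = "(real \<times> nat) \<times> bool"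

definition service_law :: "real \<Rightarrow> real measure \<Rightarrow> real \<Rightarrow> service measure" where
  "service_law lam G p = job_law lam G \<Otimes>\<^sub>M measure_pmf (bernoulli_pmf p)"

text \<open>
  The length is nonnegative almost surely only; cutting it at \<open>0\<close> makes all elapsed times monotone
  along every sequence of services.
\<close>

definition service_time :: "service \<Rightarrow> real" where
  "service_time d = max 0 (fst (fst d))"

definition arrivals :: "service \<Rightarrow> nat" where
  "arrivals d = snd (fst d)"

definition returns :: "service \<Rightarrow> bool" where
  "returns d = snd d"

text \<open>
  The contribution of a service to the functional ``elapsed time plus \<open>c\<close> times the number of
  customers in line'' after the round.
\<close>

definition weight :: "real \<Rightarrow> service \<Rightarrow> real" where
  "weight c d = service_time d + c * (real (arrivals d) + of_bool (returns d))"

locale feedback_law = service_time_law G lam b + regularly_varying_tail "\<lambda>x. 1 - cdf G x" \<tau>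
  for G :: "real measure" and lam b p \<tau> :: real +
  assumes p_pos: "0 < p" and p_less_1: "p < 1" and stable: "p + lam * b < 1"
begin

abbreviation "D \<equiv> service_law lam G p"
abbreviation "Gbar \<equiv> \<lambda>x. 1 - cdf G x"
abbreviation "r \<equiv> p + lam * b"

lemma r_pos: "0 < r"
  using p_pos lam_pos b_pos by (intro add_pos_pos mult_pos_pos)

lemma sets_D [measurable_cong]: "sets D = sets ((borel \<Otimes>\<^sub>M count_space UNIV) \<Otimes>\<^sub>M count_space UNIV)"
  unfolding service_law_def by (rule sets_pair_measure_cong) (simp_all add: sets_job_law)

lemma space_D [simp]: "space D = UNIV"
  using sets_eq_imp_space_eq[OF sets_D] by (simp add: space_pair_measure)

lemma measurable_service [measurable]:
  "service_time \<in> borel_measurable ((borel \<Otimes>\<^sub>M count_space UNIV) \<Otimes>\<^sub>M count_space UNIV)"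
  "arrivals \<in> measurable ((borel \<Otimes>\<^sub>M count_space UNIV) \<Otimes>\<^sub>M count_space UNIV) (count_space UNIV)"
  "returns \<in> measurable ((borel \<Otimes>\<^sub>M count_space UNIV) \<Otimes>\<^sub>M count_space UNIV) (count_space UNIV)"
  "weight c \<in> borel_measurable ((borel \<Otimes>\<^sub>M count_space UNIV) \<Otimes>\<^sub>M count_space UNIV)"
  unfolding service_time_def[abs_def] arrivals_def[abs_def] returns_def[abs_def] weight_def[abs_def]
  by measurable

lemma service_time_nonneg [simp]: "0 \<le> service_time d"
  by (simp add: service_time_def)

lemma weight_nonneg: "0 \<le> c \<Longrightarrow> 0 \<le> weight c d"
  by (simp add: weight_def)

lemma nn_integral_service_law:
  assumes [measurable]: "\<phi> \<in> borel_measurable ((borel \<Otimes>\<^sub>M count_space UNIV) \<Otimes>\<^sub>M count_space UNIV)"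
  shows "(\<integral>\<^sup>+d. \<phi> d \<partial>D) = (\<integral>\<^sup>+x. \<phi> (x, True) * p + \<phi> (x, False) * (1 - p) \<partial>J)"
proof -
  have "\<phi> \<in> borel_measurable D" by measurable
  then have "(\<integral>\<^sup>+d. \<phi> d \<partial>D) = (\<integral>\<^sup>+x. \<integral>\<^sup>+f. \<phi> (x, f) \<partial>measure_pmf (bernoulli_pmf p) \<partial>J)"
    unfolding service_law_def by (subst measure_pmf.nn_integral_fst[symmetric]) auto
  then show ?thesis using p_pos p_less_1 by simp
qed

lemma nn_integral_service_law_fst:
  assumes [measurable]: "\<phi> \<in> borel_measurable (borel \<Otimes>\<^sub>M count_space UNIV)"
  shows "(\<integral>\<^sup>+d. \<phi> (fst d) \<partial>D) = (\<integral>\<^sup>+x. \<phi> x \<partial>J)"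
proof -
  have "\<phi> x * ennreal p + \<phi> x * ennreal (1 - p) = \<phi> x" for x
    using p_pos p_less_1 by (simp flip: distrib_left ennreal_plus)
  then show ?thesis by (subst nn_integral_service_law) auto
qed

lemma prob_space_service_law: "prob_space D"
  using nn_integral_service_law_fst[of "\<lambda>_. 1"] J.emeasure_space_1 by (intro prob_spaceI) simp

sublocale D: prob_space D by (rule prob_space_service_law)
sublocale seq: sequence_space D ..

lemma sets_DI:
  "Measurable.pred ((borel \<Otimes>\<^sub>M count_space UNIV) \<Otimes>\<^sub>M count_space UNIV) P \<Longrightarrow> {x. P x} \<in> sets D"
  by (simp add: pred_def space_pair_measure sets_D)

lemma prob_D_fst:
  assumes [measurable]: "Measurable.pred (borel \<Otimes>\<^sub>M count_space UNIV) Q"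
  shows "D.prob {d. Q (fst d)} = J.prob {x. Q x}"
proof -
  have "emeasure D {d. Q (fst d)} = (\<integral>\<^sup>+d. indicator {x. Q x} (fst d) \<partial>D)"
    by (subst nn_integral_indicator[symmetric])
      (auto intro!: nn_integral_cong sets_DI simp: indicator_def)
  also have "\<dots> = (\<integral>\<^sup>+x. indicator {x. Q x} x \<partial>J)"
    by (subst nn_integral_service_law_fst) (auto intro!: borel_measurable_indicator sets_job_lawI)
  also have "\<dots> = emeasure J {x. Q x}"
    by (intro nn_integral_indicator) (auto intro!: sets_job_lawI)
  finally show ?thesis by (simp add: D.emeasure_eq_measure J.emeasure_eq_measure)
qed

lemma prob_J_service_time: "J.prob {x. y < fst x} = Gbar y"
proof -
  interpret G: real_distribution G
    by standard (use space_G in auto)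
  have "J.prob {x. fst x \<in> {y<..}} = prob {y<..}"
    using emeasure_job_law_fst[of "{y<..}"] by (simp add: J.emeasure_eq_measure emeasure_eq_measure)
  also have "prob {y<..} = prob (space G - {..y})" by (intro arg_cong[where f = prob]) auto
  also have "\<dots> = 1 - cdf G y"
    by (subst prob_compl) (auto simp: cdf_def)
  finally show ?thesis by simp
qed

text \<open>
  A weight above \<open>x\<close> needs a long service or unusually many arrivals for its length. The return
  decision contributes at most \<open>c\<close>.
\<close>

lemma weight_tail_upper:
  assumes "0 \<le> c" "0 < \<delta>" "\<delta> < 1" "0 < x"
  shows "D.prob {d. x < weight c d} \<le> Gbar ((1 - \<delta>) / (1 + c * lam * (1 + \<delta>)) * x)
    + exp \<delta> * exp (- (\<delta> * \<delta> / (c + 1)) * x)"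
proof -
  (* The -1 pays for the returning customer, and the denominator c + 1 instead of c covers c = 0. *)
  let ?a = "1 + c * lam * (1 + \<delta>)" and ?y = "\<delta> * x / (c + 1) - 1"
  have a: "0 < ?a" using assms lam_pos by (intro add_pos_nonneg mult_nonneg_nonneg) auto
  let ?A = "{x'. (1 - \<delta>) / ?a * x < fst x'}" and ?B = "{x'. (1 + \<delta>) * lam * fst x' + ?y \<le> real (snd x')}"
  have AB: "?A \<in> sets J" "?B \<in> sets J"
    unfolding sets_job_law by (intro sets_job_lawI, measurable)+
  have "weight c d \<le> max 0 (fst (fst d)) + c * (real (snd (fst d)) + 1)" for d
    using assms(1) unfolding weight_def service_time_def arrivals_def
    by (intro add_mono mult_left_mono) auto
  then have "D.prob {d. x < weight c d} \<le> D.prob {d. x < max 0 (fst (fst d)) + c * (real (snd (fst d)) + 1)}"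
    by (intro D.finite_measure_mono) (auto intro!: sets_DI elim!: less_le_trans)
  also have "\<dots> = J.prob {x'. x < max 0 (fst x') + c * (real (snd x') + 1)}"
    by (rule prob_D_fst) measurable
  also have "\<dots> \<le> J.prob (?A \<union> ?B)"
  proof (rule J.finite_measure_mono_AE)
    show "AE x' in J. x' \<in> {x'. x < max 0 (fst x') + c * (real (snd x') + 1)} \<longrightarrow> x' \<in> ?A \<union> ?B"
      using AE_job_law_nonneg
    proof eventually_elim
      case (elim x')
      have "max 0 (fst x') + c * (real (snd x') + 1) \<le> x" if "x' \<notin> ?A \<union> ?B"
      proof -
        have 1: "?a * fst x' \<le> (1 - \<delta>) * x" using that a by (simp add: not_less field_simps)
        have "c * real (snd x') \<le> c * ((1 + \<delta>) * lam * fst x' + ?y)"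
          using that assms by (intro mult_left_mono) auto
        moreover have "c * (?y + 1) \<le> \<delta> * x"
        proof -
          have "c * (?y + 1) = \<delta> * x * (c / (c + 1))" by simp
          also have "\<dots> \<le> \<delta> * x * 1" using assms by (intro mult_left_mono) auto
          finally show ?thesis by simp
        qed
        ultimately have "max 0 (fst x') + c * (real (snd x') + 1) \<le> ?a * fst x' + \<delta> * x"
          using elim by (simp add: algebra_simps)
        with 1 show ?thesis by (simp add: algebra_simps)
      qed
      then show ?case by (auto simp: not_le[symmetric])
    qed
  qed (rule sets.Un[OF AB])
  also have "\<dots> \<le> J.prob ?A + J.prob ?B"
    by (rule measure_Un_le[OF AB])
  also have "J.prob ?A = Gbar ((1 - \<delta>) / ?a * x)"
    by (rule prob_J_service_time)
  also have "J.prob ?B \<le> exp (- \<delta> * ?y)"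
  proof (rule many_arrivals)
    (* The Chernoff parameter is \<delta> itself. *)
    have "exp \<delta> \<le> 1 + \<delta> + \<delta>\<^sup>2" using assms by (intro exp_bound) auto
    then show "exp \<delta> - 1 \<le> (1 + \<delta>) * \<delta>" by (simp add: power2_eq_square algebra_simps)
  qed (use assms in auto)
  also have "exp (- \<delta> * ?y) = exp \<delta> * exp (- (\<delta> * \<delta> / (c + 1)) * x)"
    by (simp add: exp_add[symmetric] algebra_simps)
  finally show ?thesis by simp
qed

lemma weight_tail_lower:
  assumes "0 \<le> c" "0 < \<delta>" "\<delta> < 1"
  shows "(1 - exp (- (lam * \<delta>\<^sup>2 / 4 / (1 + c * lam * (1 - \<delta>))) * x)) * Gbar (1 / (1 + c * lam * (1 - \<delta>)) * x)
    \<le> D.prob {d. x < weight c d}"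
proof -
  let ?a = "1 + c * lam * (1 - \<delta>)" and ?\<kappa> = "lam * \<delta>\<^sup>2 / 4"
  have a: "0 < ?a" using assms lam_pos by (intro add_pos_nonneg mult_nonneg_nonneg) auto
  let ?y = "1 / ?a * x"
  let ?A = "{x'. ?y < fst x'}" and ?B = "{x'. ?y < fst x' \<and> real (snd x') \<le> (1 - \<delta>) * lam * fst x'}"
  have AB: "?A \<in> sets J" "?B \<in> sets J"
    unfolding sets_job_law by (intro sets_job_lawI, measurable)+
  have "J.prob ?B \<le> exp (- ?\<kappa> * ?y) * J.prob ?A"
  proof (rule few_arrivals)
    have "(1 - \<delta> / 2 + (\<delta> / 2)\<^sup>2) * exp (\<delta> / 2) \<ge> (1 - \<delta> / 2 + (\<delta> / 2)\<^sup>2) * (1 + \<delta> / 2)"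
      using assms by (intro mult_left_mono) auto
    moreover have "(1 - \<delta> / 2 + (\<delta> / 2)\<^sup>2) * (1 + \<delta> / 2) = 1 + (\<delta> / 2) ^ 3"
      by (simp add: power2_eq_square power3_eq_cube algebra_simps)
    moreover have "0 \<le> (\<delta> / 2) ^ 3" using assms by simp
    ultimately have "1 \<le> (1 - \<delta> / 2 + (\<delta> / 2)\<^sup>2) * exp (\<delta> / 2)" by linarith
    then have "exp (- (\<delta> / 2)) \<le> 1 - \<delta> / 2 + (\<delta> / 2)\<^sup>2"
      by (simp add: exp_minus field_simps)
    then show "(1 - \<delta>) * (\<delta> / 2) + ?\<kappa> / lam \<le> 1 - exp (- (\<delta> / 2))"
      using lam_pos by (simp add: power2_eq_square field_simps)
  qed (use assms lam_pos in auto)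
  then have "(1 - exp (- ?\<kappa> * ?y)) * J.prob ?A \<le> J.prob ?A - J.prob ?B"
    by (simp add: algebra_simps)
  also have "\<dots> = J.prob (?A - ?B)"
    by (rule J.finite_measure_Diff[symmetric, OF AB]) auto
  also have "\<dots> = D.prob {d :: service. fst d \<in> ?A - ?B}"
  proof -
    have "Measurable.pred (borel \<Otimes>\<^sub>M count_space UNIV) (\<lambda>x. x \<in> ?A - ?B)" by simp
    from prob_D_fst[OF this] show ?thesis by (simp only: Collect_mem_eq)
  qed
  also have "\<dots> \<le> D.prob {d. x < weight c d}"
  proof (intro D.finite_measure_mono subsetI)
    fix d assume "d \<in> {d :: service. fst d \<in> ?A - ?B}"
    then have d: "?y < fst (fst d)" "(1 - \<delta>) * lam * fst (fst d) < real (snd (fst d))" by auto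
    have "x = ?a * ?y" using a by simp
    also have "\<dots> < ?a * fst (fst d)" using d a by (intro mult_strict_left_mono) auto
    also have "\<dots> = fst (fst d) + c * ((1 - \<delta>) * lam * fst (fst d))" by (simp add: algebra_simps)
    also have "\<dots> \<le> max 0 (fst (fst d)) + c * (real (snd (fst d)) + of_bool (snd d))"
      using d assms by (intro add_mono mult_left_mono) auto
    finally show "d \<in> {d. x < weight c d}"
      by (simp add: weight_def service_time_def arrivals_def returns_def)
  qed (auto intro!: sets_DI)
  also have "J.prob ?A = Gbar ?y" by (rule prob_J_service_time)
  finally show ?thesis by simp
qed

text \<open>
  A service of the large length \<open>y\<close> meets \<open>(1 + o(1)) lam y\<close> arrivals, so its weight is about
  \<open>(1 + c lam) y\<close>; regular variation turns the factor \<open>1 + c lam\<close> into its power \<open>\<tau>\<close>.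
\<close>

lemma weight_tail:
  assumes "0 \<le> c"
  shows "((\<lambda>x. D.prob {d. x < weight c d} / Gbar x) \<longlongrightarrow> (1 + c * lam) powr \<tau>) at_top"
proof -
  let ?a = "\<lambda>\<delta>. 1 + c * lam * (1 - \<delta>)" and ?a' = "\<lambda>\<delta>. 1 + c * lam * (1 + \<delta>)"
  have a: "0 < ?a \<delta>" "0 < ?a' \<delta>" if "0 < \<delta>" "\<delta> < 1" for \<delta>
    using assms lam_pos that by (auto intro!: add_pos_nonneg mult_nonneg_nonneg)
  let ?l = "\<lambda>\<delta> x. (1 - exp (- (lam * \<delta>\<^sup>2 / 4 / ?a \<delta>) * x)) * (Gbar (1 / ?a \<delta> * x) / Gbar x)"
  let ?u = "\<lambda>\<delta> x. Gbar ((1 - \<delta>) / ?a' \<delta> * x) / Gbar x + exp \<delta> * (exp (- (\<delta> * \<delta> / (c + 1)) * x) / Gbar x)"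
  show ?thesis
  proof (rule tendsto_sandwich_approx[where l = ?l and u = ?u and L = "\<lambda>\<delta>. (1 - 0) * (1 / ?a \<delta>) powr - \<tau>"
        and U = "\<lambda>\<delta>. ((1 - \<delta>) / ?a' \<delta>) powr - \<tau> + exp \<delta> * 0"])
    show "\<forall>\<^sub>F \<delta> in at_right 0. (\<forall>\<^sub>F x in at_top. ?l \<delta> x \<le> D.prob {d. x < weight c d} / Gbar x) \<and>
        (?l \<delta> \<longlongrightarrow> (1 - 0) * (1 / ?a \<delta>) powr - \<tau>) at_top"
    proof (rule eventually_at_right_0I[of 1])
      fix \<delta> :: real assume \<delta>: "0 < \<delta>" "\<delta> < 1"
      have k: "0 < lam * \<delta>\<^sup>2 / 4 / ?a \<delta>"
        using \<delta> a[OF \<delta>] lam_pos by (intro divide_pos_pos mult_pos_pos zero_less_power) auto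
      have "((\<lambda>x. exp (- e * x)) \<longlongrightarrow> 0) at_top" if "0 < e" for e :: real
        using that by real_asymp
      from this[OF k] have "(?l \<delta> \<longlongrightarrow> (1 - 0) * (1 / ?a \<delta>) powr - \<tau>) at_top"
        using a[OF \<delta>] by (intro tendsto_mult tendsto_diff tendsto_const tail_scale) auto
      moreover have "?l \<delta> x \<le> D.prob {d. x < weight c d} / Gbar x" for x
        using divide_right_mono[OF weight_tail_lower[OF assms \<delta>, of x], of "Gbar x"] tail_pos[of x] by simp
      ultimately show "(\<forall>\<^sub>F x in at_top. ?l \<delta> x \<le> D.prob {d. x < weight c d} / Gbar x) \<and>
        (?l \<delta> \<longlongrightarrow> (1 - 0) * (1 / ?a \<delta>) powr - \<tau>) at_top" by simp
    qed simp
    show "\<forall>\<^sub>F \<delta> in at_right 0. (\<forall>\<^sub>F x in at_top. D.prob {d. x < weight c d} / Gbar x \<le> ?u \<delta> x) \<and>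
        (?u \<delta> \<longlongrightarrow> ((1 - \<delta>) / ?a' \<delta>) powr - \<tau> + exp \<delta> * 0) at_top"
    proof (rule eventually_at_right_0I[of 1])
      fix \<delta> :: real assume \<delta>: "0 < \<delta>" "\<delta> < 1"
      have "0 < \<delta> * \<delta> / (c + 1)" using \<delta> assms by simp
      then have "(?u \<delta> \<longlongrightarrow> ((1 - \<delta>) / ?a' \<delta>) powr - \<tau> + exp \<delta> * 0) at_top"
        using a[OF \<delta>] \<delta> by (intro tendsto_add tendsto_mult tendsto_const tail_scale exp_negligible) auto
      moreover have "\<forall>\<^sub>F x in at_top. D.prob {d. x < weight c d} / Gbar x \<le> ?u \<delta> x"
        using eventually_gt_at_top[of 0]
      proof eventually_elim
        case (elim x)
        show ?case
          using divide_right_mono[OF weight_tail_upper[OF assms \<delta> elim], of "Gbar x"] tail_pos[of x]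
          by (simp add: add_divide_distrib)
      qed
      ultimately show "(\<forall>\<^sub>F x in at_top. D.prob {d. x < weight c d} / Gbar x \<le> ?u \<delta> x) \<and>
        (?u \<delta> \<longlongrightarrow> ((1 - \<delta>) / ?a' \<delta>) powr - \<tau> + exp \<delta> * 0) at_top" by blast
    qed simp
    have c: "1 + c * lam * 1 \<noteq> 0" "0 < 1 + c * lam" using assms lam_pos by (auto intro!: add_pos_nonneg mult_nonneg_nonneg simp: add_nonneg_eq_0_iff)
    have "((\<lambda>\<delta>. (1 - 0) * (1 / ?a \<delta>) powr - \<tau>) \<longlongrightarrow> (1 - 0) * (1 / (1 + c * lam * (1 - 0))) powr - \<tau>) (at_right 0)"
      using c by (intro tendsto_intros) auto
    then show "((\<lambda>\<delta>. (1 - 0) * (1 / ?a \<delta>) powr - \<tau>) \<longlongrightarrow> (1 + c * lam) powr \<tau>) (at_right 0)"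
      using c by (simp add: powr_divide powr_minus field_simps)
    have "((\<lambda>\<delta>. ((1 - \<delta>) / ?a' \<delta>) powr - \<tau> + exp \<delta> * 0) \<longlongrightarrow> ((1 - 0) / (1 + c * lam * (1 + 0))) powr - \<tau> + exp 0 * 0) (at_right 0)"
      using c by (intro tendsto_intros) auto
    then show "((\<lambda>\<delta>. ((1 - \<delta>) / ?a' \<delta>) powr - \<tau> + exp \<delta> * 0) \<longlongrightarrow> (1 + c * lam) powr \<tau>) (at_right 0)"
      using c by (simp add: powr_divide powr_minus field_simps)
  qed
qed

lemma mean_service_time: "(\<integral>\<^sup>+d. ennreal (service_time d) \<partial>D) = ennreal b"
proof -
  have "(\<integral>\<^sup>+d. ennreal (service_time d) \<partial>D) = (\<integral>\<^sup>+x. ennreal (max 0 (fst x)) \<partial>J)"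
    unfolding service_time_def by (rule nn_integral_service_law_fst) measurable
  also have "\<dots> = (\<integral>\<^sup>+s. ennreal (max 0 s) \<partial>G)"
    by (rule nn_integral_job_law_fst) measurable
  also have "\<dots> = (\<integral>\<^sup>+s. ennreal s \<partial>G)"
    using G_nonneg by (intro nn_integral_cong_AE) auto
  also have "\<dots> = ennreal b"
    using G_integrable G_nonneg G_mean by (subst nn_integral_eq_integral) auto
  finally show ?thesis .
qed

lemma mean_arrivals: "(\<integral>\<^sup>+d. of_nat (arrivals d) \<partial>D) = ennreal (lam * b)"
  unfolding arrivals_def job_law_mean_arrivals[symmetric]
  by (rule nn_integral_service_law_fst) measurable

lemma mean_returns: "(\<integral>\<^sup>+d. of_bool (returns d) \<partial>D) = ennreal p"
  by (subst nn_integral_service_law) (simp_all add: returns_def J.emeasure_space_1[simplified])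

lemma mean_weight:
  assumes "0 \<le> c"
  shows "integrable D (weight c)" "D.expectation (weight c) = b + c * r"
proof -
  have "(\<integral>\<^sup>+d. ennreal (weight c d) \<partial>D) =
      (\<integral>\<^sup>+d. ennreal (service_time d) + ennreal c * (of_nat (arrivals d) + of_bool (returns d)) \<partial>D)"
    using assms by (intro nn_integral_cong)
      (auto simp: weight_def ennreal_mult ennreal_of_nat_eq_real_of_nat)
  also have "\<dots> = ennreal b + ennreal c * (ennreal (lam * b) + ennreal p)"
    by (simp add: nn_integral_add nn_integral_cmult mean_service_time mean_arrivals mean_returns)
  also have "\<dots> = ennreal (b + c * r)"
    using assms b_pos lam_pos p_pos by (simp add: add.commute flip: ennreal_plus ennreal_mult)
  finally have *: "(\<integral>\<^sup>+d. ennreal (weight c d) \<partial>D) = ennreal (b + c * r)" .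
  then show "integrable D (weight c)"
    using weight_nonneg[OF assms] by (intro integrableI_nonneg) auto
  show "D.expectation (weight c) = b + c * r"
  proof -
    have "D.expectation (weight c) = enn2real (\<integral>\<^sup>+d. ennreal (weight c d) \<partial>D)"
      using weight_nonneg[OF assms] by (intro integral_eq_nn_integral) auto
    also have "\<dots> = b + c * r"
      unfolding * using assms b_pos p_pos lam_pos by (intro enn2real_ennreal add_nonneg_nonneg mult_nonneg_nonneg) auto
    finally show ?thesis .
  qed
qed

end

section \<open>One round of services\<close>

text \<open>
  In a round with \<open>m\<close> customers in front of the tagged one, the services \<open>0, ..., m - 1\<close> are those of
  the customers in front and service \<open>m\<close> is that of the tagged customer.
\<close>

definition round_time :: "nat \<Rightarrow> (nat \<Rightarrow> service) \<Rightarrow> real" where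
  "round_time m \<omega> = (\<Sum>i<Suc m. service_time (\<omega> i))"

text \<open>
  The next round is preceded by everybody who joined the line during this one: the external arrivals
  and the returning customers. The return decision of service \<open>m\<close> concerns the tagged customer and
  does not count.
\<close>

definition others_after :: "nat \<Rightarrow> (nat \<Rightarrow> service) \<Rightarrow> nat" where
  "others_after m \<omega> = (\<Sum>i<m. arrivals (\<omega> i) + of_bool (returns (\<omega> i))) + arrivals (\<omega> m)"

context feedback_law
begin

abbreviation "P \<equiv> seq.S"

lemma measurable_service_D [measurable]:
  "service_time \<in> borel_measurable D" "arrivals \<in> measurable D (count_space UNIV)"
  "returns \<in> measurable D (count_space UNIV)" "weight c \<in> borel_measurable D"
  by measurable

lemma space_P [simp]: "space P = UNIV"
  by (simp add: space_PiM)

lemma round_time_nonneg: "0 \<le> round_time m \<omega>"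
  by (simp add: round_time_def sum_nonneg)

lemma measurable_round [measurable]:
  "round_time m \<in> borel_measurable P" "others_after m \<in> measurable P (count_space UNIV)"
  unfolding round_time_def[abs_def] others_after_def[abs_def] by measurable

lemma weight_sum:
  "(\<Sum>i<Suc m. weight c (\<omega> i)) = round_time m \<omega> + c * real (others_after m \<omega>) + c * of_bool (returns (\<omega> m))"
  by (simp add: round_time_def others_after_def weight_def sum.distrib sum_distrib_left[symmetric] algebra_simps)

lemma measurable_coordinate_D: "(\<lambda>\<omega>. \<omega> i) \<in> measurable P D"
  by (rule measurable_component_singleton) simp

lemma distr_P_component: "distr P D (\<lambda>\<omega>. \<omega> i) = D"
  using seq.PiM_component[of i] by simp

text \<open>
  Makes all results on heavy-tailed sums available for the weights of successive services.
\<close>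

lemma iid_weights:
  assumes "0 \<le> c"
  shows "iid_heavy_tail P Gbar \<tau> (\<lambda>i \<omega>. weight c (\<omega> i)) (b + c * r) ((1 + c * lam) powr \<tau>)"
proof -
  have distr: "distr P borel (\<lambda>\<omega>. weight c (\<omega> i)) = distr D borel (weight c)" for i
  proof -
    have "distr D borel (weight c) = distr (distr P D (\<lambda>\<omega>. \<omega> i)) borel (weight c)"
      unfolding distr_P_component ..
    also have "\<dots> = distr P borel (weight c \<circ> (\<lambda>\<omega>. \<omega> i))"
      by (rule distr_distr[OF measurable_service_D(4) measurable_coordinate_D])
    finally show ?thesis by (simp add: comp_def)
  qed
  have "prob_space.indep_vars P (\<lambda>_. D) (\<lambda>i \<omega>. \<omega> i) UNIV"
    by (subst seq.P.indep_vars_iff_distr_eq_PiM) (auto simp: distr_P_component restrict_UNIV)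
  then have "prob_space.indep_vars P (\<lambda>_. borel) (\<lambda>i \<omega>. weight c (\<omega> i)) UNIV"
    by (rule seq.P.indep_vars_compose2) measurable
  moreover have "integrable P (\<lambda>\<omega>. weight c (\<omega> 0))" "seq.P.expectation (\<lambda>\<omega>. weight c (\<omega> 0)) = b + c * r"
  proof -
    have "integrable (distr P D (\<lambda>\<omega>. \<omega> 0)) (weight c)"
      unfolding distr_P_component by (rule mean_weight[OF assms])
    then show "integrable P (\<lambda>\<omega>. weight c (\<omega> 0))"
      by (subst (asm) integrable_distr_eq) auto
    have "seq.P.expectation (\<lambda>\<omega>. weight c (\<omega> 0)) = (\<integral>d. weight c d \<partial>distr P D (\<lambda>\<omega>. \<omega> 0))"
      by (subst integral_distr) auto
    then show "seq.P.expectation (\<lambda>\<omega>. weight c (\<omega> 0)) = b + c * r"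
      unfolding distr_P_component using mean_weight[OF assms] by simp
  qed
  moreover have "seq.P.prob {\<omega> \<in> space P. x < weight c (\<omega> 0)} = D.prob {d. x < weight c d}" for x
  proof -
    have "D.prob {d. x < weight c d} = measure (distr P D (\<lambda>\<omega>. \<omega> 0)) {d. x < weight c d}"
      unfolding distr_P_component ..
    also have "\<dots> = seq.P.prob {\<omega> \<in> space P. x < weight c (\<omega> 0)}"
      by (subst measure_distr[OF measurable_coordinate_D]) (auto intro!: sets_DI simp: vimage_def)
    finally show ?thesis ..
  qed
  ultimately show ?thesis
    using weight_tail[OF assms] distr weight_nonneg[OF assms]
    by unfold_locales auto
qed

text \<open>
  The tail of the functional ``time plus \<open>c\<close> times customers in front'' gathered in one round; it
  plays the role of \<open>h\<close> in \<open>random_sum_tail\<close>.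
\<close>

definition round_tail :: "real \<Rightarrow> nat \<Rightarrow> real \<Rightarrow> real" where
  "round_tail c m t = seq.P.prob {\<omega>. t < round_time m \<omega> + c * real (others_after m \<omega>)}"

lemma sets_PI: "Measurable.pred P Q \<Longrightarrow> {\<omega>. Q \<omega>} \<in> sets P"
  by (simp add: pred_def)

text \<open>
  The weight of service \<open>m\<close> counts the return of the tagged customer, which the functional does not.
  The error is at most \<open>c\<close>, and nothing is lost if service \<open>m\<close> is dropped altogether.
\<close>

lemma round_tail_bounds:
  assumes "0 \<le> c"
  shows "round_tail c m t \<le> seq.P.prob {\<omega> \<in> space P. t < (\<Sum>i<Suc m. weight c (\<omega> i))}"
    and "seq.P.prob {\<omega> \<in> space P. t + c < (\<Sum>i<Suc m. weight c (\<omega> i))} \<le> round_tail c m t"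
    and "seq.P.prob {\<omega> \<in> space P. t < (\<Sum>i<m. weight c (\<omega> i))} \<le> round_tail c m t"
proof -
  have 1: "round_time m \<omega> + c * real (others_after m \<omega>) \<le> (\<Sum>i<Suc m. weight c (\<omega> i))"
    and 2: "(\<Sum>i<Suc m. weight c (\<omega> i)) \<le> round_time m \<omega> + c * real (others_after m \<omega>) + c" for \<omega>
    using assms unfolding weight_sum by (auto simp: of_bool_def)
  have 3: "(\<Sum>i<m. weight c (\<omega> i)) \<le> round_time m \<omega> + c * real (others_after m \<omega>)" for \<omega>
  proof -
    have "(\<Sum>i<Suc m. weight c (\<omega> i)) = (\<Sum>i<m. weight c (\<omega> i)) + weight c (\<omega> m)" by simp
    moreover have "c * of_bool (returns (\<omega> m)) \<le> weight c (\<omega> m)"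
      using assms by (simp add: weight_def algebra_simps)
    ultimately show ?thesis unfolding weight_sum by linarith
  qed
  show "round_tail c m t \<le> seq.P.prob {\<omega> \<in> space P. t < (\<Sum>i<Suc m. weight c (\<omega> i))}"
  proof (unfold round_tail_def, intro seq.P.finite_measure_mono)
    show "{\<omega>. t < round_time m \<omega> + c * real (others_after m \<omega>)} \<subseteq> {\<omega> \<in> space P. t < (\<Sum>i<Suc m. weight c (\<omega> i))}"
      using 1 by (auto intro: less_le_trans simp del: sum.lessThan_Suc)
  qed measurable
  show "seq.P.prob {\<omega> \<in> space P. t + c < (\<Sum>i<Suc m. weight c (\<omega> i))} \<le> round_tail c m t"
  proof (unfold round_tail_def, intro seq.P.finite_measure_mono sets_PI)
    show "{\<omega> \<in> space P. t + c < (\<Sum>i<Suc m. weight c (\<omega> i))} \<subseteq> {\<omega>. t < round_time m \<omega> + c * real (others_after m \<omega>)}"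
    proof safe
      fix \<omega> assume "t + c < (\<Sum>i<Suc m. weight c (\<omega> i))"
      with 2[of \<omega>] show "t < round_time m \<omega> + c * real (others_after m \<omega>)" by linarith
    qed
  qed measurable
  show "seq.P.prob {\<omega> \<in> space P. t < (\<Sum>i<m. weight c (\<omega> i))} \<le> round_tail c m t"
  proof (unfold round_tail_def, intro seq.P.finite_measure_mono sets_PI)
    show "{\<omega> \<in> space P. t < (\<Sum>i<m. weight c (\<omega> i))} \<subseteq> {\<omega>. t < round_time m \<omega> + c * real (others_after m \<omega>)}"
      using 3 by (auto intro: less_le_trans)
  qed measurable
qed

lemma round_tail_antimono: "s \<le> t \<Longrightarrow> round_tail c m t \<le> round_tail c m s"
  unfolding round_tail_def by (intro seq.P.finite_measure_mono sets_PI) auto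

lemma round_tail_neg:
  assumes "0 \<le> c" "t < 0"
  shows "round_tail c m t = 1"
proof -
  have "{\<omega>. t < round_time m \<omega> + c * real (others_after m \<omega>)} = UNIV"
    using assms round_time_nonneg[of m] by (auto intro!: less_le_trans[OF assms(2)] add_nonneg_nonneg)
  then show ?thesis using seq.P.prob_space by (simp add: round_tail_def)
qed

lemma round_tail_le_1: "round_tail c m t \<le> 1" and round_tail_nonneg: "0 \<le> round_tail c m t"
  by (simp_all add: round_tail_def)

lemma round_tail_limit:
  assumes "0 \<le> c"
  shows "((\<lambda>x. round_tail c m (x - y) / Gbar x) \<longlongrightarrow> (real m + 1) * (1 + c * lam) powr \<tau>) at_top"
proof -
  interpret I: iid_heavy_tail P Gbar \<tau> "\<lambda>i \<omega>. weight c (\<omega> i)" "b + c * r" "(1 + c * lam) powr \<tau>"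
    by (rule iid_weights[OF assms])
  let ?Q = "\<lambda>t. seq.P.prob {\<omega> \<in> space P. t < (\<Sum>i<Suc m. weight c (\<omega> i))}"
  have shift: "((\<lambda>x. ?Q (x - z) / Gbar x) \<longlongrightarrow> real (Suc m) * (1 + c * lam) powr \<tau>) at_top" for z
  proof -
    have "filterlim (\<lambda>x. x - z) at_top at_top"
      using filterlim_tendsto_add_at_top[OF tendsto_const[of "- z"] filterlim_ident[of at_top]] by simp
    from filterlim_compose[OF I.fixed_sum_tail this, of "Suc m"]
    have "((\<lambda>x. ?Q (x - z) / Gbar (x - z) * (Gbar (x - z) / Gbar x)) \<longlongrightarrow> real (Suc m) * (1 + c * lam) powr \<tau> * 1) at_top"
      by (intro tendsto_mult tail_shift)
    moreover have "?Q (x - z) / Gbar (x - z) * (Gbar (x - z) / Gbar x) = ?Q (x - z) / Gbar x" for x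
      using tail_pos[of "x - z"] by simp
    ultimately show ?thesis by (simp only: mult_1_right)
  qed
  show ?thesis
  proof (rule tendsto_sandwich)
    show "\<forall>\<^sub>F x in at_top. round_tail c m (x - y) / Gbar x \<le> ?Q (x - y) / Gbar x"
      by (intro always_eventually allI divide_right_mono[OF _ less_imp_le[OF tail_pos]] round_tail_bounds(1) assms)
    have "?Q (x - (y - c)) \<le> round_tail c m (x - y)" for x
      using round_tail_bounds(2)[OF assms, where t="x - y" and m=m] by (simp add: algebra_simps)
    then show "\<forall>\<^sub>F x in at_top. ?Q (x - (y - c)) / Gbar x \<le> round_tail c m (x - y) / Gbar x"
      by (intro always_eventually allI divide_right_mono[OF _ less_imp_le[OF tail_pos]])
    show "((\<lambda>x. ?Q (x - y) / Gbar x) \<longlongrightarrow> (real m + 1) * (1 + c * lam) powr \<tau>) at_top"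
      using shift[of y] by (simp add: add.commute)
    show "((\<lambda>x. ?Q (x - (y - c)) / Gbar x) \<longlongrightarrow> (real m + 1) * (1 + c * lam) powr \<tau>) at_top"
      using shift[of "y - c"] by (simp add: add.commute)
  qed
qed

text \<open>
  The round has \<open>n + 1\<close> services but the level grows by \<open>v\<close> only \<open>n\<close> times, which amounts to a
  shift of the level by \<open>v\<close>.
\<close>

lemma round_tail_upper:
  assumes "0 \<le> c" "b + c * r < v"
  obtains B where "0 < B" "\<And>n x. 0 \<le> x \<Longrightarrow> round_tail c n (v * real n + x) \<le> B * (real n + 1) * Gbar x"
proof -
  interpret I: iid_heavy_tail P Gbar \<tau> "\<lambda>i \<omega>. weight c (\<omega> i)" "b + c * r" "(1 + c * lam) powr \<tau>"
    by (rule iid_weights[OF assms(1)])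
  obtain B1 where B1: "0 < B1" "\<And>n x. 0 \<le> x \<Longrightarrow>
      seq.P.prob {\<omega> \<in> space P. v * real n + x < (\<Sum>i<n. weight c (\<omega> i))} \<le> B1 * real n * Gbar x"
    using I.sum_tail_bound[OF assms(2)] by blast
  obtain B2 where B2: "0 < B2" "\<And>x. 0 \<le> x \<Longrightarrow> Gbar (1 / 2 * x) \<le> B2 * Gbar x"
    using scale_bounded[of "1 / 2"] by auto
  have v: "0 < v" using assms I.mean_nonneg by linarith
  define B where "B = max (B1 * B2) (1 / Gbar (2 * v))"
  show thesis
  proof
    show "0 < B" using B1 B2 by (auto simp: B_def less_max_iff_disj)
    fix n :: nat and x :: real assume "0 \<le> x"
    show "round_tail c n (v * real n + x) \<le> B * (real n + 1) * Gbar x"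
    proof (cases "2 * v \<le> x")
      case True
      have "round_tail c n (v * real n + x) \<le> seq.P.prob {\<omega> \<in> space P. v * real (Suc n) + (x - v) < (\<Sum>i<Suc n. weight c (\<omega> i))}"
        using round_tail_bounds(1)[OF assms(1), of n "v * real n + x"] by (simp add: algebra_simps)
      also have "\<dots> \<le> B1 * real (Suc n) * Gbar (x - v)" using True v by (intro B1) auto
      also have "\<dots> \<le> B1 * real (Suc n) * Gbar (1 / 2 * x)"
        using True B1 by (intro mult_left_mono tail_antimono) auto
      also have "\<dots> \<le> B1 * real (Suc n) * (B2 * Gbar x)"
        using \<open>0 \<le> x\<close> B1 by (intro mult_left_mono B2) auto
      also have "\<dots> = (B1 * B2) * ((real n + 1) * Gbar x)" by (simp add: algebra_simps)
      also have "\<dots> \<le> B * ((real n + 1) * Gbar x)"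
        using tail_pos[of x] by (intro mult_right_mono) (auto simp: B_def)
      finally show ?thesis by (simp only: mult.assoc)
    next
      case False
      have "Gbar (2 * v) \<le> Gbar x" using False by (intro tail_antimono) auto
      then have "1 \<le> 1 / Gbar (2 * v) * Gbar x" using tail_pos[of "2 * v"] by (simp add: field_simps)
      also have "\<dots> \<le> B * ((real n + 1) * Gbar x)"
        using tail_pos[of x] tail_pos[of "2 * v"]
        by (intro mult_mono) (auto simp: B_def intro: le_max_iff_disj[THEN iffD2] mult_nonneg_nonneg)
      finally show ?thesis
        using round_tail_le_1[of c n "v * real n + x"] unfolding mult.assoc by linarith
    qed
  qed
qed

lemma round_tail_lower:
  assumes "0 \<le> c" "v < b + c * r"
  shows "(\<lambda>n. round_tail c n (v * real n)) \<longlonglongrightarrow> 1"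
proof -
  interpret I: iid_heavy_tail P Gbar \<tau> "\<lambda>i \<omega>. weight c (\<omega> i)" "b + c * r" "(1 + c * lam) powr \<tau>"
    by (rule iid_weights[OF assms(1)])
  let ?Q = "\<lambda>n. seq.P.prob {\<omega> \<in> space P. (\<Sum>i<n. weight c (\<omega> i)) \<le> v * real n}"
  have "?Q \<longlonglongrightarrow> 0"
    using I.lower_deviation[of "b + c * r - v"] assms by simp
  then have lim: "(\<lambda>n. 1 - ?Q n) \<longlonglongrightarrow> 1 - 0" by (intro tendsto_intros)
  have "1 - ?Q n \<le> round_tail c n (v * real n)" for n
  proof -
    have "1 - ?Q n = seq.P.prob (space P - {\<omega> \<in> space P. (\<Sum>i<n. weight c (\<omega> i)) \<le> v * real n})"
      by (intro seq.P.prob_compl[symmetric]) measurable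
    also have "space P - {\<omega> \<in> space P. (\<Sum>i<n. weight c (\<omega> i)) \<le> v * real n} =
        {\<omega> \<in> space P. v * real n < (\<Sum>i<n. weight c (\<omega> i))}" by auto
    also note round_tail_bounds(3)[OF assms(1)]
    finally show ?thesis .
  qed
  then have le: "\<forall>\<^sub>F n in sequentially. 1 - ?Q n \<le> round_tail c n (v * real n)"
    by (intro always_eventually allI)
  have "\<forall>\<^sub>F n in sequentially. round_tail c n (v * real n) \<le> 1"
    by (intro always_eventually allI round_tail_le_1)
  from tendsto_sandwich[OF le this _ tendsto_const] lim show ?thesis by simp
qed

end

section \<open>The Markov chain of rounds\<close>

context feedback_law
begin

abbreviation "S2 \<equiv> (borel \<Otimes>\<^sub>M count_space UNIV) :: (real \<times> nat) measure"

definition step :: "(real \<times> nat) \<times> (nat \<Rightarrow> service) \<Rightarrow> real \<times> nat" where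
  "step = (\<lambda>(z, \<omega>). (fst z + round_time (snd z) \<omega>, others_after (snd z) \<omega>))"

text \<open>
  The law of (time elapsed, number of customers in front of the tagged one) after \<open>j\<close> rounds, as long
  as the tagged customer keeps returning. It starts from the empty system.
\<close>

primrec chain :: "nat \<Rightarrow> (real \<times> nat) measure" where
  "chain 0 = return S2 (0, 0)"
| "chain (Suc j) = distr (chain j \<Otimes>\<^sub>M P) S2 step"

declare chain.simps(2) [simp del]

lemma sets_chain [measurable_cong]: "sets (chain j) = sets S2"
  by (cases j) (auto simp: chain.simps(2))

lemma space_chain [simp]: "space (chain j) = UNIV"
  using sets_eq_imp_space_eq[OF sets_chain] by (simp add: space_pair_measure)

lemma measurable_step [measurable]: "step \<in> measurable (S2 \<Otimes>\<^sub>M P) S2"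
proof -
  have [measurable]: "(\<lambda>x. round_time (snd (fst x)) (snd x)) \<in> borel_measurable (S2 \<Otimes>\<^sub>M P)"
    by (rule measurable_compose_countable[where g="\<lambda>x. snd (fst x)" and f="\<lambda>m x. round_time m (snd x)"]) measurable
  have [measurable]: "(\<lambda>x. others_after (snd (fst x)) (snd x)) \<in> measurable (S2 \<Otimes>\<^sub>M P) (count_space UNIV)"
    by (rule measurable_compose_countable[where g="\<lambda>x. snd (fst x)" and f="\<lambda>m x. others_after m (snd x)"]) measurable
  have eq: "step = (\<lambda>x. (fst (fst x) + round_time (snd (fst x)) (snd x), others_after (snd (fst x)) (snd x)))"
    by (auto simp: step_def)
  show ?thesis unfolding eq by measurable
qed

lemma prob_space_chain: "prob_space (chain j)"
proof (induction j)
  case 0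
  show ?case by (auto intro!: prob_space_return simp: space_pair_measure)
next
  case (Suc j)
  then interpret C: prob_space "chain j" .
  interpret CP: pair_prob_space "chain j" P ..
  have "step \<in> measurable (chain j \<Otimes>\<^sub>M P) S2" by measurable
  then show ?case by (simp add: CP.prob_space_distr chain.simps(2))
qed

lemma nn_integral_chain_Suc:
  assumes [measurable]: "\<phi> \<in> borel_measurable S2"
  shows "(\<integral>\<^sup>+z. \<phi> z \<partial>chain (Suc j)) = (\<integral>\<^sup>+z. \<integral>\<^sup>+\<omega>. \<phi> (step (z, \<omega>)) \<partial>P \<partial>chain j)"
proof -
  have st: "step \<in> measurable (chain j \<Otimes>\<^sub>M P) S2" by measurable
  have "(\<integral>\<^sup>+z. \<phi> z \<partial>chain (Suc j)) = (\<integral>\<^sup>+x. \<phi> (step x) \<partial>(chain j \<Otimes>\<^sub>M P))"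
    by (simp add: nn_integral_distr[OF st] chain.simps(2))
  also have "\<dots> = (\<integral>\<^sup>+z. \<integral>\<^sup>+\<omega>. \<phi> (step (z, \<omega>)) \<partial>P \<partial>chain j)"
    by (rule seq.P.nn_integral_fst[symmetric]) (rule measurable_compose[OF st assms])
  finally show ?thesis .
qed

lemma nn_integral_coordinate:
  assumes "\<phi> \<in> borel_measurable D"
  shows "(\<integral>\<^sup>+\<omega>. \<phi> (\<omega> i) \<partial>P) = (\<integral>\<^sup>+d. \<phi> d \<partial>D)"
proof -
  have "(\<integral>\<^sup>+d. \<phi> d \<partial>D) = (\<integral>\<^sup>+d. \<phi> d \<partial>distr P D (\<lambda>\<omega>. \<omega> i))"
    unfolding distr_P_component ..
  also have "\<dots> = (\<integral>\<^sup>+\<omega>. \<phi> (\<omega> i) \<partial>P)"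
    using assms by (intro nn_integral_distr measurable_coordinate_D) auto
  finally show ?thesis ..
qed

text \<open>
  Each customer in front is replaced by \<open>r = p + lam * b\<close> customers on average, and the service of the
  tagged customer lets in \<open>lam * b\<close> more.
\<close>

lemma mean_others_after: "(\<integral>\<^sup>+\<omega>. of_nat (others_after m \<omega>) \<partial>P) = ennreal (real m * r + lam * b)"
proof -
  have "(\<integral>\<^sup>+\<omega>. of_nat (others_after m \<omega>) \<partial>P) =
      (\<integral>\<^sup>+\<omega>. (\<Sum>i<m. of_nat (arrivals (\<omega> i)) + of_bool (returns (\<omega> i))) + of_nat (arrivals (\<omega> m)) \<partial>P)"
    by (simp add: others_after_def)
  also have "\<dots> = (\<Sum>i<m. ennreal (lam * b) + ennreal p) + ennreal (lam * b)"
    by (simp add: nn_integral_add nn_integral_sum nn_integral_coordinate[of "\<lambda>d. of_nat (arrivals d)"]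
        nn_integral_coordinate[of "\<lambda>d. of_bool (returns d)"] mean_arrivals mean_returns)
  also have "\<dots> = ennreal (real m * r + lam * b)"
    using lam_pos b_pos p_pos by (simp add: ennreal_of_nat_eq_real_of_nat add.commute flip: ennreal_plus ennreal_mult)
  finally show ?thesis .
qed

abbreviation "mean_others \<equiv> m0 r lam b"

lemma mean_others_nonneg: "0 \<le> mean_others j"
  using stable r_pos lam_pos b_pos
  by (auto simp: m0_def intro!: mult_nonneg_nonneg divide_nonneg_nonneg power_le_one)

lemma mean_others_le: "mean_others j \<le> lam * b / (1 - r)"
proof -
  have "(1 - r ^ j) * (lam * b / (1 - r)) \<le> 1 * (lam * b / (1 - r))"
    using stable r_pos lam_pos b_pos by (intro mult_right_mono) auto
  then show ?thesis by (simp add: m0_def)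
qed

lemma mean_others_Suc: "mean_others (Suc j) = r * mean_others j + lam * b"
proof -
  have "(1 - R ^ Suc j) / (1 - R) * A = R * ((1 - R ^ j) / (1 - R) * A) + A" if "R \<noteq> 1" for R A :: real
    using that by (simp add: field_simps)
  from this[of r "lam * b"] show ?thesis
    using stable unfolding m0_def by (simp add: mult.assoc)
qed

text \<open>
  Identifies \<open>m0\<close> as the mean number of customers in front of the tagged one.
\<close>

lemma mean_chain: "(\<integral>\<^sup>+z. of_nat (snd z) \<partial>chain j) = ennreal (mean_others j)"
proof (induction j)
  case 0
  show ?case by (simp add: nn_integral_return space_pair_measure m0_def)
next
  case (Suc j)
  interpret C: prob_space "chain j" by (rule prob_space_chain)
  have "(\<integral>\<^sup>+z. of_nat (snd z) \<partial>chain (Suc j)) = (\<integral>\<^sup>+z. \<integral>\<^sup>+\<omega>. of_nat (others_after (snd z) \<omega>) \<partial>P \<partial>chain j)"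
    by (subst nn_integral_chain_Suc) (simp_all add: step_def)
  also have "\<dots> = (\<integral>\<^sup>+z. ennreal r * of_nat (snd z) + ennreal (lam * b) \<partial>chain j)"
  proof -
    have "ennreal (real m * R + A) = ennreal R * of_nat m + ennreal A" if "0 \<le> R" "0 \<le> A" for m R A
      using that by (simp add: ennreal_of_nat_eq_real_of_nat ennreal_mult mult.commute)
    from this[of r "lam * b"] show ?thesis
      unfolding mean_others_after using r_pos lam_pos b_pos by (intro nn_integral_cong) auto
  qed
  also have "\<dots> = ennreal r * ennreal (mean_others j) + ennreal (lam * b)"
    using Suc C.emeasure_space_1 by (subst nn_integral_add) (auto simp: nn_integral_cmult)
  also have "\<dots> = ennreal (mean_others (Suc j))"
    unfolding mean_others_Suc using r_pos lam_pos b_pos mean_others_nonneg[of j]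
    by (subst ennreal_plus) (auto simp only: ennreal_mult intro!: mult_nonneg_nonneg)
  finally show ?case .
qed

lemma integrable_chain: "integrable (chain j) (\<lambda>z. real (snd z))"
  and expectation_chain: "(\<integral>z. real (snd z) \<partial>chain j) = mean_others j"
proof -
  have *: "(\<integral>\<^sup>+z. ennreal (real (snd z)) \<partial>chain j) = ennreal (mean_others j)"
    unfolding mean_chain[symmetric] by (simp add: ennreal_of_nat_eq_real_of_nat)
  then show "integrable (chain j) (\<lambda>z. real (snd z))"
    by (intro integrableI_nonneg) auto
  have "(\<integral>z. real (snd z) \<partial>chain j) = enn2real (\<integral>\<^sup>+z. ennreal (real (snd z)) \<partial>chain j)"
    by (intro integral_eq_nn_integral) auto
  then show "(\<integral>z. real (snd z) \<partial>chain j) = mean_others j"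
    unfolding * by (simp add: mean_others_nonneg)
qed

lemma sets_S2I: "Measurable.pred S2 Q \<Longrightarrow> {z. Q z} \<in> sets S2"
  by (simp add: pred_def space_pair_measure)

lemma measurable_round_tail [measurable]: "round_tail c m \<in> borel_measurable borel"
  by (intro borel_measurable_antimono antimonoI round_tail_antimono)

lemma measurable_round_tail_state [measurable]:
  "(\<lambda>z. round_tail c (snd z) (x - fst z)) \<in> borel_measurable S2"
  by (rule measurable_compose_countable[where g=snd and f="\<lambda>m z. round_tail c m (x - fst z)"]) measurable

lemma chain_tail_Suc:
  "measure (chain (Suc j)) {z. x < fst z + c * real (snd z)} = (\<integral>z. round_tail c (snd z) (x - fst z) \<partial>chain j)"
proof -
  interpret C: prob_space "chain j" by (rule prob_space_chain)
  interpret C': prob_space "chain (Suc j)" by (rule prob_space_chain)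
  let ?A = "{z :: real \<times> nat. x < fst z + c * real (snd z)}"
  have A [measurable]: "?A \<in> sets S2" by (intro sets_S2I) measurable
  have "emeasure (chain (Suc j)) ?A = (\<integral>\<^sup>+z. indicator ?A z \<partial>chain (Suc j))"
    using A by (intro nn_integral_indicator[symmetric]) (simp only: sets_chain)
  also have "\<dots> = (\<integral>\<^sup>+z. \<integral>\<^sup>+\<omega>. indicator ?A (step (z, \<omega>)) \<partial>P \<partial>chain j)"
    by (rule nn_integral_chain_Suc) (rule borel_measurable_indicator[OF A])
  also have "\<dots> = (\<integral>\<^sup>+z. ennreal (round_tail c (snd z) (x - fst z)) \<partial>chain j)"
  proof (intro nn_integral_cong)
    fix z :: "real \<times> nat"
    have "(\<integral>\<^sup>+\<omega>. indicator ?A (step (z, \<omega>)) \<partial>P) =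
        (\<integral>\<^sup>+\<omega>. indicator {\<omega>. x - fst z < round_time (snd z) \<omega> + c * real (others_after (snd z) \<omega>)} \<omega> \<partial>P)"
      by (intro nn_integral_cong) (auto simp: step_def indicator_def)
    also have "\<dots> = emeasure P {\<omega>. x - fst z < round_time (snd z) \<omega> + c * real (others_after (snd z) \<omega>)}"
      by (intro nn_integral_indicator sets_PI) measurable
    finally show "(\<integral>\<^sup>+\<omega>. indicator ?A (step (z, \<omega>)) \<partial>P) = ennreal (round_tail c (snd z) (x - fst z))"
      by (simp add: round_tail_def seq.P.emeasure_eq_measure)
  qed
  also have "\<dots> = ennreal (\<integral>z. round_tail c (snd z) (x - fst z) \<partial>chain j)"
    by (intro nn_integral_eq_integral C.integrable_const_bound[of _ 1])
      (auto simp: round_tail_le_1 round_tail_nonneg)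
  finally show ?thesis
    unfolding C'.emeasure_eq_measure by (simp add: integral_nonneg_AE round_tail_nonneg)
qed

text \<open>
  The limiting constant of \<open>W\<^sub>j + c X\<^sub>j\<close>. First summand: the big jump happened in an earlier round, and
  by the law of large numbers each customer then in front contributes the mean weight \<open>b + c * r\<close>.
  Second summand: it happens in the last round, during one of \<open>X\<^sub>j + 1\<close> services.
\<close>

primrec tail_const :: "nat \<Rightarrow> real \<Rightarrow> real" where
  "tail_const 0 c = 0"
| "tail_const (Suc j) c = tail_const j (b + c * r) + (mean_others j + 1) * (1 + c * lam) powr \<tau>"

lemma isCont_tail_const: "0 \<le> c \<Longrightarrow> isCont (tail_const j) c"
proof (induction j arbitrary: c)
  case 0
  have "tail_const 0 = (\<lambda>_. 0)" by (rule ext) simp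
  then show ?case by simp
next
  case (Suc j)
  have eq: "tail_const (Suc j) = (\<lambda>c. tail_const j (b + c * r) + (mean_others j + 1) * (1 + c * lam) powr \<tau>)"
    by (rule ext) simp
  have "0 < 1 + c * lam" using Suc.prems lam_pos by (intro add_pos_nonneg) auto
  moreover have "isCont (\<lambda>c. tail_const j (b + c * r)) c"
    using Suc.prems b_pos r_pos by (intro isCont_o2[OF _ Suc.IH] continuous_intros) auto
  ultimately show ?case unfolding eq by (auto intro!: continuous_intros)
qed

lemma chain_tail:
  assumes "0 \<le> c"
  shows "((\<lambda>x. measure (chain j) {z. x < fst z + c * real (snd z)} / Gbar x) \<longlongrightarrow> tail_const j c) at_top"
  using assms
proof (induction j arbitrary: c)
  case 0
  have "\<forall>\<^sub>F x in at_top. measure (chain 0) {z. x < fst z + c * real (snd z)} / Gbar x = 0"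
    using eventually_ge_at_top[of 0]
  proof eventually_elim
    case (elim x)
    have "{z :: real \<times> nat. x < fst z + c * real (snd z)} \<in> sets S2" by (intro sets_S2I) measurable
    then show ?case using elim by (simp add: measure_return)
  qed
  then show ?case by (simp add: tendsto_eventually)
next
  case (Suc j)
  have \<mu>: "0 < b + c * r" using Suc.prems b_pos r_pos by (intro add_pos_nonneg) auto
  have "((\<lambda>x. (\<integral>z. round_tail c (snd z) (x - fst z) \<partial>chain j) / Gbar x) \<longlongrightarrow>
      tail_const j (b + c * r) + ((\<integral>z. real (snd z) \<partial>chain j) + 1) * (1 + c * lam) powr \<tau>) at_top"
  proof (rule random_sum_tail[where \<mu> = "b + c * r" and C = "tail_const j" and h = "round_tail c"])
    show "prob_space (chain j)" by (rule prob_space_chain)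
    show "fst \<in> borel_measurable (chain j)" "snd \<in> measurable (chain j) (count_space UNIV)" by measurable
    show "integrable (chain j) (\<lambda>z. real (snd z))" by (rule integrable_chain)
    show "0 \<le> round_tail c n t" "round_tail c n t \<le> 1" for n t
      by (rule round_tail_nonneg round_tail_le_1)+
    show "round_tail c n t \<le> round_tail c n s" if "s \<le> t" for n s t
      using that by (rule round_tail_antimono)
    show "round_tail c n t = 1" if "t < 0" for n t using Suc.prems that by (rule round_tail_neg)
    show "((\<lambda>x. round_tail c n (x - y) / Gbar x) \<longlongrightarrow> (real n + 1) * (1 + c * lam) powr \<tau>) at_top" for n y
      by (rule round_tail_limit[OF Suc.prems])
    show "\<exists>B. \<forall>n. \<forall>x\<ge>0. round_tail c n (m * real n + x) \<le> B * (real n + 1) * Gbar x"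
      if "b + c * r < m" for m
      using round_tail_upper[OF Suc.prems that] by metis
    show "(\<lambda>n. round_tail c n (m * real n)) \<longlonglongrightarrow> 1" if "m < b + c * r" for m
      using round_tail_lower[OF Suc.prems that] .
    show "0 < b + c * r" by (rule \<mu>)
    show "isCont (tail_const j) (b + c * r)" using \<mu> by (intro isCont_tail_const) auto
    show "((\<lambda>x. measure (chain j) {z \<in> space (chain j). x < fst z + c' * real (snd z)} / Gbar x)
        \<longlongrightarrow> tail_const j c') at_top" if "0 \<le> c'" for c'
      using Suc.IH[OF that] by simp
  qed
  then show ?case by (simp add: chain_tail_Suc expectation_chain)
qed

text \<open>
  For a slope \<open>c\<close> with \<open>b + c r < c\<close> the functional \<open>W + c X\<close> does not grow on average where \<open>X\<close> is
  large. A step can therefore raise it from below \<open>(1 - \<delta>) x\<close> to above \<open>x\<close> only by a big jump, whose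
  probability is at most a constant times the tail, uniformly in \<open>j\<close>. The loss of \<open>\<delta>\<close> in
  the level costs a factor below \<open>\<theta>\<close> in each round.
\<close>

lemma chain_tail_bound:
  assumes \<theta>: "1 < \<theta>"
  obtains B where "0 < B" "\<And>j x. 0 \<le> x \<Longrightarrow> measure (chain j) {z. x < fst z} \<le> B * \<theta> ^ j * Gbar x"
proof -
  (* Any slope above b / (1 - r) would do. *)
  define c where "c = (b + 1) / (1 - r)"
  have "c * (1 - r) = b + 1" using stable by (simp add: c_def)
  then have "b + c * r < c" unfolding right_diff_distrib by linarith
  moreover have "0 < c" using stable b_pos by (simp add: c_def)
  ultimately have c: "0 < c" "b + c * r < c" by blast+
  obtain \<delta> where \<delta>: "0 < \<delta>" "\<delta> < 1" "(1 - \<delta>) powr - \<tau> < \<theta>"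
  proof -
    have "\<forall>\<^sub>F \<delta> in at_right 0. (1 - \<delta>) powr - \<tau> < \<theta> \<and> 0 < \<delta> \<and> \<delta> < (1::real)"
      using order_tendstoD(2)[OF powr_scale_tendsto_1(1) \<theta>]
        eventually_at_right_0I[of 1 "\<lambda>\<delta>. 0 < \<delta> \<and> \<delta> < (1::real)"]
      by (auto elim: eventually_elim2)
    then show thesis
      using that eventually_happens'[OF trivial_limit_at_right_real] by blast
  qed
  obtain B0 where B0: "0 < B0" "\<And>n x. 0 \<le> x \<Longrightarrow> round_tail c n (c * real n + x) \<le> B0 * (real n + 1) * Gbar x"
    using round_tail_upper[OF less_imp_le[OF c(1)] c(2)] by blast
  obtain B1 where B1: "0 < B1" "\<And>x. 0 \<le> x \<Longrightarrow> Gbar (\<delta> * x) \<le> B1 * Gbar x"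
    using scale_bounded[OF \<delta>(1)] by blast
  obtain x1 where x1: "\<And>x. x1 \<le> x \<Longrightarrow> Gbar ((1 - \<delta>) * x) \<le> \<theta> * Gbar x"
    using eventually_scale_le[of "1 - \<delta>" \<theta>] \<delta> by (auto simp: eventually_at_top_linorder)
  define B2 where "B2 = max (B0 * B1 * (lam * b / (1 - r) + 1)) (1 / Gbar x1)"
  have "0 < B2" using tail_pos[of x1] by (simp add: B2_def less_max_iff_disj)
  define B where "B = B2 / (\<theta> - 1)"
  have B: "0 < B" "B * (\<theta> - 1) = B2" using \<theta> \<open>0 < B2\<close> by (auto simp: B_def)
  let ?Q = "\<lambda>j x. measure (chain j) {z. x < fst z + c * real (snd z)}"
  have step: "?Q (Suc j) x \<le> ?Q j ((1 - \<delta>) * x) + B0 * B1 * (lam * b / (1 - r) + 1) * Gbar x" if x: "0 \<le> x" for j x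
  proof -
    interpret C: prob_space "chain j" by (rule prob_space_chain)
    let ?A = "{z :: real \<times> nat. (1 - \<delta>) * x < fst z + c * real (snd z)}"
    have A: "?A \<in> sets (chain j)" unfolding sets_chain by (intro sets_S2I) measurable
    have "?Q (Suc j) x = (\<integral>z. round_tail c (snd z) (x - fst z) \<partial>chain j)"
      by (rule chain_tail_Suc)
    also have "\<dots> \<le> (\<integral>z. indicat_real ?A z + B0 * B1 * Gbar x * (real (snd z) + 1) \<partial>chain j)"
    proof (rule integral_mono)
      show "integrable (chain j) (\<lambda>z. round_tail c (snd z) (x - fst z))"
        by (intro C.integrable_const_bound[of _ 1]) (auto simp: round_tail_le_1 round_tail_nonneg)
      show "integrable (chain j) (\<lambda>z. indicat_real ?A z + B0 * B1 * Gbar x * (real (snd z) + 1))"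
        using A integrable_chain by (auto simp: C.emeasure_eq_measure)
      fix z :: "real \<times> nat"
      have nn: "0 \<le> B0 * B1 * Gbar x * (real (snd z) + 1)"
        using B0(1) B1(1) tail_pos[of x] by (intro mult_nonneg_nonneg) auto
      show "round_tail c (snd z) (x - fst z) \<le> indicat_real ?A z + B0 * B1 * Gbar x * (real (snd z) + 1)"
      proof (cases "z \<in> ?A")
        case True
        then show ?thesis using round_tail_le_1[of c "snd z" "x - fst z"] nn by simp
      next
        case False
        then have "c * real (snd z) + \<delta> * x \<le> x - fst z" by (simp add: algebra_simps)
        then have "round_tail c (snd z) (x - fst z) \<le> round_tail c (snd z) (c * real (snd z) + \<delta> * x)"
          by (rule round_tail_antimono)
        also have "\<dots> \<le> B0 * (real (snd z) + 1) * Gbar (\<delta> * x)" using \<delta> x by (intro B0) auto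
        also have "\<dots> \<le> B0 * (real (snd z) + 1) * (B1 * Gbar x)"
          using B0(1) x by (intro mult_left_mono B1) auto
        also have "\<dots> = B0 * B1 * Gbar x * (real (snd z) + 1)" by simp
        finally show ?thesis by (simp add: indicator_def)
      qed
    qed
    also have "\<dots> = ?Q j ((1 - \<delta>) * x) + B0 * B1 * Gbar x * (mean_others j + 1)"
      using A integrable_chain[of j] C.prob_space
      by (subst Bochner_Integration.integral_add) (auto simp: C.emeasure_eq_measure expectation_chain)
    also have "B0 * B1 * Gbar x * (mean_others j + 1) \<le> B0 * B1 * Gbar x * (lam * b / (1 - r) + 1)"
      using B0(1) B1(1) tail_pos[of x] mean_others_le[of j] by (intro mult_left_mono) auto
    finally show ?thesis by (simp add: mult_ac)
  qed
  (* Subtracting 1 makes room for the inhomogeneous term: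
     B (\<theta> ^ (j + 1) - 1) = \<theta> B (\<theta> ^ j - 1) + B (\<theta> - 1). *)
  have main: "?Q j x \<le> B * (\<theta> ^ j - 1) * Gbar x" if "0 \<le> x" for j x
    using that
  proof (induction j arbitrary: x)
    case 0
    have "{z :: real \<times> nat. x < fst z + c * real (snd z)} \<in> sets S2" by (intro sets_S2I) measurable
    then show ?case using 0 by (simp add: measure_return)
  next
    case (Suc j)
    have Gx: "0 < Gbar x" by (rule tail_pos)
    have "B * (\<theta> ^ Suc j - 1) = B * (\<theta> ^ j - 1) * \<theta> + B * (\<theta> - 1)" by (simp add: algebra_simps)
    then have rec: "B * (\<theta> ^ Suc j - 1) = B * (\<theta> ^ j - 1) * \<theta> + B2" by (simp add: B)
    have nn: "0 \<le> B * (\<theta> ^ j - 1)" using B \<theta> by (intro mult_nonneg_nonneg) (auto simp: one_le_power)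
    show ?case
    proof (cases "x1 \<le> x")
      case True
      have "?Q (Suc j) x \<le> ?Q j ((1 - \<delta>) * x) + B0 * B1 * (lam * b / (1 - r) + 1) * Gbar x"
        by (rule step[OF Suc.prems])
      also have "?Q j ((1 - \<delta>) * x) \<le> B * (\<theta> ^ j - 1) * Gbar ((1 - \<delta>) * x)"
        using Suc.prems \<delta> by (intro Suc.IH) auto
      also have "\<dots> \<le> B * (\<theta> ^ j - 1) * (\<theta> * Gbar x)"
        by (intro mult_left_mono x1 True nn)
      also have "B0 * B1 * (lam * b / (1 - r) + 1) * Gbar x \<le> B2 * Gbar x"
        using Gx by (intro mult_right_mono) (auto simp: B2_def)
      finally show ?thesis unfolding rec by (simp add: algebra_simps)
    next
      case False
      have "?Q (Suc j) x \<le> 1"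
        by (intro prob_space.prob_le_1 prob_space_chain)
      also have "1 \<le> 1 / Gbar x1 * Gbar x"
        using tail_antimono[of x x1] False tail_pos[of x1] by (simp add: field_simps)
      also have "\<dots> \<le> B2 * Gbar x" using Gx by (intro mult_right_mono) (auto simp: B2_def)
      also have "\<dots> \<le> B * (\<theta> ^ Suc j - 1) * Gbar x"
        unfolding rec using nn \<theta> Gx by (intro mult_right_mono) auto
      finally show ?thesis .
    qed
  qed
  show thesis
  proof
    show "0 < B" by fact
    fix j and x :: real assume x: "0 \<le> x"
    interpret C: prob_space "chain j" by (rule prob_space_chain)
    have "{z :: real \<times> nat. x < fst z + c * real (snd z)} \<in> sets (chain j)"
      unfolding sets_chain by (intro sets_S2I) measurable
    then have "measure (chain j) {z. x < fst z} \<le> ?Q j x"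
      using c by (intro C.finite_measure_mono) (auto intro: less_le_trans)
    also have "\<dots> \<le> B * (\<theta> ^ j - 1) * Gbar x" by (rule main[OF x])
    also have "\<dots> \<le> B * \<theta> ^ j * Gbar x"
      using B(1) tail_pos[of x] by (intro mult_right_mono mult_left_mono) auto
    finally show "measure (chain j) {z. x < fst z} \<le> B * \<theta> ^ j * Gbar x" .
  qed
qed

end

section \<open>Departure of the tagged customer\<close>

text \<open>
  With \<open>m\<close> customers in front and services \<open>\<omega>\<close>, the tagged customer departs at the end of exactly the
  \<open>k\<close>-th round from now, and this takes longer than \<open>y\<close>. The rounds consume different numbers of
  services, hence the shift by \<open>Suc m\<close>.
\<close>

primrec leaves :: "nat \<Rightarrow> nat \<Rightarrow> (nat \<Rightarrow> service) \<Rightarrow> real \<Rightarrow> bool" where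
  "leaves 0 m \<omega> y \<longleftrightarrow> False"
| "leaves (Suc k) m \<omega> y \<longleftrightarrow>
    (if returns (\<omega> m) then leaves k (others_after m \<omega>) (\<lambda>i. \<omega> (i + Suc m)) (y - round_time m \<omega>)
     else k = 0 \<and> y < round_time m \<omega>)"

context feedback_law
begin

lemma measurable_shift [measurable]: "(\<lambda>\<omega> i. \<omega> (i + n)) \<in> measurable P P"
  by (rule measurable_abs_UNIV) (rule measurable_coordinate_D)

lemma measurable_leaves:
  "Measurable.pred (P \<Otimes>\<^sub>M borel) (\<lambda>x. leaves k m (fst x) (snd x))"
proof (induction k arbitrary: m)
  case 0
  show ?case by simp
next
  case (Suc k)
  have [measurable]: "Measurable.pred (P \<Otimes>\<^sub>M borel)
      (\<lambda>x. leaves k i (\<lambda>j. fst x (j + Suc m)) (snd x - round_time m (fst x)))" for i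
  proof -
    have "(\<lambda>x. (\<lambda>j. fst x (j + Suc m), snd x - round_time m (fst x))) \<in> measurable (P \<Otimes>\<^sub>M borel) (P \<Otimes>\<^sub>M borel)"
      by (intro measurable_Pair measurable_compose[OF measurable_fst measurable_shift]) measurable
    from measurable_compose[OF this Suc.IH[of i]] show ?thesis by simp
  qed
  have [measurable]: "Measurable.pred (P \<Otimes>\<^sub>M borel)
      (\<lambda>x. leaves k (others_after m (fst x)) (\<lambda>j. fst x (j + Suc m)) (snd x - round_time m (fst x)))"
    by (rule measurable_compose_countable[where g="\<lambda>x. others_after m (fst x)"
        and f="\<lambda>i x. leaves k i (\<lambda>j. fst x (j + Suc m)) (snd x - round_time m (fst x))"]) measurable
  show ?case unfolding leaves.simps by measurable
qed

definition leave_prob :: "nat \<Rightarrow> nat \<Rightarrow> real \<Rightarrow> ennreal" where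
  "leave_prob k m y = (\<integral>\<^sup>+\<omega>. of_bool (leaves k m \<omega> y) \<partial>P)"

lemma measurable_leaves_fixed [measurable]: "Measurable.pred P (\<lambda>\<omega>. leaves k m \<omega> y)"
proof -
  have "(\<lambda>\<omega>. (\<omega>, y)) \<in> measurable P (P \<Otimes>\<^sub>M borel)" by measurable
  from measurable_compose[OF this measurable_leaves] show ?thesis by simp
qed

lemma leave_prob_eq_emeasure: "leave_prob k m y = emeasure P {\<omega>. leaves k m \<omega> y}"
proof -
  have "leave_prob k m y = (\<integral>\<^sup>+\<omega>. indicator {\<omega>. leaves k m \<omega> y} \<omega> \<partial>P)"
    unfolding leave_prob_def by (intro nn_integral_cong) (auto simp: indicator_def)
  also have "\<dots> = emeasure P {\<omega>. leaves k m \<omega> y}"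
    by (intro nn_integral_indicator sets_PI) measurable
  finally show ?thesis .
qed

lemma measurable_leave_prob [measurable]:
  "(\<lambda>z. leave_prob k (snd z) (x - fst z)) \<in> borel_measurable S2"
proof -
  have "leave_prob k m \<in> borel_measurable borel" for m
  proof -
    have "(\<lambda>x. (snd x, fst x)) \<in> measurable (borel \<Otimes>\<^sub>M P) (P \<Otimes>\<^sub>M borel)" by measurable
    from measurable_compose[OF this measurable_leaves[of k m]]
    have "Measurable.pred (borel \<Otimes>\<^sub>M P) (\<lambda>x. leaves k m (snd x) (fst x))" by simp
    then have [measurable]: "Measurable.pred (borel \<Otimes>\<^sub>M P) (\<lambda>(y, \<omega>). leaves k m \<omega> y)" by (simp add: case_prod_beta)
    show ?thesis unfolding leave_prob_def[abs_def]
      by (rule seq.P.borel_measurable_nn_integral) (simp add: case_prod_beta', measurable)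
  qed
  note [measurable] = this
  show ?thesis
    by (rule measurable_compose_countable[where g=snd and f="\<lambda>m z. leave_prob k m (x - fst z)"]) measurable
qed

text \<open>
  The services from number \<open>n\<close> on are independent of those before and have the same joint law.
\<close>

lemma nn_integral_split:
  assumes [measurable]: "f \<in> borel_measurable P"
  shows "(\<integral>\<^sup>+\<omega>. f \<omega> \<partial>P) = (\<integral>\<^sup>+\<omega>. \<integral>\<^sup>+\<omega>'. f (comb_seq n \<omega> \<omega>') \<partial>P \<partial>P)"
proof -
  have cs: "(\<lambda>(\<omega>, \<omega>'). comb_seq n \<omega> \<omega>') \<in> measurable (P \<Otimes>\<^sub>M P) P"
    by (rule measurable_comb_seq)
  have "(\<integral>\<^sup>+\<omega>. f \<omega> \<partial>P) = (\<integral>\<^sup>+\<omega>. f \<omega> \<partial>distr (P \<Otimes>\<^sub>M P) P (\<lambda>(\<omega>, \<omega>'). comb_seq n \<omega> \<omega>'))"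
    by (simp only: seq.PiM_comb_seq)
  also have "\<dots> = (\<integral>\<^sup>+x. f (case x of (\<omega>, \<omega>') \<Rightarrow> comb_seq n \<omega> \<omega>') \<partial>(P \<Otimes>\<^sub>M P))"
    by (rule nn_integral_distr[OF cs]) simp
  also have "\<dots> = (\<integral>\<^sup>+\<omega>. \<integral>\<^sup>+\<omega>'. f (comb_seq n \<omega> \<omega>') \<partial>P \<partial>P)"
    using seq.P.nn_integral_fst[OF measurable_compose[OF cs assms], symmetric] by simp
  finally show ?thesis .
qed

lemma returns_independent_coordinate:
  assumes [measurable]: "\<zeta> \<in> borel_measurable (borel \<Otimes>\<^sub>M count_space UNIV)"
  shows "(\<integral>\<^sup>+d. of_bool (returns d = v) * \<zeta> (fst d) \<partial>D) = ennreal (if v then p else 1 - p) * (\<integral>\<^sup>+d. \<zeta> (fst d) \<partial>D)"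
proof -
  have "(\<integral>\<^sup>+d. of_bool (returns d = v) * \<zeta> (fst d) \<partial>D) =
      (\<integral>\<^sup>+x. of_bool (True = v) * \<zeta> x * p + of_bool (False = v) * \<zeta> x * (1 - p) \<partial>J)"
    by (subst nn_integral_service_law) (simp_all add: returns_def)
  also have "\<dots> = (\<integral>\<^sup>+x. ennreal (if v then p else 1 - p) * \<zeta> x \<partial>J)"
    by (intro nn_integral_cong) (auto simp: mult.commute)
  also have "\<dots> = ennreal (if v then p else 1 - p) * (\<integral>\<^sup>+x. \<zeta> x \<partial>J)"
    by (rule nn_integral_cmult) (simp cong: measurable_cong_sets)
  finally show ?thesis by (simp add: nn_integral_service_law_fst)
qed

text \<open>
  The return decision of the tagged customer influences neither the duration of the round nor the
  number of customers who are in front in the next one. Splitting the sequence of services at \<open>m\<close>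
  isolates service \<open>m\<close>, whose decision is independent of its length and arrivals.
\<close>

lemma returns_independent:
  assumes [measurable]: "\<psi> \<in> borel_measurable S2"
  shows "(\<integral>\<^sup>+\<omega>. of_bool (returns (\<omega> m) = v) * \<psi> (round_time m \<omega>, others_after m \<omega>) \<partial>P) =
    ennreal (if v then p else 1 - p) * (\<integral>\<^sup>+\<omega>. \<psi> (round_time m \<omega>, others_after m \<omega>) \<partial>P)"
proof -
  define \<zeta> where "\<zeta> \<omega> x = \<psi> ((\<Sum>i<m. service_time (\<omega> i)) + max 0 (fst x),
      (\<Sum>i<m. arrivals (\<omega> i) + of_bool (returns (\<omega> i))) + snd x)" for \<omega> and x :: "real \<times> nat"
  have [measurable]: "\<zeta> \<omega> \<in> borel_measurable (borel \<Otimes>\<^sub>M count_space UNIV)" for \<omega>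
    unfolding \<zeta>_def by measurable
  have eq: "\<psi> (round_time m (comb_seq m \<omega> \<omega>'), others_after m (comb_seq m \<omega> \<omega>')) = \<zeta> \<omega> (fst (\<omega>' 0))" for \<omega> \<omega>'
    by (simp add: \<zeta>_def round_time_def others_after_def comb_seq_def service_time_def arrivals_def)
  have ret: "returns (comb_seq m \<omega> \<omega>' m) = returns (\<omega>' 0)" for \<omega> \<omega>'
    by (simp add: comb_seq_def)
  have "(\<integral>\<^sup>+\<omega>. of_bool (returns (\<omega> m) = v) * \<psi> (round_time m \<omega>, others_after m \<omega>) \<partial>P) =
      (\<integral>\<^sup>+\<omega>. \<integral>\<^sup>+\<omega>'. of_bool (returns (\<omega>' 0) = v) * \<zeta> \<omega> (fst (\<omega>' 0)) \<partial>P \<partial>P)"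
    by (subst nn_integral_split[where n=m]) (simp_all add: eq ret)
  also have "\<dots> = (\<integral>\<^sup>+\<omega>. ennreal (if v then p else 1 - p) * (\<integral>\<^sup>+\<omega>'. \<zeta> \<omega> (fst (\<omega>' 0)) \<partial>P) \<partial>P)"
  proof (intro nn_integral_cong)
    fix \<omega>
    have m: "(\<lambda>d. \<zeta> \<omega> (fst d)) \<in> borel_measurable D" "(\<lambda>d. of_bool (returns d = v) * \<zeta> \<omega> (fst d)) \<in> borel_measurable D"
      by measurable
    show "(\<integral>\<^sup>+\<omega>'. of_bool (returns (\<omega>' 0) = v) * \<zeta> \<omega> (fst (\<omega>' 0)) \<partial>P) =
        ennreal (if v then p else 1 - p) * (\<integral>\<^sup>+\<omega>'. \<zeta> \<omega> (fst (\<omega>' 0)) \<partial>P)"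
      unfolding nn_integral_coordinate[OF m(1)] nn_integral_coordinate[OF m(2)]
      by (rule returns_independent_coordinate) measurable
  qed
  also have "\<dots> = ennreal (if v then p else 1 - p) * (\<integral>\<^sup>+\<omega>. \<integral>\<^sup>+\<omega>'. \<zeta> \<omega> (fst (\<omega>' 0)) \<partial>P \<partial>P)"
    unfolding \<zeta>_def by (rule nn_integral_cmult) measurable
  also have "(\<integral>\<^sup>+\<omega>. \<integral>\<^sup>+\<omega>'. \<zeta> \<omega> (fst (\<omega>' 0)) \<partial>P \<partial>P) = (\<integral>\<^sup>+\<omega>. \<psi> (round_time m \<omega>, others_after m \<omega>) \<partial>P)"
    by (subst (2) nn_integral_split[where n=m]) (simp_all add: eq)
  finally show ?thesis .
qed

lemma leave_prob_last: "leave_prob (Suc 0) m y = ennreal (1 - p) * (\<integral>\<^sup>+\<omega>. of_bool (y < round_time m \<omega>) \<partial>P)"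
proof -
  have "leave_prob (Suc 0) m y = (\<integral>\<^sup>+\<omega>. of_bool (returns (\<omega> m) = False) * of_bool (y < fst (round_time m \<omega>, others_after m \<omega>)) \<partial>P)"
    unfolding leave_prob_def by (intro nn_integral_cong) simp
  also have "\<dots> = ennreal (1 - p) * (\<integral>\<^sup>+\<omega>. of_bool (y < fst (round_time m \<omega>, others_after m \<omega>)) \<partial>P)"
    using returns_independent[where \<psi>="\<lambda>z. of_bool (y < fst z)" and v=False] by simp
  finally show ?thesis by simp
qed

text \<open>
  The Markov property at the end of a round, which uses \<open>Suc m\<close> services.
\<close>

lemma leave_prob_Suc:
  "leave_prob (Suc (Suc k)) m y =
    ennreal p * (\<integral>\<^sup>+\<omega>. leave_prob (Suc k) (others_after m \<omega>) (y - round_time m \<omega>) \<partial>P)"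
proof -
  have *: "round_time m (comb_seq (Suc m) \<omega> \<omega>') = round_time m \<omega>"
    "others_after m (comb_seq (Suc m) \<omega> \<omega>') = others_after m \<omega>"
    "comb_seq (Suc m) \<omega> \<omega>' m = \<omega> m"
    "(\<lambda>i. comb_seq (Suc m) \<omega> \<omega>' (i + Suc m)) = \<omega>'" for \<omega> \<omega>' :: "nat \<Rightarrow> service"
    by (auto simp: round_time_def others_after_def comb_seq_def)
  have "leave_prob (Suc (Suc k)) m y =
      (\<integral>\<^sup>+\<omega>. \<integral>\<^sup>+\<omega>'. of_bool (leaves (Suc (Suc k)) m (comb_seq (Suc m) \<omega> \<omega>') y) \<partial>P \<partial>P)"
    unfolding leave_prob_def by (rule nn_integral_split) measurable
  also have "\<dots> = (\<integral>\<^sup>+\<omega>. of_bool (returns (\<omega> m) = True) * leave_prob (Suc k) (others_after m \<omega>) (y - round_time m \<omega>) \<partial>P)"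
  proof (intro nn_integral_cong)
    fix \<omega> :: "nat \<Rightarrow> service"
    have "leaves (Suc (Suc k)) m (comb_seq (Suc m) \<omega> \<omega>') y \<longleftrightarrow>
        returns (\<omega> m) \<and> leaves (Suc k) (others_after m \<omega>) \<omega>' (y - round_time m \<omega>)" for \<omega>'
      by (subst leaves.simps) (simp only: * if_cancel, simp)
    then show "(\<integral>\<^sup>+\<omega>'. of_bool (leaves (Suc (Suc k)) m (comb_seq (Suc m) \<omega> \<omega>') y) \<partial>P) =
        of_bool (returns (\<omega> m) = True) * leave_prob (Suc k) (others_after m \<omega>) (y - round_time m \<omega>)"
      unfolding leave_prob_def by (cases "returns (\<omega> m)") auto
  qed
  also have "\<dots> = ennreal p * (\<integral>\<^sup>+\<omega>. leave_prob (Suc k) (others_after m \<omega>) (y - round_time m \<omega>) \<partial>P)"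
    using returns_independent[where \<psi>="\<lambda>z. leave_prob (Suc k) (snd z) (y - fst z)" and v=True] by simp
  finally show ?thesis .
qed

text \<open>
  After \<open>j\<close> rounds the tagged customer needs another \<open>k + 1\<close>: it returns \<open>k\<close> times and then leaves,
  independently of the evolution of the chain.
\<close>

lemma leave_prob_chain:
  "(\<integral>\<^sup>+z. leave_prob (Suc k) (snd z) (x - fst z) \<partial>chain j) =
    ennreal ((1 - p) * p ^ k) * emeasure (chain (Suc (k + j))) {z. x < fst z}"
proof (induction k arbitrary: j)
  case 0
  have A: "{z :: real \<times> nat. x < fst z} \<in> sets S2" by (intro sets_S2I) measurable
  have [measurable]: "(\<lambda>z. \<integral>\<^sup>+\<omega>. of_bool (x - fst z < round_time (snd z) \<omega>) \<partial>P) \<in> borel_measurable S2"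
  proof -
    have "(\<lambda>z. \<integral>\<^sup>+\<omega>. indicator {z. x < fst z} (step (z, \<omega>)) \<partial>P) \<in> borel_measurable S2"
      using A by (intro seq.P.borel_measurable_nn_integral) simp
    then show ?thesis by (simp add: step_def indicator_def of_bool_def algebra_simps)
  qed
  have "emeasure (chain (Suc j)) {z. x < fst z} = (\<integral>\<^sup>+z. indicator {z. x < fst z} z \<partial>chain (Suc j))"
    using A by (intro nn_integral_indicator[symmetric]) (simp add: sets_chain)
  also have "\<dots> = (\<integral>\<^sup>+z. \<integral>\<^sup>+\<omega>. indicator {z. x < fst z} (step (z, \<omega>)) \<partial>P \<partial>chain j)"
    using A by (intro nn_integral_chain_Suc) simp
  also have "\<dots> = (\<integral>\<^sup>+z. \<integral>\<^sup>+\<omega>. of_bool (x - fst z < round_time (snd z) \<omega>) \<partial>P \<partial>chain j)"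
    by (intro nn_integral_cong) (auto simp: step_def indicator_def)
  finally show ?case
    by (simp add: leave_prob_last nn_integral_cmult)
next
  case (Suc k)
  have "(\<integral>\<^sup>+z. leave_prob (Suc (Suc k)) (snd z) (x - fst z) \<partial>chain j) =
      (\<integral>\<^sup>+z. ennreal p * (\<integral>\<^sup>+\<omega>. leave_prob (Suc k) (snd (step (z, \<omega>))) (x - fst (step (z, \<omega>))) \<partial>P) \<partial>chain j)"
    by (simp add: leave_prob_Suc step_def algebra_simps)
  also have "\<dots> = ennreal p * (\<integral>\<^sup>+z. \<integral>\<^sup>+\<omega>. leave_prob (Suc k) (snd (step (z, \<omega>))) (x - fst (step (z, \<omega>))) \<partial>P \<partial>chain j)"
  proof (rule nn_integral_cmult)
    have "(\<lambda>y. leave_prob (Suc k) (snd (step y)) (x - fst (step y))) \<in> borel_measurable (S2 \<Otimes>\<^sub>M P)"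
      by (rule measurable_compose[OF measurable_step measurable_leave_prob])
    then have "(\<lambda>z. \<integral>\<^sup>+\<omega>. leave_prob (Suc k) (snd (step (z, \<omega>))) (x - fst (step (z, \<omega>))) \<partial>P) \<in> borel_measurable S2"
      by (intro seq.P.borel_measurable_nn_integral) (simp add: case_prod_beta')
    then show "(\<lambda>z. \<integral>\<^sup>+\<omega>. leave_prob (Suc k) (snd (step (z, \<omega>))) (x - fst (step (z, \<omega>))) \<partial>P) \<in> borel_measurable (chain j)"
      by (simp cong: measurable_cong_sets add: sets_chain)
  qed
  also have "\<dots> = ennreal p * (\<integral>\<^sup>+z. leave_prob (Suc k) (snd z) (x - fst z) \<partial>chain (Suc j))"
    by (subst nn_integral_chain_Suc) simp_all
  also have "\<dots> = ennreal p * (ennreal ((1 - p) * p ^ k) * emeasure (chain (Suc (k + Suc j))) {z. x < fst z})"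
    by (subst Suc.IH) simp
  also have "\<dots> = ennreal ((1 - p) * p ^ Suc k) * emeasure (chain (Suc (Suc k + j))) {z. x < fst z}"
  proof -
    have "ennreal p * ennreal ((1 - p) * p ^ k) = ennreal ((1 - p) * p ^ Suc k)"
      using p_pos p_less_1 by (subst ennreal_mult[symmetric]) (auto simp: mult_ac)
    then show ?thesis by (simp add: mult.assoc[symmetric])
  qed
  finally show ?case .
qed

lemma prob_leaves:
  "seq.P.prob {\<omega>. leaves (Suc k) 0 \<omega> x} = (1 - p) * p ^ k * measure (chain (Suc k)) {z. x < fst z}"
proof -
  interpret C: prob_space "chain (Suc k)" by (rule prob_space_chain)
  have "leave_prob (Suc k) 0 x = (\<integral>\<^sup>+z. leave_prob (Suc k) (snd z) (x - fst z) \<partial>chain 0)"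
    by (simp add: nn_integral_return space_pair_measure)
  also have "\<dots> = ennreal ((1 - p) * p ^ k * measure (chain (Suc k)) {z. x < fst z})"
    unfolding leave_prob_chain add_0_right C.emeasure_eq_measure
    using p_pos p_less_1 by (intro ennreal_mult[symmetric]) auto
  finally show ?thesis
    using p_pos p_less_1 by (simp add: leave_prob_eq_emeasure seq.P.emeasure_eq_measure)
qed

lemma limit_const_terms:
  "(1 - (p + r ^ k * lam * b)) / (1 - r) = 1 + mean_others k"
  using stable by (simp add: m0_def field_simps)

text \<open>
  The recursion iterates the affine map \<open>c \<mapsto> b + c r\<close>.
\<close>

lemma tail_const_eq:
  "tail_const j c = (\<Sum>i<j. (mean_others (j - 1 - i) + 1) *
    (1 + (r ^ i * c + (1 - r ^ i) / (1 - r) * b) * lam) powr \<tau>)"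
proof (induction j arbitrary: c)
  case (Suc j)
  have nz: "1 - r \<noteq> 0" using stable by simp
  have *: "R ^ i * (b + c * R) + (1 - R ^ i) / (1 - R) * b = R ^ Suc i * c + (1 - R ^ Suc i) / (1 - R) * b"
    if "1 - R \<noteq> 0" for i and R :: real
    using that by (simp add: field_simps)
  show ?case
    unfolding tail_const.simps Suc.IH *[OF nz] sum.lessThan_Suc_shift by simp
qed simp

lemma summable_geometric_bounded:
  assumes "\<And>k. \<bar>w k\<bar> \<le> B"
  shows "summable (\<lambda>k. norm (p ^ k * w k))"
proof (rule summable_comparison_test')
  show "summable (\<lambda>k. B * p ^ k)" using p_pos p_less_1 by (intro summable_mult summable_geometric) auto
  show "norm (norm (p ^ k * w k)) \<le> B * p ^ k" for k
    using assms[of k] p_pos by (simp add: abs_mult mult.commute mult_right_mono)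
qed

text \<open>
  For \<open>c = 0\<close> the factor \<open>1 + c\<^sub>i lam\<close> of the unrolled recursion is \<open>1 + m\<^sub>i\<close>, the same as in the
  tail of a rescaled service time. What remains is a Cauchy product of two absolutely convergent series.
\<close>

lemma tail_const_sum:
  "(\<Sum>k. p ^ k * tail_const (Suc k) 0) =
    (1 + p) / (1 - r * p) * (\<Sum>k. p ^ k * ((1 - (p + r ^ k * lam * b)) / (1 - r)) powr \<tau>)"
proof -
  define w where "w i = ((1 - (p + r ^ i * lam * b)) / (1 - r)) powr \<tau>" for i
  have w: "w i = (1 + mean_others i) powr \<tau>" for i
    unfolding w_def limit_const_terms ..
  have w_bound: "\<bar>w i\<bar> \<le> (1 + lam * b / (1 - r)) powr \<tau>" for i
    using mean_others_le[of i] mean_others_nonneg[of i] index_gt_1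
    by (auto simp: w intro!: powr_mono2)
  have m_bound: "\<bar>mean_others i + 1\<bar> \<le> lam * b / (1 - r) + 1" for i
    using mean_others_le[of i] mean_others_nonneg[of i] by simp
  have *: "tail_const (Suc k) 0 = (\<Sum>i\<le>k. w i * (mean_others (k - i) + 1))" for k
    unfolding tail_const_eq w by (simp add: lessThan_Suc_atMost m0_def mult_ac)
  have "p ^ k * tail_const (Suc k) 0 = (\<Sum>i\<le>k. (p ^ i * w i) * (p ^ (k - i) * (mean_others (k - i) + 1)))" for k
    unfolding * sum_distrib_left by (intro sum.cong refl) (simp add: power_add[symmetric] mult_ac)
  moreover have "(\<lambda>k. \<Sum>i\<le>k. (p ^ i * w i) * (p ^ (k - i) * (mean_others (k - i) + 1))) sums
      ((\<Sum>k. p ^ k * w k) * (\<Sum>k. p ^ k * (mean_others k + 1)))"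
    by (intro Cauchy_product_sums summable_geometric_bounded[OF w_bound] summable_geometric_bounded[OF m_bound])
  ultimately have "(\<Sum>k. p ^ k * tail_const (Suc k) 0) = (\<Sum>k. p ^ k * w k) * (\<Sum>k. p ^ k * (mean_others k + 1))"
    by (simp add: sums_iff)
  also have "(\<lambda>k. p ^ k * (mean_others k + 1)) sums ((1 + p) / (1 - r * p))"
  proof -
    have rp: "\<bar>r * p\<bar> < 1" "\<bar>p\<bar> < 1"
      using p_pos p_less_1 r_pos stable mult_strict_mono[of r 1 p 1] by (auto simp: abs_mult)
    have "(\<lambda>k. (1 + lam * b / (1 - r)) * p ^ k - lam * b / (1 - r) * (r * p) ^ k) sums
        ((1 + lam * b / (1 - r)) * (1 / (1 - p)) - lam * b / (1 - r) * (1 / (1 - r * p)))"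
      using rp by (intro sums_diff sums_mult geometric_sums) auto
    moreover have "(1 + lam * b / (1 - r)) * p ^ k - lam * b / (1 - r) * (r * p) ^ k = p ^ k * (mean_others k + 1)" for k
    proof -
      have "(1 + A) * p ^ k - A * (R * p) ^ k = p ^ k * ((1 - R ^ k) * A + 1)" for A R :: real
        by (simp add: power_mult_distrib algebra_simps)
      from this[of "lam * b / (1 - r)" r] show ?thesis by (simp add: m0_def mult.assoc)
    qed
    moreover have "(1 + lam * b / (1 - r)) * (1 / (1 - p)) - lam * b / (1 - r) * (1 / (1 - r * p)) = (1 + p) / (1 - r * p)"
    proof -
      (* A stands for lam * b, which keeps the identity free of products of parameters. *)
      have id: "(1 + A / (1 - (p + A))) * (1 / (1 - p)) - A / (1 - (p + A)) * (1 / (1 - (p + A) * p)) = (1 + p) / (1 - (p + A) * p)"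
        if "1 - (p + A) \<noteq> 0" "1 - p \<noteq> 0" "1 - (p + A) * p \<noteq> 0" for A :: real
      proof -
        have "(1 + A / (1 - (p + A))) = (1 - p) / (1 - (p + A))" using that by (simp add: field_simps)
        then have "(1 + A / (1 - (p + A))) * (1 / (1 - p)) = 1 / (1 - (p + A))" using that by simp
        moreover have "1 / (1 - (p + A)) - A / (1 - (p + A)) * (1 / (1 - (p + A) * p)) =
            (1 - (p + A) * p - A) / ((1 - (p + A)) * (1 - (p + A) * p))"
          using that by (simp add: divide_simps)
        moreover have "1 - (p + A) * p - A = (1 + p) * (1 - (p + A))" by (simp add: algebra_simps)
        ultimately show ?thesis using that by simp
      qed
      show ?thesis by (rule id) (use stable p_less_1 rp in auto)
    qed
    ultimately show ?thesis by simp
  qed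
  then have "(\<Sum>k. p ^ k * (mean_others k + 1)) = (1 + p) / (1 - r * p)" by (rule sums_unique[symmetric])
  finally show ?thesis by (simp add: w_def mult.commute)
qed

text \<open>
  Tannery's theorem for the sum over the number of rounds: the geometric weights \<open>p\<^sup>k\<close> beat
  the growth \<open>\<theta>\<^sup>k\<close> of the tails of the chain.
\<close>

lemma sojourn_tail:
  "((\<lambda>x. (\<Sum>k. seq.P.prob {\<omega>. leaves (Suc k) 0 \<omega> x}) / Gbar x) \<longlongrightarrow>
    (1 - p) * ((1 + p) / (1 - r * p) * (\<Sum>k. p ^ k * ((1 - (p + r ^ k * lam * b)) / (1 - r)) powr \<tau>))) at_top"
proof -
  (* Midway between 1 and 1 / p, so that p \<theta> < 1. *)
  define \<theta> where "\<theta> = (1 + 1 / p) / 2"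
  have \<theta>: "1 < \<theta>" "p * \<theta> < 1" using p_pos p_less_1 by (auto simp: \<theta>_def field_simps)
  obtain B where B: "0 < B" "\<And>j x. 0 \<le> x \<Longrightarrow> measure (chain j) {z. x < fst z} \<le> B * \<theta> ^ j * Gbar x"
    using chain_tail_bound[OF \<theta>(1)] by blast
  let ?a = "\<lambda>k x. (1 - p) * p ^ k * (measure (chain (Suc k)) {z. x < fst z} / Gbar x)"
  have lim: "(?a k \<longlongrightarrow> (1 - p) * p ^ k * tail_const (Suc k) 0) at_top" for k
    using chain_tail[of 0 "Suc k"] by (intro tendsto_mult tendsto_const) simp
  have bound: "\<forall>\<^sub>F (k, x) in at_top \<times>\<^sub>F at_top. norm (?a k x) \<le> B * \<theta> * (p * \<theta>) ^ k"
  proof -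
    have "\<forall>\<^sub>F kx in at_top \<times>\<^sub>F at_top. (0 :: real) \<le> snd (kx :: nat \<times> real)"
      unfolding eventually_prod_filter
      by (intro exI[of _ "\<lambda>_. True"] exI[of _ "\<lambda>x. 0 \<le> x"]) (simp add: eventually_ge_at_top)
    then show ?thesis
    proof (rule eventually_mono)
      fix kx :: "nat \<times> real" assume "0 \<le> snd kx"
      obtain k x where kx: "kx = (k, x)" by force
      have x: "0 \<le> x" using \<open>0 \<le> snd kx\<close> kx by simp
      have "?a k x \<le> (1 - p) * p ^ k * (B * \<theta> ^ Suc k)"
        using B(2)[OF x, of "Suc k"] tail_pos[of x] p_pos p_less_1
        by (intro mult_left_mono) (auto simp: divide_le_eq)
      also have "\<dots> \<le> 1 * p ^ k * (B * \<theta> ^ Suc k)"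
        using p_pos p_less_1 B(1) \<theta> by (intro mult_right_mono) auto
      finally have "?a k x \<le> B * \<theta> * (p * \<theta>) ^ k" by (simp add: power_mult_distrib mult_ac)
      moreover have "0 \<le> ?a k x" using tail_pos[of x] p_pos p_less_1 by simp
      ultimately have "norm (?a k x) \<le> B * \<theta> * (p * \<theta>) ^ k"
        unfolding real_norm_def by (simp only: abs_of_nonneg)
      then show "case kx of (k, x) \<Rightarrow> norm (?a k x) \<le> B * \<theta> * (p * \<theta>) ^ k"
        by (simp only: kx case_prod_conv)
    qed
  qed
  have "summable (\<lambda>k. B * \<theta> * (p * \<theta>) ^ k)"
    using \<theta> p_pos by (intro summable_mult summable_geometric) (auto simp: abs_mult)
  from tannerys_theorem[OF lim bound this]
  have "((\<lambda>x. \<Sum>k. ?a k x) \<longlongrightarrow> (\<Sum>k. (1 - p) * p ^ k * tail_const (Suc k) 0)) at_top"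
    and ev: "\<forall>\<^sub>F x in at_top. summable (\<lambda>k. norm (?a k x))"
    and s: "summable (\<lambda>k. norm ((1 - p) * p ^ k * tail_const (Suc k) 0))" by auto
  moreover have "\<forall>\<^sub>F x in at_top. (\<Sum>k. ?a k x) = (\<Sum>k. seq.P.prob {\<omega>. leaves (Suc k) 0 \<omega> x}) / Gbar x"
    using ev
  proof eventually_elim
    case (elim x)
    have "summable (\<lambda>k. Gbar x * ?a k x)" by (intro summable_mult summable_norm_cancel[OF elim])
    then have "summable (\<lambda>k. seq.P.prob {\<omega>. leaves (Suc k) 0 \<omega> x})"
      using tail_pos[of x] by (simp add: prob_leaves del: leaves.simps)
    then have "(\<Sum>k. seq.P.prob {\<omega>. leaves (Suc k) 0 \<omega> x}) / Gbar x = (\<Sum>k. seq.P.prob {\<omega>. leaves (Suc k) 0 \<omega> x} / Gbar x)"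
      by (rule suminf_divide[symmetric])
    then show ?case by (simp add: prob_leaves del: leaves.simps)
  qed
  moreover have "(\<Sum>k. (1 - p) * p ^ k * tail_const (Suc k) 0) = (1 - p) * (\<Sum>k. p ^ k * tail_const (Suc k) 0)"
  proof -
    have "summable (\<lambda>k. (1 - p) * (p ^ k * tail_const (Suc k) 0))"
      using summable_norm_cancel[OF s] by (simp add: mult.assoc)
    then have "summable (\<lambda>k. p ^ k * tail_const (Suc k) 0)"
      using p_less_1 by (subst (asm) summable_cmult_iff) auto
    then show ?thesis by (simp add: suminf_mult mult.assoc del: tail_const.simps)
  qed
  ultimately show ?thesis by (simp add: tail_const_sum tendsto_cong del: tail_const.simps leaves.simps)
qed

end

section \<open>Memorylessness of the Poisson stream\<close>

text \<open>
  The gaps seen by an observer who starts at time \<open>d\<close>, provided that \<open>n\<close> customers other than customer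
  0 have arrived by then: the rest of the current gap, followed by the later gaps.
\<close>

definition residual :: "nat \<Rightarrow> real \<Rightarrow> (nat \<Rightarrow> real) \<Rightarrow> nat \<Rightarrow> real" where
  "residual n d t = case_nat (arrival_time t (Suc n) - d) (\<lambda>i. t (i + Suc n))"

text \<open>
  Arrivals at different times that do not accumulate. Without this the number of arrivals up to some
  time could be infinite, in which case its cardinality is \<open>0\<close> by convention.
\<close>

definition regular :: "(nat \<Rightarrow> real) \<Rightarrow> bool" where
  "regular t \<longleftrightarrow> (\<forall>i. 0 < t i) \<and> (\<forall>u. \<exists>n. u < arrival_time t n)"

text \<open>
  The arrivals in \<open>(0, d]\<close>, without customer 0, who arrives at time \<open>0\<close>.
\<close>

definition counted :: "real \<Rightarrow> (nat \<Rightarrow> real) \<Rightarrow> nat" where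
  "counted d t = arrived t d - 1"

lemma arrival_time_0 [simp]: "arrival_time t 0 = 0"
  by (simp add: arrival_time_def)

lemma arrival_time_case_nat: "arrival_time (case_nat s t) (Suc n) = s + arrival_time t n"
  by (simp add: arrival_time_def sum.lessThan_Suc_shift del: sum.lessThan_Suc)

lemma residual_0: "residual 0 d (case_nat s t) = case_nat (s - d) t"
  by (simp add: residual_def arrival_time_def)

lemma residual_Suc: "residual (Suc n) d (case_nat s t) = residual n (d - s) t"
  by (simp add: residual_def arrival_time_case_nat algebra_simps)

lemma regular_arrival_mono:
  assumes "regular t" "m \<le> n"
  shows "arrival_time t m \<le> arrival_time t n"
  using assms unfolding arrival_time_def regular_def
  by (intro sum_mono2) (auto simp: less_imp_le)

lemma regular_bracket:
  assumes "regular t" "0 \<le> u"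
  obtains n where "arrival_time t n \<le> u" "u < arrival_time t (Suc n)"
proof -
  define m where "m = (LEAST n. u < arrival_time t n)"
  have ex: "\<exists>n. u < arrival_time t n" using assms by (auto simp: regular_def)
  have m: "u < arrival_time t m" unfolding m_def by (rule LeastI_ex[OF ex])
  then obtain n where n: "m = Suc n" using assms(2) by (cases m) auto
  have "\<not> u < arrival_time t n" unfolding m_def using not_less_Least[of n "\<lambda>n. u < arrival_time t n"] n m_def by auto
  with m n show thesis by (intro that[of n]) auto
qed

lemma arrived_eq:
  assumes "regular t" "arrival_time t n \<le> u" "u < arrival_time t (Suc n)"
  shows "arrived t u = Suc n"
proof -
  have "{k. arrival_time t k \<le> u} = {..n}"
  proof (intro set_eqI iffI)
    fix k assume "k \<in> {k. arrival_time t k \<le> u}"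
    then have "arrival_time t k < arrival_time t (Suc n)" using assms by simp
    then have "\<not> Suc n \<le> k" using regular_arrival_mono[OF assms(1), of "Suc n" k] by linarith
    then show "k \<in> {..n}" by simp
  next
    fix k assume "k \<in> {..n}"
    then show "k \<in> {k. arrival_time t k \<le> u}" using regular_arrival_mono[OF assms(1), of k n] assms by simp
  qed
  then show ?thesis by (simp add: arrived_def)
qed

lemma arrived_pos:
  assumes "regular t" "0 \<le> u"
  shows "0 < arrived t u"
proof -
  obtain n where "arrival_time t n \<le> u" "u < arrival_time t (Suc n)"
    using regular_bracket[OF assms] by blast
  then show ?thesis using arrived_eq[OF assms(1)] by simp
qed

lemma arrived_0: "regular t \<Longrightarrow> arrived t 0 = 1"
  using arrived_eq[of t 0 0] by (simp add: arrival_time_def regular_def)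

lemma arrival_time_residual: "arrival_time (residual n d t) (Suc k) = arrival_time t (Suc (n + k)) - d"
proof (induction k)
  case 0
  show ?case by (simp add: arrival_time_def residual_def)
next
  case (Suc k)
  have "arrival_time (residual n d t) (Suc (Suc k)) = arrival_time (residual n d t) (Suc k) + residual n d t (Suc k)"
    by (simp add: arrival_time_def)
  then show ?case using Suc by (simp add: residual_def arrival_time_def add.commute)
qed

lemma regular_residual:
  assumes "regular t" "arrival_time t n \<le> d" "d < arrival_time t (Suc n)"
  shows "regular (residual n d t)"
proof -
  have "0 < residual n d t i" for i
    using assms by (cases i) (auto simp: residual_def regular_def)
  moreover have "\<exists>k. u < arrival_time (residual n d t) k" for u
  proof -
    obtain k where k: "u + d < arrival_time t k" using assms(1) by (auto simp: regular_def)
    also have "\<dots> \<le> arrival_time t (Suc (n + k))" by (rule regular_arrival_mono[OF assms(1)]) simp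
    finally have "u < arrival_time (residual n d t) (Suc k)" by (simp add: arrival_time_residual)
    then show ?thesis ..
  qed
  ultimately show ?thesis by (simp add: regular_def)
qed

lemma regular_residual_counted:
  assumes "regular t" "0 \<le> d"
  shows "regular (residual (counted d t) d t)"
proof -
  obtain n where n: "arrival_time t n \<le> d" "d < arrival_time t (Suc n)"
    using regular_bracket[OF assms] by blast
  then have "counted d t = n" using arrived_eq[OF assms(1) n] by (simp add: counted_def)
  then show ?thesis using regular_residual[OF assms(1) n] by simp
qed

text \<open>
  In the residual stream time \<open>d\<close> becomes time \<open>0\<close>, at which a fictitious customer 0 is counted; this
  accounts for the \<open>Suc\<close>.
\<close>

lemma arrived_residual:
  assumes "regular t" "0 \<le> d" "0 \<le> u"
  shows "arrived (residual (counted d t) d t) u + arrived t d = Suc (arrived t (d + u))"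
proof -
  obtain n where n: "arrival_time t n \<le> d" "d < arrival_time t (Suc n)"
    using regular_bracket[OF assms(1,2)] by blast
  obtain m where m: "arrival_time t m \<le> d + u" "d + u < arrival_time t (Suc m)"
    using regular_bracket[OF assms(1), of "d + u"] assms by auto
  have "\<not> Suc m \<le> n" using regular_arrival_mono[OF assms(1), of "Suc m" n] n m assms by linarith
  then have nm: "n \<le> m" by simp
  have c: "counted d t = n" using arrived_eq[OF assms(1) n] by (simp add: counted_def)
  have "arrived (residual n d t) u = Suc (m - n)"
  proof (rule arrived_eq)
    show "regular (residual n d t)" by (rule regular_residual[OF assms(1) n])
    show "arrival_time (residual n d t) (m - n) \<le> u"
    proof (cases "m - n")
      case (Suc k)
      then have "Suc (n + k) = m" by simp
      then show ?thesis using m by (simp add: Suc arrival_time_residual)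
    qed (use assms in simp)
    show "u < arrival_time (residual n d t) (Suc (m - n))"
      using m nm by (simp add: arrival_time_residual)
  qed
  then show ?thesis
    using arrived_eq[OF assms(1) n] arrived_eq[OF assms(1) m] nm by (simp add: c)
qed

lemma measurable_arrived [measurable]:
  assumes "\<And>i. (\<lambda>x. t x i) \<in> borel_measurable N" "u \<in> borel_measurable N"
  shows "(\<lambda>x. arrived (t x) (u x)) \<in> measurable N (count_space UNIV)"
  unfolding arrived_def arrival_time_def
  by (rule measurable_card) (use assms in measurable)

locale poisson_arrivals =
  fixes lam :: real
  assumes rate_pos: "0 < lam"
begin

definition gap_law :: "real measure" where
  "gap_law = density lborel (\<lambda>x. ennreal (exponential_density lam x))"

lemma sets_gap_law [measurable_cong, simp]: "sets gap_law = sets borel"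
  by (simp add: gap_law_def)

lemma space_gap_law [simp]: "space gap_law = UNIV"
  by (simp add: gap_law_def)

sublocale gap: prob_space gap_law
  unfolding gap_law_def by (rule prob_space_exponential_density[OF rate_pos])

sublocale gaps: sequence_space gap_law ..

abbreviation "A \<equiv> gaps.S"

lemma space_A [simp]: "space A = UNIV"
  by (simp add: space_PiM)

lemma nn_integral_gap_law:
  "f \<in> borel_measurable borel \<Longrightarrow>
    (\<integral>\<^sup>+s. f s \<partial>gap_law) = (\<integral>\<^sup>+s. ennreal (exponential_density lam s) * f s \<partial>lborel)"
  unfolding gap_law_def by (subst nn_integral_density) auto

lemma measurable_case_nat_A:
  assumes "f \<in> borel_measurable N" "g \<in> measurable N A"
  shows "(\<lambda>x. case_nat (f x) (g x)) \<in> measurable N A"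
proof (rule measurable_case_nat')
  show "f \<in> measurable N gap_law" using assms(1) by (simp cong: measurable_cong_sets)
qed (rule assms(2))

lemma measurable_arrival_time [measurable]: "(\<lambda>t. arrival_time t n) \<in> borel_measurable A"
  unfolding arrival_time_def by measurable

lemma measurable_residual [measurable]:
  "(\<lambda>x. residual n (fst x) (snd x)) \<in> measurable (borel \<Otimes>\<^sub>M A) A"
proof -
  have sh: "(\<lambda>t i. t (i + Suc n)) \<in> measurable A A"
    by (rule measurable_abs_UNIV) (rule measurable_component_singleton, simp)
  have "(\<lambda>x. case_nat (arrival_time (snd x) (Suc n) - fst x) (\<lambda>i. snd x (i + Suc n))) \<in> measurable (borel \<Otimes>\<^sub>M A) A"
  proof (rule measurable_case_nat_A)
    show "(\<lambda>x. arrival_time (snd x) (Suc n) - fst x) \<in> borel_measurable (borel \<Otimes>\<^sub>M A)"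
      by measurable
    show "(\<lambda>x. (\<lambda>i. snd x (i + Suc n))) \<in> measurable (borel \<Otimes>\<^sub>M A) A"
      by (rule measurable_compose[OF measurable_snd sh])
  qed
  then show ?thesis by (simp add: residual_def)
qed

lemma measurable_residual_fixed [measurable]: "residual n d \<in> measurable A A"
proof -
  have "(\<lambda>t. (d, t)) \<in> measurable A (borel \<Otimes>\<^sub>M A)" by measurable
  from measurable_compose[OF this measurable_residual] show ?thesis by simp
qed

lemma nn_integral_first_gap:
  assumes [measurable]: "f \<in> borel_measurable A"
  shows "(\<integral>\<^sup>+t. f t \<partial>A) = (\<integral>\<^sup>+s. ennreal (exponential_density lam s) * (\<integral>\<^sup>+t. f (case_nat s t) \<partial>A) \<partial>lborel)"
proof -
  have cn: "(\<lambda>(s, t). case_nat s t) \<in> measurable (gap_law \<Otimes>\<^sub>M A) A"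
    unfolding case_prod_beta' by (intro measurable_case_nat' measurable_fst measurable_snd)
  have "(\<integral>\<^sup>+t. f t \<partial>A) = (\<integral>\<^sup>+t. f t \<partial>distr (gap_law \<Otimes>\<^sub>M A) A (\<lambda>(s, t). case_nat s t))"
    by (simp only: gaps.PiM_iter)
  also have "\<dots> = (\<integral>\<^sup>+x. f (case x of (s, t) \<Rightarrow> case_nat s t) \<partial>(gap_law \<Otimes>\<^sub>M A))"
    by (rule nn_integral_distr[OF cn]) simp
  also have "\<dots> = (\<integral>\<^sup>+s. \<integral>\<^sup>+t. f (case_nat s t) \<partial>A \<partial>gap_law)"
    using gaps.P.nn_integral_fst[OF measurable_compose[OF cn assms], symmetric] by simp
  also have "\<dots> = (\<integral>\<^sup>+s. ennreal (exponential_density lam s) * (\<integral>\<^sup>+t. f (case_nat s t) \<partial>A) \<partial>lborel)"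
    by (rule nn_integral_gap_law) measurable
  finally show ?thesis .
qed

text \<open>
  Conditioning on the first gap: the Poisson weight of \<open>n + 1\<close> arrivals before \<open>d\<close> is the exponential
  density convolved with that of \<open>n\<close> arrivals. The exponential factors combine, and the polynomial one
  has an explicit antiderivative.
\<close>

lemma gap_convolution:
  "(\<integral>\<^sup>+s. ennreal (exponential_density lam s) *
      ennreal (if s \<le> d then poisson_weight (lam * (d - s)) n else 0) \<partial>lborel) =
    ennreal (if 0 \<le> d then poisson_weight (lam * d) (Suc n) else 0)"
proof (cases "0 \<le> d")
  case True
  let ?f = "\<lambda>s. lam * exp (- (lam * d)) * (lam * (d - s)) ^ n / fact n"
  let ?K = "- exp (- (lam * d)) / fact (Suc n)"
  let ?F = "\<lambda>s. ?K * (lam * (d - s)) ^ Suc n"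
  have "(\<integral>\<^sup>+s. ennreal (exponential_density lam s) * ennreal (if s \<le> d then poisson_weight (lam * (d - s)) n else 0) \<partial>lborel)
      = (\<integral>\<^sup>+s. ennreal (?f s) * indicator {0..d} s \<partial>lborel)"
  proof (intro nn_integral_cong)
    fix s :: real
    show "ennreal (exponential_density lam s) * ennreal (if s \<le> d then poisson_weight (lam * (d - s)) n else 0)
        = ennreal (?f s) * indicator {0..d} s"
    proof (cases "0 \<le> s \<and> s \<le> d")
      case True
      have e: "exp (- s * lam) * exp (- (lam * (d - s))) = exp (- (lam * d))"
        by (simp add: exp_add[symmetric] algebra_simps)
      have "exponential_density lam s * poisson_weight (lam * (d - s)) n =
          lam * (exp (- s * lam) * exp (- (lam * (d - s)))) * (lam * (d - s)) ^ n / fact n"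
        using True by (simp add: exponential_density_def poisson_weight_def)
      then have "exponential_density lam s * poisson_weight (lam * (d - s)) n = ?f s" unfolding e .
      moreover have "0 \<le> poisson_weight (lam * (d - s)) n" "0 \<le> exponential_density lam s"
        using True rate_pos by (auto intro: poisson_weight_nonneg exponential_density_nonneg)
      ultimately show ?thesis using True by (simp add: ennreal_mult[symmetric])
    qed (auto simp: exponential_density_def)
  qed
  also have "\<dots> = ennreal (?F d - ?F 0)"
  proof (rule nn_integral_FTC_Icc)
    show "?f \<in> borel_measurable borel" by measurable
    fix s assume "s \<in> {0..d}"
    then have s: "0 \<le> s" "s \<le> d" by auto
    show "(?F has_real_derivative ?f s) (at s)"
    proof -
      have "(?F has_real_derivative ?K * (real (Suc n) * (lam * (d - s)) ^ n * (- lam))) (at s)"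
        by (rule derivative_eq_intros refl | simp del: power_Suc of_nat_Suc fact_Suc)+
      moreover have "?K * (real (Suc n) * (lam * (d - s)) ^ n * (- lam)) = ?f s"
        by (simp add: fact_Suc del: of_nat_Suc)
      ultimately show ?thesis by (simp only:)
    qed
    show "0 \<le> ?f s" using s rate_pos by simp
  qed (use True in auto)
  also have "?F d - ?F 0 = poisson_weight (lam * d) (Suc n)" by (simp add: poisson_weight_def)
  finally show ?thesis using True by simp
next
  case False
  then have "(\<integral>\<^sup>+s. ennreal (exponential_density lam s) *
      ennreal (if s \<le> d then poisson_weight (lam * (d - s)) n else 0) \<partial>lborel) = (\<integral>\<^sup>+(s::real). 0 \<partial>lborel)"
    by (intro nn_integral_cong) (auto simp: exponential_density_def)
  then show ?thesis using False by simp
qed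

text \<open>
  The memorylessness of the stream: on the event of \<open>n\<close> arrivals before \<open>d\<close>, the residual gaps are
  independent with the original law. For \<open>n = 0\<close> this is the memorylessness of the exponential
  distribution; the general case follows by conditioning on the first gap.
\<close>

lemma arrivals_then_residual:
  assumes [measurable]: "f \<in> borel_measurable A"
  shows "(\<integral>\<^sup>+t. of_bool (arrival_time t n \<le> d \<and> d < arrival_time t (Suc n)) * f (residual n d t) \<partial>A) =
    ennreal (if 0 \<le> d then poisson_weight (lam * d) n else 0) * (\<integral>\<^sup>+t. f t \<partial>A)"
proof (induction n arbitrary: d)
  case 0
  show ?case
  proof (cases "0 \<le> d")
    case True
    define \<Phi> where "\<Phi> u = (\<integral>\<^sup>+t. f (case_nat u t) \<partial>A)" for u
    have [measurable]: "\<Phi> \<in> borel_measurable borel" unfolding \<Phi>_def[abs_def] by measurable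
    have "(\<integral>\<^sup>+t. of_bool (arrival_time t 0 \<le> d \<and> d < arrival_time t (Suc 0)) * f (residual 0 d t) \<partial>A) =
        (\<integral>\<^sup>+s. ennreal (exponential_density lam s) * (of_bool (d < s) * \<Phi> (s - d)) \<partial>lborel)"
    proof (subst nn_integral_first_gap, measurable, intro nn_integral_cong)
      fix s
      show "ennreal (exponential_density lam s) *
          (\<integral>\<^sup>+t. of_bool (arrival_time (case_nat s t) 0 \<le> d \<and> d < arrival_time (case_nat s t) (Suc 0)) * f (residual 0 d (case_nat s t)) \<partial>A) =
          ennreal (exponential_density lam s) * (of_bool (d < s) * \<Phi> (s - d))"
        using True by (simp add: arrival_time_case_nat residual_0 \<Phi>_def)
    qed
    also have "\<dots> = (\<integral>\<^sup>+u. ennreal (exponential_density lam (d + u)) * (of_bool (0 < u) * \<Phi> u) \<partial>lborel)"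
      by (subst nn_integral_real_affine[where c=1 and t=d]) auto
    also have "\<dots> = (\<integral>\<^sup>+u. ennreal (exp (- (lam * d))) * (ennreal (exponential_density lam u) * \<Phi> u) \<partial>lborel)"
    proof (intro nn_integral_cong_AE, use AE_lborel_singleton[of 0] in eventually_elim)
      case (elim u)
      show ?case
      proof (cases "0 < u")
        case True
        have "exponential_density lam (d + u) = exp (- (lam * d)) * exponential_density lam u"
          using True \<open>0 \<le> d\<close> by (simp add: exponential_density_def exp_add[symmetric] algebra_simps)
        then show ?thesis using True rate_pos
          by (simp add: ennreal_mult exponential_density_nonneg mult.assoc)
      next
        case False
        then show ?thesis using elim by (simp add: exponential_density_def)
      qed
    qed
    also have "\<dots> = ennreal (exp (- (lam * d))) * (\<integral>\<^sup>+t. f t \<partial>A)"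
      by (subst nn_integral_cmult) (simp_all add: nn_integral_first_gap[OF assms] \<Phi>_def)
    finally show ?thesis using True by (simp add: poisson_weight_def)
  qed simp
next
  case (Suc n)
  have "(\<integral>\<^sup>+t. of_bool (arrival_time t (Suc n) \<le> d \<and> d < arrival_time t (Suc (Suc n))) * f (residual (Suc n) d t) \<partial>A) =
      (\<integral>\<^sup>+s. ennreal (exponential_density lam s) *
        (\<integral>\<^sup>+t. of_bool (arrival_time t n \<le> d - s \<and> d - s < arrival_time t (Suc n)) * f (residual n (d - s) t) \<partial>A) \<partial>lborel)"
  proof (subst nn_integral_first_gap, measurable, intro nn_integral_cong)
    fix s
    have "of_bool (arrival_time (case_nat s t) (Suc n) \<le> d \<and> d < arrival_time (case_nat s t) (Suc (Suc n))) * f (residual (Suc n) d (case_nat s t))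
        = of_bool (arrival_time t n \<le> d - s \<and> d - s < arrival_time t (Suc n)) * f (residual n (d - s) t)" for t
      by (auto simp: arrival_time_case_nat residual_Suc)
    then show "ennreal (exponential_density lam s) *
          (\<integral>\<^sup>+t. of_bool (arrival_time (case_nat s t) (Suc n) \<le> d \<and> d < arrival_time (case_nat s t) (Suc (Suc n))) * f (residual (Suc n) d (case_nat s t)) \<partial>A) =
        ennreal (exponential_density lam s) *
        (\<integral>\<^sup>+t. of_bool (arrival_time t n \<le> d - s \<and> d - s < arrival_time t (Suc n)) * f (residual n (d - s) t) \<partial>A)"
      by simp
  qed
  also have "\<dots> = (\<integral>\<^sup>+s. ennreal (exponential_density lam s) * ennreal (if s \<le> d then poisson_weight (lam * (d - s)) n else 0) * (\<integral>\<^sup>+t. f t \<partial>A) \<partial>lborel)"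
    by (simp add: Suc.IH mult.assoc)
  also have "\<dots> = (\<integral>\<^sup>+s. ennreal (exponential_density lam s) * ennreal (if s \<le> d then poisson_weight (lam * (d - s)) n else 0) \<partial>lborel) * (\<integral>\<^sup>+t. f t \<partial>A)"
    by (rule nn_integral_multc) measurable
  finally show ?case unfolding gap_convolution .
qed

text \<open>
  The events of exactly \<open>n\<close> arrivals by time \<open>d\<close> are disjoint and have the Poisson weights as
  probabilities, which add up to \<open>1\<close>.
\<close>

lemma AE_bracket:
  assumes "0 \<le> d"
  shows "AE t in A. \<exists>n. arrival_time t n \<le> d \<and> d < arrival_time t (Suc n)"
proof -
  let ?E = "\<lambda>n t. arrival_time t n \<le> d \<and> d < arrival_time t (Suc n)"
  have pos: "AE t in A. \<forall>i. 0 \<le> t i"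
  proof -
    have "AE s in gap_law. 0 \<le> s"
      unfolding gap_law_def by (subst AE_density) (auto simp: exponential_density_def)
    then have "AE t in A. 0 \<le> t i" for i by (intro gaps.AE_component) auto
    then show ?thesis by (simp add: AE_all_countable)
  qed
  have "(\<integral>\<^sup>+t. (\<Sum>n. of_bool (?E n t)) \<partial>A) = (\<Sum>n. \<integral>\<^sup>+t. of_bool (?E n t) \<partial>A)"
    by (rule nn_integral_suminf) measurable
  also have "\<dots> = (\<Sum>n. ennreal (poisson_weight (lam * d) n))"
    using arrivals_then_residual[of "\<lambda>_. 1" _ d] assms gaps.P.emeasure_space_1 by simp
  also have "\<dots> = 1" using assms rate_pos by (intro poisson_weight_total) auto
  finally have one: "(\<integral>\<^sup>+t. (\<Sum>n. of_bool (?E n t)) \<partial>A) = 1" .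
  have le: "AE t in A. (\<Sum>n. of_bool (?E n t)) = (of_bool (\<exists>n. ?E n t) :: ennreal)"
    using pos
  proof eventually_elim
    case (elim t)
    have mono: "arrival_time t m \<le> arrival_time t n" if "m \<le> n" for m n
      unfolding arrival_time_def using elim that by (intro sum_mono2) auto
    show ?case
    proof (cases "\<exists>n. ?E n t")
      case True
      then obtain n where n: "?E n t" ..
      have "?E k t \<longleftrightarrow> k = n" for k
      proof
        assume k: "?E k t"
        have "\<not> Suc k \<le> n" "\<not> Suc n \<le> k" using mono[of "Suc k" n] mono[of "Suc n" k] n k by linarith+
        then show "k = n" by simp
      qed (use n in simp)
      then have "(\<Sum>k. of_bool (?E k t)) = (\<Sum>k. if k = n then 1 else 0 :: ennreal)" by (simp add: of_bool_def)
      also have "\<dots> = 1" using sums_single[of n "\<lambda>_. 1 :: ennreal"] by (simp add: sums_iff)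
      finally show ?thesis using True by simp
    next
      case False
      then have "(\<lambda>k. of_bool (?E k t)) = (\<lambda>_. 0 :: ennreal)" by (intro ext) auto
      then show ?thesis using False by (simp only: suminf_zero of_bool_eq)
    qed
  qed
  have "(\<integral>\<^sup>+t. of_bool (\<exists>n. ?E n t) \<partial>A) = 1"
    unfolding one[symmetric] using le by (intro nn_integral_cong_AE) auto
  moreover have "(\<integral>\<^sup>+t. of_bool (\<exists>n. ?E n t) \<partial>A) = emeasure A {t. \<exists>n. ?E n t}"
  proof -
    have "(\<integral>\<^sup>+t. of_bool (\<exists>n. ?E n t) \<partial>A) = (\<integral>\<^sup>+t. indicator {t \<in> space A. \<exists>n. ?E n t} t \<partial>A)"
      by (intro nn_integral_cong) (auto simp: indicator_def)
    also have "\<dots> = emeasure A {t \<in> space A. \<exists>n. ?E n t}"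
      by (intro nn_integral_indicator) measurable
    finally show ?thesis by simp
  qed
  ultimately have "gaps.P.prob {t. \<exists>n. ?E n t} = 1" by (simp add: measure_def)
  from gaps.P.AE_prob_1[OF this] show ?thesis by simp
qed

lemma AE_regular: "AE t in A. regular t"
proof -
  have "AE s in gap_law. 0 < s"
    unfolding gap_law_def using AE_lborel_singleton[of 0]
    by (subst AE_density) (auto simp: exponential_density_def elim!: eventually_mono)
  then have "AE t in A. 0 < t i" for i by (intro gaps.AE_component) auto
  then have "AE t in A. \<forall>i. 0 < t i" by (simp add: AE_all_countable)
  moreover have "AE t in A. \<forall>m::nat. \<exists>n. real m < arrival_time t n"
    unfolding AE_all_countable
  proof
    fix m :: nat
    show "AE t in A. \<exists>n. real m < arrival_time t n"
      by (rule eventually_mono[OF AE_bracket[of "real m"]]) auto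
  qed
  ultimately show ?thesis
  proof eventually_elim
    case (elim t)
    have "\<exists>n. u < arrival_time t n" for u
    proof -
      obtain m :: nat where "u < real m" using reals_Archimedean2 by blast
      moreover obtain n where "real m < arrival_time t n" using elim by blast
      ultimately show ?thesis by (intro exI[of _ n]) simp
    qed
    then show ?case using elim by (simp add: regular_def)
  qed
qed

text \<open>
  The number of arrivals during a service and the arrival stream after it are independent; this is
  what the induction over the successive services needs.
\<close>

lemma count_residual_independent:
  assumes [measurable]: "f \<in> borel_measurable A" and d: "0 \<le> d"
  shows "(\<integral>\<^sup>+t. \<psi> (counted d t) * f (residual (counted d t) d t) \<partial>A) =
    (\<Sum>n. ennreal (poisson_weight (lam * d) n) * \<psi> n) * (\<integral>\<^sup>+t. f t \<partial>A)"
proof -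
  let ?E = "\<lambda>n t. arrival_time t n \<le> d \<and> d < arrival_time t (Suc n)"
  have "(\<integral>\<^sup>+t. \<psi> (counted d t) * f (residual (counted d t) d t) \<partial>A) =
      (\<integral>\<^sup>+t. (\<Sum>n. \<psi> n * (of_bool (?E n t) * f (residual n d t))) \<partial>A)"
  proof (intro nn_integral_cong_AE, use AE_regular in eventually_elim)
    case (elim t)
    obtain n where n: "?E n t" using regular_bracket[OF elim d] by blast
    have c: "counted d t = k" if "?E k t" for k
      using arrived_eq[OF elim, of k d] that by (simp add: counted_def)
    have "\<psi> k * (of_bool (?E k t) * f (residual k d t)) = (if k = n then \<psi> k * f (residual k d t) else 0)" for k
      using c[OF n] c[of k] n by (cases "?E k t") auto
    then have "(\<Sum>k. \<psi> k * (of_bool (?E k t) * f (residual k d t))) = \<psi> n * f (residual n d t)"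
      using sums_single[of n "\<lambda>k. \<psi> k * f (residual k d t)"] by (simp add: sums_iff)
    then show ?case using c[OF n] by simp
  qed
  also have "\<dots> = (\<Sum>n. \<integral>\<^sup>+t. \<psi> n * (of_bool (?E n t) * f (residual n d t)) \<partial>A)"
    by (rule nn_integral_suminf) measurable
  also have "\<dots> = (\<Sum>n. \<psi> n * (ennreal (poisson_weight (lam * d) n) * (\<integral>\<^sup>+t. f t \<partial>A)))"
    using d by (subst nn_integral_cmult) (auto simp: arrivals_then_residual)
  also have "\<dots> = (\<Sum>n. ennreal (poisson_weight (lam * d) n) * \<psi> n * (\<integral>\<^sup>+t. f t \<partial>A))"
    by (simp add: mult_ac)
  finally show ?thesis by simp
qed

end

section \<open>Successive services as independent triples\<close>

text \<open>
  The \<open>i\<close>-th service if the server works without interruption. The recursion restarts the arrival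
  stream at the end of each service, which suits the memoryless property; \<open>services_eq\<close> relates it to
  the number of arrivals between two completion times.
\<close>

primrec services :: "nat \<Rightarrow> (nat \<Rightarrow> real) \<Rightarrow> (nat \<Rightarrow> real \<times> bool) \<Rightarrow> service" where
  "services 0 t sf = ((fst (sf 0), counted (fst (sf 0)) t), snd (sf 0))"
| "services (Suc i) t sf =
    services i (residual (counted (fst (sf 0)) t) (fst (sf 0)) t) (\<lambda>n. sf (Suc n))"

lemma services_eq:
  assumes "regular t" "\<And>i. 0 \<le> fst (sf i)"
  shows "services i t sf = ((fst (sf i),
    arrived t (\<Sum>j<Suc i. fst (sf j)) - arrived t (\<Sum>j<i. fst (sf j))), snd (sf i))"
  using assms
proof (induction i arbitrary: t sf)
  case 0
  then show ?case by (simp add: counted_def arrived_0)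
next
  case (Suc i)
  define d where "d = fst (sf 0)"
  define t' where "t' = residual (counted d t) d t"
  have d: "0 \<le> d" using Suc.prems by (simp add: d_def)
  have reg: "regular t'" unfolding t'_def by (rule regular_residual_counted[OF Suc.prems(1) d])
  have shift: "arrived t' u + arrived t d = Suc (arrived t (d + u))" if "0 \<le> u" for u
    unfolding t'_def by (rule arrived_residual[OF Suc.prems(1) d that])
  have sums: "(\<Sum>j<Suc k. fst (sf j)) = d + (\<Sum>j<k. fst (sf (Suc j)))" for k
    by (simp add: sum.lessThan_Suc_shift d_def del: sum.lessThan_Suc)
  have nn: "0 \<le> (\<Sum>j<k. fst (sf (Suc j)))" for k using Suc.prems by (simp add: sum_nonneg)
  have "services (Suc i) t sf = services i t' (\<lambda>n. sf (Suc n))" by (simp add: t'_def d_def)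
  also have "\<dots> = ((fst (sf (Suc i)), arrived t' (\<Sum>j<Suc i. fst (sf (Suc j))) - arrived t' (\<Sum>j<i. fst (sf (Suc j)))), snd (sf (Suc i)))"
    using Suc.prems by (intro Suc.IH reg) auto
  also have "arrived t' (\<Sum>j<Suc i. fst (sf (Suc j))) - arrived t' (\<Sum>j<i. fst (sf (Suc j))) =
      arrived t (\<Sum>j<Suc (Suc i). fst (sf j)) - arrived t (\<Sum>j<Suc i. fst (sf j))"
    unfolding sums using shift[OF nn[of "Suc i"]] shift[OF nn[of i]] by linarith
  finally show ?case .
qed

lemma borel_measurable_of_bool:
  assumes "Measurable.pred N Q"
  shows "(\<lambda>x. of_bool (Q x) :: ennreal) \<in> borel_measurable N"
  by (rule measurable_compose[OF assms]) simp

context feedback_law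
begin

sublocale pois: poisson_arrivals lam
  by standard (rule lam_pos)

abbreviation "B \<equiv> measure_pmf (bernoulli_pmf p)"
abbreviation "GB \<equiv> G \<Otimes>\<^sub>M B"

sublocale GB: pair_prob_space G B ..

sublocale sf: sequence_space GB ..

abbreviation "SF \<equiv> sf.S"
abbreviation "A \<equiv> pois.A"

lemma sets_GB [measurable_cong]: "sets GB = sets (borel \<Otimes>\<^sub>M count_space UNIV)"
  by (rule sets_pair_measure_cong) simp_all

lemma space_GB [simp]: "space GB = UNIV"
  using sets_eq_imp_space_eq[OF sets_GB] by (simp add: space_pair_measure)

lemma space_SF [simp]: "space SF = UNIV"
  by (simp add: space_PiM)

lemma measurable_sf: "(\<lambda>sf. sf i) \<in> measurable SF (borel \<Otimes>\<^sub>M count_space UNIV)"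
proof -
  have "(\<lambda>sf. sf i) \<in> measurable SF GB" by (rule measurable_component_singleton) simp
  then show ?thesis by (simp add: sets_GB cong: measurable_cong_sets)
qed

lemma measurable_A_component: "(\<lambda>t. t i) \<in> borel_measurable A"
proof -
  have "(\<lambda>t. t i) \<in> measurable A pois.gap_law" by (rule measurable_component_singleton) simp
  then show ?thesis by (simp cong: measurable_cong_sets)
qed

lemma measurable_counted: "(\<lambda>x. counted (fst x) (snd x)) \<in> measurable (borel \<Otimes>\<^sub>M A) (count_space UNIV)"
proof -
  have "(\<lambda>x. arrived (snd x) (fst x)) \<in> measurable (borel \<Otimes>\<^sub>M A) (count_space UNIV)"
    by (intro measurable_arrived measurable_compose[OF measurable_snd measurable_A_component]) simp
  then show ?thesis unfolding counted_def by measurable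
qed

lemma measurable_residual_counted:
  "(\<lambda>x. residual (counted (fst x) (snd x)) (fst x) (snd x)) \<in> measurable (borel \<Otimes>\<^sub>M A) A"
  by (rule measurable_compose_countable[OF pois.measurable_residual measurable_counted])

lemma measurable_services: "(\<lambda>x. services i (fst x) (snd x)) \<in> measurable (A \<Otimes>\<^sub>M SF) D"
proof (induction i)
  case 0
  have "(\<lambda>x. (fst (snd x 0), fst x)) \<in> measurable (A \<Otimes>\<^sub>M SF) (borel \<Otimes>\<^sub>M A)"
    by (intro measurable_Pair measurable_compose[OF measurable_compose[OF measurable_snd measurable_sf] measurable_fst] measurable_fst)
  from measurable_compose[OF this measurable_counted]
  have "(\<lambda>x. ((fst (snd x 0), counted (fst (snd x 0)) (fst x)), snd (snd x 0))) \<in>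
      measurable (A \<Otimes>\<^sub>M SF) ((borel \<Otimes>\<^sub>M count_space UNIV) \<Otimes>\<^sub>M count_space UNIV)"
    by (intro measurable_Pair measurable_compose[OF measurable_compose[OF measurable_snd measurable_sf] measurable_fst]
        measurable_compose[OF measurable_compose[OF measurable_snd measurable_sf] measurable_snd]) simp
  then show ?case by (simp add: sets_D cong: measurable_cong_sets)
next
  case (Suc i)
  have 1: "(\<lambda>x. (fst (snd x 0), fst x)) \<in> measurable (A \<Otimes>\<^sub>M SF) (borel \<Otimes>\<^sub>M A)"
    by (intro measurable_Pair measurable_compose[OF measurable_compose[OF measurable_snd measurable_sf] measurable_fst] measurable_fst)
  have 2: "(\<lambda>x n. snd x (Suc n)) \<in> measurable (A \<Otimes>\<^sub>M SF) SF"
    by (rule measurable_abs_UNIV) (rule measurable_compose[OF measurable_snd measurable_component_singleton], simp)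
  from measurable_compose[OF measurable_Pair[OF measurable_compose[OF 1 measurable_residual_counted] 2] Suc.IH]
  show ?case by (simp only: services.simps fst_conv snd_conv)
qed

lemma nn_integral_first_service:
  assumes [measurable]: "f \<in> borel_measurable SF"
  shows "(\<integral>\<^sup>+sf. f sf \<partial>SF) = (\<integral>\<^sup>+x. \<integral>\<^sup>+sf. f (case_nat x sf) \<partial>SF \<partial>GB)"
proof -
  have cn: "(\<lambda>(s, t). case_nat s t) \<in> measurable (GB \<Otimes>\<^sub>M SF) SF"
    unfolding case_prod_beta' by (intro measurable_case_nat' measurable_fst measurable_snd)
  have "(\<integral>\<^sup>+sf. f sf \<partial>SF) = (\<integral>\<^sup>+sf. f sf \<partial>distr (GB \<Otimes>\<^sub>M SF) SF (\<lambda>(s, t). case_nat s t))"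
    by (simp only: sf.PiM_iter)
  also have "\<dots> = (\<integral>\<^sup>+x. f (case x of (s, t) \<Rightarrow> case_nat s t) \<partial>(GB \<Otimes>\<^sub>M SF))"
    by (rule nn_integral_distr[OF cn]) simp
  also have "\<dots> = (\<integral>\<^sup>+x. \<integral>\<^sup>+sf. f (case_nat x sf) \<partial>SF \<partial>GB)"
    using sf.P.nn_integral_fst[OF measurable_compose[OF cn assms], symmetric] by simp
  finally show ?thesis .
qed

lemma AE_GB_nonneg: "AE x in GB. 0 \<le> fst x"
proof -
  have "AE x in G. AE y in B. 0 \<le> fst (x, y)" using G_nonneg by simp
  moreover have "{x \<in> space GB. 0 \<le> fst x} \<in> sets GB" by measurable
  ultimately show ?thesis by (rule GB.AE_pair_measure[rotated])
qed

lemma measurable_job_sum: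
  assumes "E \<in> sets D"
  shows "(\<lambda>x. \<Sum>k. ennreal (poisson_weight (lam * fst x) k) * indicator E ((fst x, k), snd x)) \<in> borel_measurable GB"
proof -
  have E: "E \<in> sets ((borel \<Otimes>\<^sub>M count_space UNIV) \<Otimes>\<^sub>M count_space UNIV)"
    using assms by (simp only: sets_D)
  have "(\<lambda>x. ((fst x, k), snd x)) \<in> measurable GB ((borel \<Otimes>\<^sub>M count_space UNIV) \<Otimes>\<^sub>M count_space UNIV)" for k
    by measurable
  note measurable_compose[OF this borel_measurable_indicator[OF E], measurable]
  show ?thesis by measurable
qed

text \<open>
  The law of a triple in the form in which \<open>count_residual_independent\<close> produces it.
\<close>

lemma emeasure_D_eq:
  assumes "E \<in> sets D"
  shows "emeasure D E = (\<integral>\<^sup>+x. (\<Sum>k. ennreal (poisson_weight (lam * fst x) k) * indicator E ((fst x, k), snd x)) \<partial>GB)"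
proof -
  have E: "E \<in> sets ((borel \<Otimes>\<^sub>M count_space UNIV) \<Otimes>\<^sub>M count_space UNIV)"
    using assms by (simp only: sets_D)
  have B: "(\<integral>\<^sup>+f. h f \<partial>B) = h True * ennreal p + h False * ennreal (1 - p)" for h :: "bool \<Rightarrow> ennreal"
    using p_pos p_less_1 by simp
  have section_E: "(\<lambda>x. indicator E (x, v) :: ennreal) \<in> borel_measurable S2" for v
    by (rule measurable_compose[OF _ borel_measurable_indicator[OF E]]) measurable
  have "emeasure D E = (\<integral>\<^sup>+d. indicator E d \<partial>D)" using assms by simp
  also have "\<dots> = (\<integral>\<^sup>+x. indicator E (x, True) * ennreal p + indicator E (x, False) * ennreal (1 - p) \<partial>J)"
    by (rule nn_integral_service_law[OF borel_measurable_indicator[OF E]])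
  also have "\<dots> = (\<integral>\<^sup>+s. (\<Sum>k. ennreal (poisson_weight (lam * s) k) *
      (indicator E ((s, k), True) * ennreal p + indicator E ((s, k), False) * ennreal (1 - p))) \<partial>G)"
    by (rule nn_integral_job_law) (intro borel_measurable_add borel_measurable_times_ennreal section_E borel_measurable_const)
  also have "\<dots> = (\<integral>\<^sup>+s. \<integral>\<^sup>+f. (\<Sum>k. ennreal (poisson_weight (lam * s) k) * indicator E ((s, k), f)) \<partial>B \<partial>G)"
    unfolding B
  proof (intro nn_integral_cong)
    fix s
    show "(\<Sum>k. ennreal (poisson_weight (lam * s) k) *
        (indicator E ((s, k), True) * ennreal p + indicator E ((s, k), False) * ennreal (1 - p))) =
      (\<Sum>k. ennreal (poisson_weight (lam * s) k) * indicator E ((s, k), True)) * ennreal p +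
      (\<Sum>k. ennreal (poisson_weight (lam * s) k) * indicator E ((s, k), False)) * ennreal (1 - p)"
      unfolding ennreal_suminf_multc[symmetric] by (subst suminf_add) (simp_all add: distrib_left mult.assoc)
  qed
  also have "\<dots> = (\<integral>\<^sup>+x. (\<Sum>k. ennreal (poisson_weight (lam * fst x) k) * indicator E ((fst x, k), snd x)) \<partial>GB)"
    using measure_pmf.nn_integral_fst[OF measurable_job_sum[OF assms]] by simp
  finally show ?thesis .
qed

text \<open>
  Induction on the number of services: after the first service the residual stream is independent of
  the number of arrivals so far, and the other services start afresh from it.
\<close>

lemma services_rectangle:
  assumes "\<And>i. E i \<in> sets D"
  shows "(\<integral>\<^sup>+sf. \<integral>\<^sup>+t. of_bool (\<forall>i<n. services i t sf \<in> E i) \<partial>A \<partial>SF) = (\<Prod>i<n. emeasure D (E i))"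
  using assms
proof (induction n arbitrary: E)
  case 0
  show ?case using pois.gaps.P.emeasure_space_1 sf.P.emeasure_space_1 by simp
next
  case (Suc n)
  have in_E: "Measurable.pred (A \<Otimes>\<^sub>M SF) (\<lambda>x. services i (fst x) (snd x) \<in> E j)" for i j
  proof -
    have "Measurable.pred D (\<lambda>d. d \<in> E j)" using Suc.prems[of j] by (simp add: pred_def)
    from measurable_compose[OF measurable_services this] show ?thesis .
  qed
  let ?Q = "\<lambda>t sf. \<forall>i<n. services i t sf \<in> E (Suc i)"
  have Q: "Measurable.pred (A \<Otimes>\<^sub>M SF) (\<lambda>x. ?Q (fst x) (snd x))"
  proof -
    have "Measurable.pred (A \<Otimes>\<^sub>M SF) (\<lambda>x. \<forall>i\<in>{..<n}. services i (fst x) (snd x) \<in> E (Suc i))"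
      by (rule pred_intros_finite(3)[OF finite_lessThan in_E])
    then show ?thesis by (simp only: Ball_def lessThan_iff)
  qed
  have Qm: "(\<lambda>sf. \<integral>\<^sup>+t. of_bool (?Q t sf) \<partial>A) \<in> borel_measurable SF"
  proof (rule pois.gaps.P.borel_measurable_nn_integral)
    have "(\<lambda>x. (snd x, fst x)) \<in> measurable (SF \<Otimes>\<^sub>M A) (A \<Otimes>\<^sub>M SF)" by measurable
    from borel_measurable_of_bool[OF measurable_compose[OF this Q]]
    show "(\<lambda>(sf, t). of_bool (?Q t sf) :: ennreal) \<in> borel_measurable (SF \<Otimes>\<^sub>M A)"
      by (simp only: case_prod_beta' fst_conv snd_conv)
  qed
  have Qt: "Measurable.pred A (\<lambda>t. ?Q t sf)" for sf
  proof -
    have "(\<lambda>t. (t, sf)) \<in> measurable A (A \<Otimes>\<^sub>M SF)"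
      by (intro measurable_Pair measurable_ident_sets[OF refl] measurable_const) simp
    from measurable_compose[OF this Q] show ?thesis by (simp only: fst_conv snd_conv)
  qed
  have full: "(\<lambda>sf. \<integral>\<^sup>+t. of_bool (\<forall>i<Suc n. services i t sf \<in> E i) \<partial>A) \<in> borel_measurable SF"
  proof (rule pois.gaps.P.borel_measurable_nn_integral)
    have "Measurable.pred (A \<Otimes>\<^sub>M SF) (\<lambda>x. \<forall>i\<in>{..<Suc n}. services i (fst x) (snd x) \<in> E i)"
      by (rule pred_intros_finite(3)[OF finite_lessThan in_E])
    then have P: "Measurable.pred (A \<Otimes>\<^sub>M SF) (\<lambda>x. \<forall>i<Suc n. services i (fst x) (snd x) \<in> E i)"
      by (simp only: Ball_def lessThan_iff)
    have "(\<lambda>x. (snd x, fst x)) \<in> measurable (SF \<Otimes>\<^sub>M A) (A \<Otimes>\<^sub>M SF)" by measurable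
    from borel_measurable_of_bool[OF measurable_compose[OF this P]]
    show "(\<lambda>(sf, t). of_bool (\<forall>i<Suc n. services i t sf \<in> E i) :: ennreal) \<in> borel_measurable (SF \<Otimes>\<^sub>M A)"
      by (simp only: case_prod_beta' fst_conv snd_conv)
  qed
  have "(\<integral>\<^sup>+sf. \<integral>\<^sup>+t. of_bool (\<forall>i<Suc n. services i t sf \<in> E i) \<partial>A \<partial>SF) =
      (\<integral>\<^sup>+x. \<integral>\<^sup>+sf. \<integral>\<^sup>+t. of_bool (\<forall>i<Suc n. services i t (case_nat x sf) \<in> E i) \<partial>A \<partial>SF \<partial>GB)"
    by (rule nn_integral_first_service[OF full])
  also have "\<dots> = (\<integral>\<^sup>+x. (\<Sum>k. ennreal (poisson_weight (lam * fst x) k) * indicator (E 0) ((fst x, k), snd x))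
      * (\<Prod>i<n. emeasure D (E (Suc i))) \<partial>GB)"
  proof (intro nn_integral_cong_AE, use AE_GB_nonneg in eventually_elim)
    case (elim x)
    let ?d = "fst x"
    have "(\<integral>\<^sup>+sf. \<integral>\<^sup>+t. of_bool (\<forall>i<Suc n. services i t (case_nat x sf) \<in> E i) \<partial>A \<partial>SF) =
      (\<integral>\<^sup>+sf. (\<Sum>k. ennreal (poisson_weight (lam * ?d) k) * indicator (E 0) ((?d, k), snd x)) * (\<integral>\<^sup>+t. of_bool (?Q t sf) \<partial>A) \<partial>SF)"
    proof (intro nn_integral_cong)
      fix sf
      have "(\<integral>\<^sup>+t. of_bool (\<forall>i<Suc n. services i t (case_nat x sf) \<in> E i) \<partial>A) =
          (\<integral>\<^sup>+t. indicator (E 0) ((?d, counted ?d t), snd x) * of_bool (?Q (residual (counted ?d t) ?d t) sf) \<partial>A)"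
        by (intro nn_integral_cong) (auto simp: All_less_Suc2 indicator_def)
      also have "\<dots> = (\<Sum>k. ennreal (poisson_weight (lam * ?d) k) * indicator (E 0) ((?d, k), snd x)) * (\<integral>\<^sup>+t. of_bool (?Q t sf) \<partial>A)"
        by (rule pois.count_residual_independent[where \<psi>="\<lambda>k. indicator (E 0) ((?d, k), snd x)"])
            (rule borel_measurable_of_bool[OF Qt], rule elim)
      finally show "(\<integral>\<^sup>+t. of_bool (\<forall>i<Suc n. services i t (case_nat x sf) \<in> E i) \<partial>A) =
          (\<Sum>k. ennreal (poisson_weight (lam * ?d) k) * indicator (E 0) ((?d, k), snd x)) * (\<integral>\<^sup>+t. of_bool (?Q t sf) \<partial>A)" .
    qed
    also have "\<dots> = (\<Sum>k. ennreal (poisson_weight (lam * ?d) k) * indicator (E 0) ((?d, k), snd x)) *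
        (\<integral>\<^sup>+sf. \<integral>\<^sup>+t. of_bool (?Q t sf) \<partial>A \<partial>SF)"
      by (rule nn_integral_cmult[OF Qm])
    also have "(\<integral>\<^sup>+sf. \<integral>\<^sup>+t. of_bool (?Q t sf) \<partial>A \<partial>SF) = (\<Prod>i<n. emeasure D (E (Suc i)))"
      by (rule Suc.IH) (rule Suc.prems)
    finally show ?case .
  qed
  also have "\<dots> = emeasure D (E 0) * (\<Prod>i<n. emeasure D (E (Suc i)))"
    by (subst nn_integral_multc[OF measurable_job_sum]) (simp_all add: emeasure_D_eq Suc.prems)
  finally show ?case by (simp add: prod.lessThan_Suc_shift del: prod.lessThan_Suc)
qed

lemma measurable_services_seq: "(\<lambda>(sf, t) i. services i t sf) \<in> measurable (SF \<Otimes>\<^sub>M A) P"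
proof -
  have "(\<lambda>x i. services i (snd x) (fst x)) \<in> measurable (SF \<Otimes>\<^sub>M A) P"
  proof (rule measurable_abs_UNIV)
    fix i
    have "(\<lambda>x. (snd x, fst x)) \<in> measurable (SF \<Otimes>\<^sub>M A) (A \<Otimes>\<^sub>M SF)" by measurable
    from measurable_compose[OF this measurable_services[of i]]
    show "(\<lambda>x. services i (snd x) (fst x)) \<in> measurable (SF \<Otimes>\<^sub>M A) D"
      by (simp only: fst_conv snd_conv)
  qed
  then show ?thesis by (simp only: case_prod_beta')
qed

lemma distr_services: "distr (SF \<Otimes>\<^sub>M A) P (\<lambda>(sf, t) i. services i t sf) = P"
proof (rule seq.PiM_eq)
  fix K E assume K: "finite K" "K \<subseteq> (UNIV :: nat set)" "\<And>j. j \<in> K \<Longrightarrow> E j \<in> sets D"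
  obtain n where n: "K \<subseteq> {..<n}" using finite_nat_bounded[OF K(1)] by blast
  define E' where "E' i = (if i \<in> K then E i else UNIV)" for i
  have E': "E' i \<in> sets D" for i
    using K(3) sets.top[of D] by (auto simp: E'_def)
  have iff: "\<omega> \<in> prod_emb UNIV (\<lambda>_. D) K (\<Pi>\<^sub>E j\<in>K. E j) \<longleftrightarrow> (\<forall>i<n. \<omega> i \<in> E' i)" for \<omega>
    using n by (auto simp: prod_emb_def E'_def PiE_iff)
  have S: "prod_emb UNIV (\<lambda>_. D) K (\<Pi>\<^sub>E j\<in>K. E j) \<in> sets P"
    using K by (intro sets_PiM_I) auto
  have "emeasure (distr (SF \<Otimes>\<^sub>M A) P (\<lambda>(sf, t) i. services i t sf)) (prod_emb UNIV (\<lambda>_. D) K (\<Pi>\<^sub>E j\<in>K. E j)) =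
      (\<integral>\<^sup>+\<omega>. indicator (prod_emb UNIV (\<lambda>_. D) K (\<Pi>\<^sub>E j\<in>K. E j)) \<omega> \<partial>distr (SF \<Otimes>\<^sub>M A) P (\<lambda>(sf, t) i. services i t sf))"
    using S by simp
  also have "\<dots> = (\<integral>\<^sup>+x. indicator (prod_emb UNIV (\<lambda>_. D) K (\<Pi>\<^sub>E j\<in>K. E j)) (case x of (sf, t) \<Rightarrow> \<lambda>i. services i t sf) \<partial>(SF \<Otimes>\<^sub>M A))"
    using S by (intro nn_integral_distr[OF measurable_services_seq]) simp
  also have "\<dots> = (\<integral>\<^sup>+sf. \<integral>\<^sup>+t. indicator (prod_emb UNIV (\<lambda>_. D) K (\<Pi>\<^sub>E j\<in>K. E j)) (\<lambda>i. services i t sf) \<partial>A \<partial>SF)"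
    using pois.gaps.P.nn_integral_fst[OF measurable_compose[OF measurable_services_seq borel_measurable_indicator[OF S]], symmetric] by simp
  also have "\<dots> = (\<integral>\<^sup>+sf. \<integral>\<^sup>+t. of_bool (\<forall>i<n. services i t sf \<in> E' i) \<partial>A \<partial>SF)"
    by (intro nn_integral_cong) (simp add: indicator_def iff)
  also have "\<dots> = (\<Prod>i<n. emeasure D (E' i))"
    by (rule services_rectangle[OF E'])
  also have "\<dots> = (\<Prod>i\<in>K. emeasure D (E' i))"
    using n D.emeasure_space_1 by (intro prod.mono_neutral_right) (auto simp: E'_def)
  also have "\<dots> = (\<Prod>i\<in>K. emeasure D (E i))"
    by (intro prod.cong) (auto simp: E'_def)
  finally show "emeasure (distr (SF \<Otimes>\<^sub>M A) P (\<lambda>(sf, t) i. services i t sf)) (prod_emb UNIV (\<lambda>_. D) K (\<Pi>\<^sub>E j\<in>K. E j)) =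
      (\<Prod>j\<in>K. emeasure D (E j))" .
qed (rule sets_distr)

end

section \<open>Rounds of the feedback queue\<close>

lemma leaves_unique: "leaves k m \<omega> y \<Longrightarrow> leaves k' m \<omega> y' \<Longrightarrow> k = k'"
proof (induction k arbitrary: k' m \<omega> y y')
  case (Suc k)
  from Suc.prems(2) obtain j where j: "k' = Suc j" by (cases k') auto
  show ?case
  proof (cases "returns (\<omega> m)")
    case True
    with Suc.prems j Suc.IH show ?thesis by auto
  qed (use Suc.prems j in auto)
qed simp

text \<open>
  While the customers in front of the tagged one are served, the line consists of those still to be
  served, the tagged customer, and those who joined during this round. The server is never
  idle, since the tagged customer is present.
\<close>

lemma queue_walk:
  fixes s :: "nat \<Rightarrow> real"
  defines "V \<equiv> \<lambda>n. \<Sum>j<n. s j"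
  assumes reg: "regular t" and s: "\<And>i. 0 \<le> s i"
    and start: "queue_state t s f n = (V n, arrived t (V n), ys @ [0])" "0 \<notin> set ys"
    and i: "i \<le> length ys"
  shows "\<exists>zs. queue_state t s f (n + i) = (V (n + i), arrived t (V (n + i)), drop i ys @ 0 # zs) \<and> 0 \<notin> set zs \<and>
    length zs = (\<Sum>j<i. (arrived t (V (Suc (n + j))) - arrived t (V (n + j))) + of_bool (f (n + j)))"
  using i
proof (induction i)
  case 0
  show ?case using start by simp
next
  case (Suc i)
  then obtain zs where st: "queue_state t s f (n + i) = (V (n + i), arrived t (V (n + i)), drop i ys @ 0 # zs)"
    and zs: "0 \<notin> set zs"
      "length zs = (\<Sum>j<i. (arrived t (V (Suc (n + j))) - arrived t (V (n + j))) + of_bool (f (n + j)))"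
    by auto
  have drop: "drop i ys = ys ! i # drop (Suc i) ys" using Suc.prems by (simp add: Cons_nth_drop_Suc)
  have V_nonneg: "0 \<le> V (n + i)" using s by (simp add: V_def sum_nonneg)
  have V_Suc: "V (Suc (n + i)) = V (n + i) + s (n + i)" by (simp add: V_def)
  let ?new = "[arrived t (V (n + i))..<arrived t (V (Suc (n + i)))]"
  let ?zs = "zs @ ?new @ (if f (n + i) then [ys ! i] else [])"
  have "queue_state t s f (n + Suc i) = (V (n + Suc i), arrived t (V (n + Suc i)), drop (Suc i) ys @ 0 # ?zs)"
    by (simp add: st drop V_Suc Let_def)
  moreover have "0 \<notin> set ?zs"
  proof -
    have "ys ! i \<in> set ys" using Suc.prems by simp
    then have "ys ! i \<noteq> 0" using start(2) by metis
    then show ?thesis using zs(1) arrived_pos[OF reg V_nonneg] by auto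
  qed
  moreover have "length ?zs = (\<Sum>j<Suc i. (arrived t (V (Suc (n + j))) - arrived t (V (n + j))) + of_bool (f (n + j)))"
    using zs(2) by (cases "f (n + i)") simp_all
  ultimately show ?case by blast
qed

text \<open>
  Links the abstract rounds to the queue. A departure at some level \<open>y0\<close> fixes the number of rounds
  \<open>k\<close>; after that, the level \<open>y\<close> is exceeded iff the sojourn time says so. The statement starts at the
  beginning of an arbitrary round, at service \<open>n\<close>, to allow for induction on \<open>k\<close>.
\<close>

lemma leaves_iff_sojourn:
  fixes t s :: "nat \<Rightarrow> real" and f :: "nat \<Rightarrow> bool"
  defines "V \<equiv> \<lambda>n. \<Sum>j<n. s j"
  defines "srv \<equiv> \<lambda>i. ((s i, arrived t (V (Suc i)) - arrived t (V i)), f i)"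
  assumes reg: "regular t" and s: "\<And>i. 0 \<le> s i"
    and "queue_state t s f n = (V n, arrived t (V n), ys @ [0])" "0 \<notin> set ys"
    and "\<And>i. i < n \<Longrightarrow> 0 \<in> present (queue_state t s f i)"
    and "leaves k (length ys) (\<lambda>i. srv (i + n)) y0"
  shows "leaves k (length ys) (\<lambda>i. srv (i + n)) y \<longleftrightarrow> V n + y < sojourn_time t s f"
  using assms(5-)
proof (induction k arbitrary: n ys y0 y)
  case (Suc k)
  define m where "m = length ys"
  define \<omega> where "\<omega> i = srv (i + n)" for i
  have walk: "\<exists>zs. queue_state t s f (n + i) = (V (n + i), arrived t (V (n + i)), drop i ys @ 0 # zs) \<and> 0 \<notin> set zs \<and>
    length zs = (\<Sum>j<i. (arrived t (V (Suc (n + j))) - arrived t (V (n + j))) + of_bool (f (n + j)))" if "i \<le> m" for i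
    using queue_walk[OF reg s Suc.prems(1)[unfolded V_def] Suc.prems(2)] that unfolding V_def m_def by blast
  then obtain zs where st: "queue_state t s f (n + m) = (V (n + m), arrived t (V (n + m)), 0 # zs)"
    and zs: "0 \<notin> set zs"
      "length zs = (\<Sum>j<m. (arrived t (V (Suc (n + j))) - arrived t (V (n + j))) + of_bool (f (n + j)))"
    using walk[of m] by (auto simp: m_def)
  have V_nonneg: "0 \<le> V (n + m)" using s by (simp add: V_def sum_nonneg)
  have V_Suc: "V (Suc (n + m)) = V (n + m) + s (n + m)" by (simp add: V_def)
  define ys' where "ys' = zs @ [arrived t (V (n + m))..<arrived t (V (Suc (n + m)))]"
  have ys': "0 \<notin> set ys'" using zs arrived_pos[OF reg V_nonneg] by (simp add: ys'_def)
  have st': "queue_state t s f (Suc (n + m)) = (V (Suc (n + m)), arrived t (V (Suc (n + m))), ys' @ (if f (n + m) then [0] else []))"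
    by (simp add: st V_Suc Let_def ys'_def)
  have present: "0 \<in> present (queue_state t s f i)" if "i < Suc (n + m)" for i
  proof (cases "i < n")
    case False
    then have "i = n + (i - n)" "i - n \<le> m" using that by auto
    with walk[of "i - n"] show ?thesis by (auto simp: present_def)
  qed (rule Suc.prems(3))
  have len: "length ys' = others_after m \<omega>"
    using zs(2) by (simp add: ys'_def others_after_def \<omega>_def srv_def arrivals_def returns_def add.commute)
  have time: "round_time m \<omega> = V (Suc (n + m)) - V n"
  proof -
    have "V (n + j) - V n = (\<Sum>i<j. s (i + n))" for j
      by (induction j) (simp_all add: V_def add.commute)
    from this[of "Suc m"] show ?thesis
      using s by (simp add: round_time_def service_time_def \<omega>_def srv_def max_def add.commute)
  qed
  have ret: "returns (\<omega> m) \<longleftrightarrow> f (n + m)" by (simp add: \<omega>_def srv_def returns_def add.commute)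
  have shift: "(\<lambda>i. \<omega> (i + Suc m)) = (\<lambda>i. srv (i + Suc (n + m)))"
    by (simp add: \<omega>_def add_ac)
  have srv: "(\<lambda>i. srv (i + n)) = \<omega>" by (rule ext) (simp add: \<omega>_def)
  have leaves: "leaves (Suc k) (length ys) (\<lambda>i. srv (i + n)) z \<longleftrightarrow>
      (if f (n + m) then leaves k (length ys') (\<lambda>i. srv (i + Suc (n + m))) (z - (V (Suc (n + m)) - V n))
       else k = 0 \<and> z < V (Suc (n + m)) - V n)" for z
    unfolding srv m_def[symmetric] leaves.simps ret shift len time ..
  show ?case
  proof (cases "f (n + m)")
    case True
    have "leaves k (length ys') (\<lambda>i. srv (i + Suc (n + m))) (y0 - (V (Suc (n + m)) - V n))"
      using Suc.prems(4) True unfolding leaves by simp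
    then have "leaves k (length ys') (\<lambda>i. srv (i + Suc (n + m))) (y - (V (Suc (n + m)) - V n)) \<longleftrightarrow>
        V (Suc (n + m)) + (y - (V (Suc (n + m)) - V n)) < sojourn_time t s f"
      using True st' ys' present by (intro Suc.IH) auto
    moreover have "V (Suc (n + m)) + (y - (V (Suc (n + m)) - V n)) = V n + y" by simp
    ultimately show ?thesis unfolding leaves using True by simp
  next
    case False
    have "k = 0" using Suc.prems(4) False unfolding leaves by simp
    have "(LEAST k. 0 \<notin> present (queue_state t s f k)) = Suc (n + m)"
    proof (rule Least_equality)
      show "0 \<notin> present (queue_state t s f (Suc (n + m)))"
        using ys' False unfolding st' by (simp add: present_def)
      show "Suc (n + m) \<le> j" if "0 \<notin> present (queue_state t s f j)" for j
        using that present[of j] by (meson not_less)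
    qed
    then have "sojourn_time t s f = V (Suc (n + m))"
      unfolding sojourn_time_def by (simp only: st' clock_def fst_conv)
    then show ?thesis
      unfolding leaves using False \<open>k = 0\<close> by (simp add: algebra_simps)
  qed
qed simp

lemma leaves_services_iff:
  assumes "regular t" "\<And>i. 0 \<le> fst (sf i)" "leaves k 0 (\<lambda>i. services i t sf) y0"
  shows "leaves k 0 (\<lambda>i. services i t sf) y \<longleftrightarrow> y < sojourn_time t (\<lambda>i. fst (sf i)) (\<lambda>i. snd (sf i))"
proof -
  have eq: "(\<lambda>i. services i t sf) = (\<lambda>i. ((fst (sf (i + 0)),
    arrived t (\<Sum>j<Suc (i + 0). fst (sf j)) - arrived t (\<Sum>j<i + 0. fst (sf j))), snd (sf (i + 0))))"
    using services_eq[OF assms(1,2)] by (intro ext) (simp only: add_0_right)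
  have "queue_state t (\<lambda>i. fst (sf i)) (\<lambda>i. snd (sf i)) 0 =
      ((\<Sum>j<0. fst (sf j)), arrived t (\<Sum>j<0. fst (sf j)), [] @ [0])"
    using arrived_0[OF assms(1)] by simp
  from leaves_iff_sojourn[OF assms(1,2) this, of k y0 y] assms(3)
  show ?thesis unfolding eq by simp
qed

text \<open>
  The state of the line takes countably many values, so its measurability can be checked for each
  value of the previous state separately.
\<close>

lemma measurable_queue_state:
  assumes t: "\<And>i. (\<lambda>x. t x i) \<in> borel_measurable N"
    and s: "\<And>i. (\<lambda>x. s x i) \<in> borel_measurable N"
    and f: "\<And>i. Measurable.pred N (\<lambda>x. f x i)"
  shows "(\<lambda>x. fst (queue_state (t x) (s x) (f x) k)) \<in> borel_measurable N \<and>
    (\<lambda>x. snd (queue_state (t x) (s x) (f x) k)) \<in> measurable N (count_space UNIV)"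
proof (induction k)
  case 0
  show ?case by simp
next
  case (Suc k)
  define u where "u x = fst (queue_state (t x) (s x) (f x) k)" for x
  define z where "z x = snd (queue_state (t x) (s x) (f x) k)" for x
  have [measurable]: "u \<in> borel_measurable N" "z \<in> measurable N (count_space UNIV)"
    using Suc by (auto simp: u_def[abs_def] z_def[abs_def])
  note [measurable] = t s f
  define u' where "u' x = (if snd (z x) = [] then arrival_time (t x) (fst (z x)) + s x k else u x + s x k)" for x
  have u' [measurable]: "u' \<in> borel_measurable N"
    unfolding u'_def[abs_def] arrival_time_def
    by (rule measurable_compose_countable[where g=z and
          f="\<lambda>z x. if snd z = [] then (\<Sum>i<fst z. t x i) + s x k else u x + s x k"]) measurable
  have a: "(\<lambda>x. arrived (t x) (u' x)) \<in> measurable N (count_space UNIV)"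
    by (intro measurable_arrived t u')
  define h :: "nat \<times> nat list \<Rightarrow> nat \<Rightarrow> bool \<Rightarrow> nat \<times> nat list" where
    "h z n' b = (n', (case snd z of [] \<Rightarrow> [Suc (fst z)..<n'] @ (if b then [fst z] else [])
      | c # cs \<Rightarrow> cs @ [fst z..<n'] @ (if b then [c] else [])))" for z n' b
  have eq: "queue_state (t x) (s x) (f x) (Suc k) = (u' x, h (z x) (arrived (t x) (u' x)) (f x k))" for x
  proof -
    have "queue_state (t x) (s x) (f x) k = (u x, fst (z x), snd (z x))" by (simp add: u_def z_def)
    then show ?thesis by (cases "snd (z x)") (auto simp: u'_def h_def Let_def)
  qed
  have "(\<lambda>x. h (z x) (arrived (t x) (u' x)) (f x k)) \<in> measurable N (count_space UNIV)"
  proof (rule measurable_compose_countable[where g=z and f="\<lambda>z x. h z (arrived (t x) (u' x)) (f x k)"])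
    fix z
    show "(\<lambda>x. h z (arrived (t x) (u' x)) (f x k)) \<in> measurable N (count_space UNIV)"
    proof (rule measurable_compose_countable[OF _ a, where f="\<lambda>n x. h z n (f x k)"])
      fix n
      show "(\<lambda>x. h z n (f x k)) \<in> measurable N (count_space UNIV)"
        by (rule measurable_compose[OF f]) simp
    qed
  qed measurable
  then show ?case using u' unfolding eq by simp
qed

lemma measurable_sojourn_time:
  assumes "\<And>i. (\<lambda>x. t x i) \<in> borel_measurable N"
    and "\<And>i. (\<lambda>x. s x i) \<in> borel_measurable N"
    and "\<And>i. Measurable.pred N (\<lambda>x. f x i)"
  shows "(\<lambda>x. sojourn_time (t x) (s x) (f x)) \<in> borel_measurable N"
proof -
  note q = measurable_queue_state[OF assms]
  have "Measurable.pred N (\<lambda>x. 0 \<notin> present (queue_state (t x) (s x) (f x) k))" for k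
    unfolding present_def by (rule measurable_compose[OF conjunct2[OF q[where k=k]]]) simp
  then have "(\<lambda>x. LEAST k. 0 \<notin> present (queue_state (t x) (s x) (f x) k)) \<in> measurable N (count_space UNIV)"
    by (rule measurable_Least)
  from measurable_compose_countable[OF conjunct1[OF q] this]
  show ?thesis by (simp add: sojourn_time_def clock_def)
qed

context feedback_law
begin

lemma AE_chain_nonneg: "AE z in chain j. 0 \<le> fst z"
proof (induction j)
  case 0
  show ?case unfolding chain.simps by (subst AE_return) (auto simp: space_pair_measure)
next
  case (Suc j)
  have A: "{z :: real \<times> nat. fst z < 0} \<in> sets S2" by (intro sets_S2I) measurable
  have "emeasure (chain (Suc j)) {z. fst z < 0} = (\<integral>\<^sup>+z. indicator {z. fst z < 0} z \<partial>chain (Suc j))"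
    using A by (intro nn_integral_indicator[symmetric]) (simp add: sets_chain)
  also have "\<dots> = (\<integral>\<^sup>+z. \<integral>\<^sup>+\<omega>. indicator {z. fst z < 0} (step (z, \<omega>)) \<partial>P \<partial>chain j)"
    using A by (intro nn_integral_chain_Suc) simp
  also have "\<dots> = (\<integral>\<^sup>+z. 0 \<partial>chain j)"
  proof (intro nn_integral_cong_AE, use Suc in eventually_elim)
    case (elim z)
    have "step (z, \<omega>) \<notin> {z. fst z < 0}" for \<omega>
      using elim round_time_nonneg[of "snd z" \<omega>] by (simp add: step_def not_less)
    then show ?case by simp
  qed
  finally have "emeasure (chain (Suc j)) {z. fst z < 0} = 0" by simp
  then show ?case
    using A by (intro AE_I[where N="{z. fst z < 0}"]) (auto simp: sets_chain not_le)
qed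

text \<open>
  At level \<open>- 1\<close>, which is below all times, \<open>leaves\<close> only says in which round the tagged customer
  departs. The probabilities of these disjoint events form a geometric distribution.
\<close>

lemma AE_leaves: "AE \<omega> in P. \<exists>k. leaves k 0 \<omega> (- 1)"
proof -
  have one: "measure (chain (Suc k)) {z. - 1 < fst z} = 1" for k
  proof -
    interpret C: prob_space "chain (Suc k)" by (rule prob_space_chain)
    have "AE z in chain (Suc k). z \<in> {z. - 1 < fst z}"
      using AE_chain_nonneg[of "Suc k"] by eventually_elim simp
    then show ?thesis by (rule C.prob_eq_1[THEN iffD2, rotated]) (simp add: sets_chain sets_S2I)
  qed
  have "(\<lambda>k. seq.P.prob {\<omega>. leaves (Suc k) 0 \<omega> (- 1)}) sums seq.P.prob (\<Union>k. {\<omega>. leaves (Suc k) 0 \<omega> (- 1)})"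
  proof (rule seq.P.finite_measure_UNION)
    show "range (\<lambda>k. {\<omega>. leaves (Suc k) 0 \<omega> (- 1)}) \<subseteq> seq.P.events"
      by (intro image_subsetI) (rule sets_PI[OF measurable_leaves_fixed])
    show "disjoint_family (\<lambda>k. {\<omega>. leaves (Suc k) 0 \<omega> (- 1)})"
      unfolding disjoint_family_on_def using leaves_unique by blast
  qed
  moreover have "(\<lambda>k. seq.P.prob {\<omega>. leaves (Suc k) 0 \<omega> (- 1)}) sums 1"
  proof -
    have "(\<lambda>k. (1 - p) * p ^ k) sums ((1 - p) * (1 / (1 - p)))"
      using p_pos p_less_1 by (intro sums_mult geometric_sums) auto
    then show ?thesis using p_less_1 by (simp add: prob_leaves one del: leaves.simps)
  qed
  ultimately have "seq.P.prob (\<Union>k. {\<omega>. leaves (Suc k) 0 \<omega> (- 1)}) = 1" by (rule sums_unique2)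
  from seq.P.AE_prob_1[OF this] show ?thesis
    by eventually_elim (auto simp del: leaves.simps)
qed

lemma AE_SF_nonneg: "AE sf in SF. \<forall>i. 0 \<le> fst (sf i)"
proof -
  have "AE sf in SF. 0 \<le> fst (sf i)" for i by (intro sf.AE_component AE_GB_nonneg) simp
  then show ?thesis by (simp add: AE_all_countable)
qed

sublocale SFA: pair_prob_space SF A ..

lemma measurable_canonical_sojourn:
  "(\<lambda>(sf, t). sojourn_time t (\<lambda>i. fst (sf i)) (\<lambda>i. snd (sf i))) \<in> borel_measurable (SF \<Otimes>\<^sub>M A)"
  unfolding case_prod_beta'
proof (rule measurable_sojourn_time)
  show "(\<lambda>x. snd x i) \<in> borel_measurable (SF \<Otimes>\<^sub>M A)" for i
    by (rule measurable_compose[OF measurable_snd measurable_A_component])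
  have c: "(\<lambda>x. fst x i) \<in> measurable (SF \<Otimes>\<^sub>M A) (borel \<Otimes>\<^sub>M count_space UNIV)" for i
    by (rule measurable_compose[OF measurable_fst measurable_sf])
  show "(\<lambda>x. fst (fst x i)) \<in> borel_measurable (SF \<Otimes>\<^sub>M A)" "Measurable.pred (SF \<Otimes>\<^sub>M A) (\<lambda>x. snd (fst x i))" for i
    by (rule measurable_compose[OF c measurable_fst] measurable_compose[OF c measurable_snd])+
qed

text \<open>
  On the product space of all services and arrivals, \<open>distr_services\<close> replaces the
  services of the queue by independent triples.
\<close>

lemma canonical_sojourn_prob:
  "measure (SF \<Otimes>\<^sub>M A) {(sf, t). x < sojourn_time t (\<lambda>i. fst (sf i)) (\<lambda>i. snd (sf i))} =
    (\<Sum>k. seq.P.prob {\<omega>. leaves (Suc k) 0 \<omega> x})"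
proof -
  let ?srv = "\<lambda>(sf, t) i. services i t sf"
  let ?L = "\<Union>k. {\<omega>. leaves (Suc k) 0 \<omega> x}"
  have L: "?L \<in> sets P" 
    by (rule sets.countable_UN) (intro image_subsetI, rule sets_PI[OF measurable_leaves_fixed])
  have space: "space (SF \<Otimes>\<^sub>M A) = UNIV" by (simp add: space_pair_measure)
  have "AE y in SF \<Otimes>\<^sub>M A. (\<forall>i. 0 \<le> fst (fst y i)) \<and> regular (snd y) \<and> (\<exists>k. leaves k 0 (?srv y) (- 1))"
  proof (intro AE_conjI)
    have "AE sf in SF. AE t in A. \<forall>i. 0 \<le> fst (fst (sf, t) i)" using AE_SF_nonneg by simp
    moreover have "{y \<in> space (SF \<Otimes>\<^sub>M A). \<forall>i. 0 \<le> fst (fst y i)} \<in> sets (SF \<Otimes>\<^sub>M A)"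
    proof -
      have [measurable]: "(\<lambda>y. fst (fst y i)) \<in> borel_measurable (SF \<Otimes>\<^sub>M A)" for i
        by (rule measurable_compose[OF measurable_compose[OF measurable_fst measurable_sf] measurable_fst])
      show ?thesis by measurable
    qed
    ultimately show "AE y in SF \<Otimes>\<^sub>M A. \<forall>i. 0 \<le> fst (fst y i)" by (intro SFA.AE_pair_measure)
    have "AE sf in SF. AE t in A. regular (snd (sf, t))" using pois.AE_regular by simp
    moreover have "{y \<in> space (SF \<Otimes>\<^sub>M A). regular (snd y)} \<in> sets (SF \<Otimes>\<^sub>M A)"
    proof -
      have [measurable]: "(\<lambda>y. snd y i) \<in> borel_measurable (SF \<Otimes>\<^sub>M A)" for i
        by (rule measurable_compose[OF measurable_snd measurable_A_component])
      have "regular t \<longleftrightarrow> (\<forall>i. 0 < t i) \<and> (\<forall>m::nat. \<exists>n. real m < arrival_time t n)" for t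
        unfolding regular_def by (meson less_trans reals_Archimedean2)
      then show ?thesis unfolding arrival_time_def by simp
    qed
    ultimately show "AE y in SF \<Otimes>\<^sub>M A. regular (snd y)" by (intro SFA.AE_pair_measure)
    have "AE \<omega> in distr (SF \<Otimes>\<^sub>M A) P ?srv. \<exists>k. leaves k 0 \<omega> (- 1)"
      unfolding distr_services by (rule AE_leaves)
    then show "AE y in SF \<Otimes>\<^sub>M A. \<exists>k. leaves k 0 (?srv y) (- 1)"
      by (rule AE_distrD[OF measurable_services_seq])
  qed
  then have ae: "AE y in SF \<Otimes>\<^sub>M A. (case y of (sf, t) \<Rightarrow> x < sojourn_time t (\<lambda>i. fst (sf i)) (\<lambda>i. snd (sf i))) \<longleftrightarrow> ?srv y \<in> ?L"
  proof eventually_elim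
    case (elim y)
    obtain sf t where y: "y = (sf, t)" by force
    obtain k where k: "leaves k 0 (\<lambda>i. services i t sf) (- 1)" using elim y by auto
    then obtain j where j: "k = Suc j" by (cases k) auto
    have iff: "leaves k 0 (\<lambda>i. services i t sf) x \<longleftrightarrow> x < sojourn_time t (\<lambda>i. fst (sf i)) (\<lambda>i. snd (sf i))"
      using elim y k by (intro leaves_services_iff) auto
    have "(\<exists>i. leaves (Suc i) 0 (\<lambda>i. services i t sf) x) \<longleftrightarrow> leaves k 0 (\<lambda>i. services i t sf) x"
      using leaves_unique[OF _ k] j by metis
    then show ?case using iff by (simp add: y del: leaves.simps)
  qed
  have "measure (SF \<Otimes>\<^sub>M A) {(sf, t). x < sojourn_time t (\<lambda>i. fst (sf i)) (\<lambda>i. snd (sf i))} =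
      measure (SF \<Otimes>\<^sub>M A) (?srv -` ?L \<inter> space (SF \<Otimes>\<^sub>M A))"
  proof (rule measure_eq_AE)
    show "?srv -` ?L \<inter> space (SF \<Otimes>\<^sub>M A) \<in> sets (SF \<Otimes>\<^sub>M A)"
      by (rule measurable_sets[OF measurable_services_seq L])
    have "(\<lambda>(sf, t). sojourn_time t (\<lambda>i. fst (sf i)) (\<lambda>i. snd (sf i))) -` {x<..} \<inter> space (SF \<Otimes>\<^sub>M A) \<in> sets (SF \<Otimes>\<^sub>M A)"
      by (rule measurable_sets[OF measurable_canonical_sojourn]) simp
    then show "{(sf, t). x < sojourn_time t (\<lambda>i. fst (sf i)) (\<lambda>i. snd (sf i))} \<in> sets (SF \<Otimes>\<^sub>M A)"
      unfolding space by (simp add: vimage_def case_prod_beta')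
    show "AE y in SF \<Otimes>\<^sub>M A. y \<in> {(sf, t). x < sojourn_time t (\<lambda>i. fst (sf i)) (\<lambda>i. snd (sf i))} \<longleftrightarrow>
        y \<in> ?srv -` ?L \<inter> space (SF \<Otimes>\<^sub>M A)"
      using ae by eventually_elim (simp add: space del: leaves.simps)
  qed
  also have "\<dots> = measure (distr (SF \<Otimes>\<^sub>M A) P ?srv) ?L"
    by (rule measure_distr[OF measurable_services_seq L, symmetric])
  also have "\<dots> = seq.P.prob ?L" unfolding distr_services ..
  also have "\<dots> = (\<Sum>k. seq.P.prob {\<omega>. leaves (Suc k) 0 \<omega> x})"
  proof (rule sums_unique, rule seq.P.finite_measure_UNION)
    show "range (\<lambda>k. {\<omega>. leaves (Suc k) 0 \<omega> x}) \<subseteq> seq.P.events"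
      by (intro image_subsetI) (rule sets_PI[OF measurable_leaves_fixed])
    show "disjoint_family (\<lambda>k. {\<omega>. leaves (Suc k) 0 \<omega> x})"
      unfolding disjoint_family_on_def using leaves_unique by blast
  qed
  finally show ?thesis .
qed

end

section \<open>The inputs of the queue\<close>

text \<open>
  The inputs come as one family with three kinds of indices, the canonical space as a pair of
  sequences. The next maps translate between the two; the index bounds a finite set of inputs.
\<close>

fun input_index :: "input \<Rightarrow> nat" where
  "input_index (Interarrival n) = n"
| "input_index (Service n) = n"
| "input_index (Feedback n) = n"

definition merge_inputs :: "(nat \<Rightarrow> real \<times> bool) \<times> (nat \<Rightarrow> real) \<Rightarrow> input \<Rightarrow> real" where
  "merge_inputs y i = (case i of Interarrival n \<Rightarrow> snd y n | Service n \<Rightarrow> fst (fst y n)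
    | Feedback n \<Rightarrow> of_bool (snd (fst y n)))"

definition split_inputs :: "(input \<Rightarrow> real) \<Rightarrow> (nat \<Rightarrow> real \<times> bool) \<times> (nat \<Rightarrow> real)" where
  "split_inputs x = (\<lambda>n. (x (Service n), x (Feedback n) = 1), \<lambda>n. x (Interarrival n))"

lemma split_merge_inputs: "split_inputs (merge_inputs y) = y"
  by (simp add: split_inputs_def merge_inputs_def prod_eq_iff fun_eq_iff)

context feedback_law
begin

definition input_law :: "input \<Rightarrow> real measure" where
  "input_law i = (case i of Interarrival _ \<Rightarrow> pois.gap_law | Service _ \<Rightarrow> G | Feedback _ \<Rightarrow> distr B borel of_bool)"

lemma sets_input_law [measurable_cong, simp]: "sets (input_law i) = sets borel"
  by (cases i) (simp_all add: input_law_def)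

lemma space_input_law [simp]: "space (input_law i) = UNIV"
  using sets_eq_imp_space_eq[OF sets_input_law] by simp

lemma prob_space_input_law: "prob_space (input_law i)"
  by (cases i) (auto simp: input_law_def pois.gap.prob_space_axioms prob_space_axioms
      intro!: measure_pmf.prob_space_distr)

sublocale inputs: product_prob_space input_law UNIV
  by (intro product_prob_spaceI prob_space_input_law)

lemma measurable_merge_inputs: "merge_inputs \<in> measurable (SF \<Otimes>\<^sub>M A) (PiM UNIV input_law)"
proof (rule measurable_abs_UNIV[where f = "\<lambda>i y. merge_inputs y i", simplified])
  fix i
  have c: "(\<lambda>x. fst x n) \<in> measurable (SF \<Otimes>\<^sub>M A) (borel \<Otimes>\<^sub>M count_space UNIV)" for n
    by (rule measurable_compose[OF measurable_fst measurable_sf])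
  have f: "(\<lambda>x. of_bool (snd (fst x n))) \<in> borel_measurable (SF \<Otimes>\<^sub>M A)" for n
    by (rule measurable_compose[OF measurable_compose[OF c measurable_snd]]) simp
  have "(\<lambda>y. merge_inputs y i) \<in> borel_measurable (SF \<Otimes>\<^sub>M A)"
  proof (cases i)
    case (Interarrival n)
    then show ?thesis
      using measurable_compose[OF measurable_snd measurable_A_component[of n]] by (simp add: merge_inputs_def)
  next
    case (Service n)
    then show ?thesis
      using measurable_compose[OF c[of n] measurable_fst] by (simp add: merge_inputs_def)
  next
    case (Feedback n)
    then show ?thesis using f[of n] by (simp add: merge_inputs_def)
  qed
  then show "(\<lambda>y. merge_inputs y i) \<in> measurable (SF \<Otimes>\<^sub>M A) (input_law i)"
    by (simp cong: measurable_cong_sets)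
qed

lemma measurable_split_inputs: "split_inputs \<in> measurable (PiM UNIV input_law) (SF \<Otimes>\<^sub>M A)"
proof -
  have c: "(\<lambda>x. x i) \<in> borel_measurable (PiM UNIV input_law)" for i
  proof -
    have "(\<lambda>x. x i) \<in> measurable (PiM UNIV input_law) (input_law i)"
      by (rule measurable_component_singleton) simp
    then show ?thesis by (simp cong: measurable_cong_sets)
  qed
  have "(\<lambda>x n. (x (Service n), x (Feedback n) = 1)) \<in> measurable (PiM UNIV input_law) SF"
  proof (rule measurable_abs_UNIV)
    fix n
    have "Measurable.pred (PiM UNIV input_law) (\<lambda>x. x (Feedback n) = 1)"
      by (rule measurable_compose[OF c]) simp
    then have "(\<lambda>x. (x (Service n), x (Feedback n) = 1)) \<in> measurable (PiM UNIV input_law) (borel \<Otimes>\<^sub>M count_space UNIV)"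
      by (intro measurable_Pair c)
    then show "(\<lambda>x. (x (Service n), x (Feedback n) = 1)) \<in> measurable (PiM UNIV input_law) GB"
      by (simp add: sets_GB cong: measurable_cong_sets)
  qed
  moreover have "(\<lambda>x n. x (Interarrival n)) \<in> measurable (PiM UNIV input_law) A"
    by (rule measurable_abs_UNIV) (use c in \<open>simp cong: measurable_cong_sets\<close>)
  ultimately show ?thesis unfolding split_inputs_def[abs_def] by (rule measurable_Pair)
qed

text \<open>
  Both laws are determined by finite rectangles, on which they are the same product up to the order
  of the factors.
\<close>

lemma distr_merge_inputs: "distr (SF \<Otimes>\<^sub>M A) (PiM UNIV input_law) merge_inputs = PiM UNIV input_law"
proof (rule inputs.PiM_eq)
  fix K E assume K: "finite K" "K \<subseteq> (UNIV :: input set)" "\<And>j. j \<in> K \<Longrightarrow> E j \<in> sets (input_law j)"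
  obtain n where n: "input_index ` K \<subseteq> {..<n}" using finite_nat_bounded[OF finite_imageI[OF K(1)]] by blast
  define E' where "E' i = (if i \<in> K then E i else UNIV)" for i
  have E': "E' i \<in> sets borel" for i
    using K(3)[of i] by (auto simp: E'_def)
  let ?R = "prod_emb UNIV input_law K (\<Pi>\<^sub>E j\<in>K. E j)"
  let ?F = "\<lambda>i. E' (Service i) \<times> {f. of_bool f \<in> E' (Feedback i)}"
  have iff: "merge_inputs y \<in> ?R \<longleftrightarrow>
      (\<forall>i<n. fst y i \<in> ?F i) \<and> (\<forall>i<n. snd y i \<in> E' (Interarrival i))" for y
  proof -
    have "merge_inputs y \<in> ?R \<longleftrightarrow> (\<forall>j\<in>K. merge_inputs y j \<in> E j)"
      by (auto simp: prod_emb_def PiE_iff)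
    also have "\<dots> \<longleftrightarrow> (\<forall>j. input_index j < n \<longrightarrow> merge_inputs y j \<in> E' j)"
      using n by (auto simp: E'_def)
    also have "\<dots> \<longleftrightarrow> (\<forall>i<n. merge_inputs y (Interarrival i) \<in> E' (Interarrival i) \<and>
        merge_inputs y (Service i) \<in> E' (Service i) \<and> merge_inputs y (Feedback i) \<in> E' (Feedback i))"
      by (metis input.exhaust input_index.simps)
    finally show ?thesis by (auto simp: merge_inputs_def mem_Times_iff)
  qed
  have R: "?R \<in> sets (PiM UNIV input_law)" using K by (intro sets_PiM_I) auto
  have "emeasure (distr (SF \<Otimes>\<^sub>M A) (PiM UNIV input_law) merge_inputs) ?R =
      emeasure (SF \<Otimes>\<^sub>M A) (merge_inputs -` ?R \<inter> space (SF \<Otimes>\<^sub>M A))"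
    by (rule emeasure_distr[OF measurable_merge_inputs R])
  also have "merge_inputs -` ?R \<inter> space (SF \<Otimes>\<^sub>M A) =
      {sf \<in> space SF. \<forall>i\<in>{..<n}. sf i \<in> ?F i} \<times> {t \<in> space A. \<forall>i\<in>{..<n}. t i \<in> E' (Interarrival i)}"
    unfolding space_pair_measure by (rule set_eqI) (simp add: iff mem_Times_iff Ball_def)
  also have "emeasure (SF \<Otimes>\<^sub>M A) \<dots> = emeasure SF {sf \<in> space SF. \<forall>i\<in>{..<n}. sf i \<in> ?F i} *
      emeasure A {t \<in> space A. \<forall>i\<in>{..<n}. t i \<in> E' (Interarrival i)}"
  proof (rule pois.gaps.P.emeasure_pair_measure_Times)
    have F: "?F i \<in> sets GB" for i
      by (rule pair_measureI) (use E' in auto)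
    show "{sf \<in> space SF. \<forall>i\<in>{..<n}. sf i \<in> ?F i} \<in> sets SF"
    proof (rule sets.sets_Collect_finite_All)
      fix i show "{sf \<in> space SF. sf i \<in> ?F i} \<in> sets SF"
        by (rule sets_Collect_single'[where P = "\<lambda>x. x \<in> ?F i"]) (use F[of i] in simp_all)
    qed simp
    show "{t \<in> space A. \<forall>i\<in>{..<n}. t i \<in> E' (Interarrival i)} \<in> sets A"
    proof (rule sets.sets_Collect_finite_All)
      fix i show "{t \<in> space A. t i \<in> E' (Interarrival i)} \<in> sets A"
        by (rule sets_Collect_single'[where P = "\<lambda>x. x \<in> E' (Interarrival i)"]) (use E' in simp_all)
    qed simp
  qed
  also have "emeasure SF {sf \<in> space SF. \<forall>i\<in>{..<n}. sf i \<in> ?F i} = (\<Prod>i<n. emeasure GB (?F i))"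
  proof (rule sf.emeasure_PiM_Collect)
    show "?F i \<in> sets GB" for i by (rule pair_measureI) (use E' in auto)
  qed auto
  also have "\<dots> = (\<Prod>i<n. emeasure (input_law (Service i)) (E' (Service i)) * emeasure (input_law (Feedback i)) (E' (Feedback i)))"
  proof (intro prod.cong refl)
    fix i
    have "emeasure GB (?F i) = emeasure G (E' (Service i)) * emeasure B {f. of_bool f \<in> E' (Feedback i)}"
      using E' by (intro measure_pmf.emeasure_pair_measure_Times) auto
    also have "emeasure B {f. of_bool f \<in> E' (Feedback i)} = emeasure (distr B borel of_bool) (E' (Feedback i))"
      using E' by (subst emeasure_distr) (auto simp: vimage_def)
    finally show "emeasure GB (?F i) = emeasure (input_law (Service i)) (E' (Service i)) * emeasure (input_law (Feedback i)) (E' (Feedback i))"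
      by (simp add: input_law_def)
  qed
  also have "emeasure A {t \<in> space A. \<forall>i\<in>{..<n}. t i \<in> E' (Interarrival i)} =
      (\<Prod>i<n. emeasure (input_law (Interarrival i)) (E' (Interarrival i)))"
    using E' by (subst pois.gaps.emeasure_PiM_Collect) (auto simp: input_law_def)
  also have "(\<Prod>i<n. emeasure (input_law (Service i)) (E' (Service i)) * emeasure (input_law (Feedback i)) (E' (Feedback i))) *
      (\<Prod>i<n. emeasure (input_law (Interarrival i)) (E' (Interarrival i))) =
      (\<Prod>j\<in>{j. input_index j < n}. emeasure (input_law j) (E' j))"
  proof -
    have split: "{j. input_index j < n} = Service ` {..<n} \<union> Feedback ` {..<n} \<union> Interarrival ` {..<n}"
    proof (rule set_eqI)
      fix j show "j \<in> {j. input_index j < n} \<longleftrightarrow> j \<in> Service ` {..<n} \<union> Feedback ` {..<n} \<union> Interarrival ` {..<n}"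
        by (cases j) auto
    qed
    show ?thesis unfolding split
      by (subst prod.union_disjoint; (subst prod.union_disjoint)?)
        (auto simp: prod.reindex inj_on_def prod.distrib)
  qed
  also have "\<dots> = (\<Prod>j\<in>K. emeasure (input_law j) (E' j))"
  proof (rule prod.mono_neutral_right)
    have "{j. input_index j < n} \<subseteq> Service ` {..<n} \<union> Feedback ` {..<n} \<union> Interarrival ` {..<n}"
    proof
      fix j assume "j \<in> {j. input_index j < n}"
      then show "j \<in> Service ` {..<n} \<union> Feedback ` {..<n} \<union> Interarrival ` {..<n}" by (cases j) auto
    qed
    then show "finite {j. input_index j < n}" by (rule finite_subset) auto
    show "K \<subseteq> {j. input_index j < n}" using n by auto
    show "\<forall>j\<in>{j. input_index j < n} - K. emeasure (input_law j) (E' j) = 1"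
    proof
      fix j assume "j \<in> {j. input_index j < n} - K"
      then show "emeasure (input_law j) (E' j) = 1"
        using prob_space.emeasure_space_1[OF prob_space_input_law[of j]] by (simp add: E'_def)
    qed
  qed
  also have "\<dots> = (\<Prod>j\<in>K. emeasure (input_law j) (E j))"
    by (intro prod.cong) (auto simp: E'_def)
  finally show "emeasure (distr (SF \<Otimes>\<^sub>M A) (PiM UNIV input_law) merge_inputs) ?R = (\<Prod>j\<in>K. emeasure (input_law j) (E j))" .
qed (rule sets_distr)

text \<open>
  The sojourn time is a function of the inputs, whose joint law is determined by the marginals.
\<close>

lemma sojourn_prob:
  assumes "prob_space M"
    and indep: "prob_space.indep_vars M (\<lambda>_. borel)
      (\<lambda>i. case i of Interarrival n \<Rightarrow> T n | Service n \<Rightarrow> S n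
                   | Feedback n \<Rightarrow> (\<lambda>\<omega>. of_bool (F n \<omega>))) UNIV"
    and T: "\<And>n. distr M borel (T n) = pois.gap_law"
    and S: "\<And>n. distr M borel (S n) = G"
    and F: "\<And>n. measure M {\<omega> \<in> space M. F n \<omega>} = p"
  shows "measure M {\<omega> \<in> space M. x < sojourn_time (\<lambda>n. T n \<omega>) (\<lambda>n. S n \<omega>) (\<lambda>n. F n \<omega>)} =
    (\<Sum>k. seq.P.prob {\<omega>. leaves (Suc k) 0 \<omega> x})"
proof -
  interpret M: prob_space M by fact
  define X :: "input \<Rightarrow> _ \<Rightarrow> real" where
    "X = (\<lambda>i. case i of Interarrival n \<Rightarrow> T n | Service n \<Rightarrow> S n | Feedback n \<Rightarrow> (\<lambda>\<omega>. of_bool (F n \<omega>)))"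
  have X_meas: "X i \<in> borel_measurable M" for i
    using indep unfolding X_def[symmetric] by (auto simp: M.indep_vars_def)
  have F_meas: "{\<omega> \<in> space M. F n \<omega>} \<in> sets M" for n
  proof -
    have "X (Feedback n) -` {1} \<inter> space M \<in> sets M" by (rule measurable_sets[OF X_meas]) simp
    also have "X (Feedback n) -` {1} \<inter> space M = {\<omega> \<in> space M. F n \<omega>}" by (auto simp: X_def)
    finally show ?thesis .
  qed
  have law: "distr M borel (X i) = input_law i" for i
  proof (cases i)
    case (Feedback n)
    have "F n \<in> measurable M (count_space UNIV)" using F_meas[of n] by (simp add: pred_def)
    have "distr M (count_space UNIV) (F n) = B"
    proof (rule measure_eqI_countable[of _ UNIV])
      fix v :: bool
      have "emeasure (distr M (count_space UNIV) (F n)) {v} = emeasure M {\<omega> \<in> space M. F n \<omega> = v}"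
        using F_meas[of n] by (subst emeasure_distr) (auto simp: pred_def vimage_def intro!: arg_cong[where f="emeasure M"])
      also have "\<dots> = ennreal (if v then p else 1 - p)"
      proof (cases v)
        case True
        then show ?thesis using F[of n] by (simp add: M.emeasure_eq_measure)
      next
        case False
        have "{\<omega> \<in> space M. F n \<omega> = v} = space M - {\<omega> \<in> space M. F n \<omega>}" using False by auto
        then show ?thesis using F[of n] M.prob_compl[OF F_meas[of n]] False by (simp add: M.emeasure_eq_measure)
      qed
      also have "\<dots> = emeasure B {v}"
        using p_pos p_less_1 by (cases v) (auto simp: emeasure_pmf_single)
      finally show "emeasure (distr M (count_space UNIV) (F n)) {v} = emeasure B {v}" .
    qed auto
    then have "distr B borel of_bool = distr (distr M (count_space UNIV) (F n)) borel (of_bool :: bool \<Rightarrow> real)" by simp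
    also have "\<dots> = distr M borel (of_bool \<circ> F n)"
      by (rule distr_distr) (use \<open>F n \<in> measurable M (count_space UNIV)\<close> in simp_all)
    finally show ?thesis by (simp add: X_def input_law_def Feedback comp_def)
  qed (simp_all add: X_def input_law_def T S)
  let ?X = "\<lambda>\<omega> i. X i \<omega>"
  have joint: "distr M (PiM UNIV input_law) ?X = PiM UNIV input_law"
  proof -
    have "distr M (PiM UNIV (\<lambda>_. borel)) (\<lambda>\<omega>. \<lambda>i\<in>UNIV. X i \<omega>) = PiM UNIV (\<lambda>i. distr M borel (X i))"
      using indep X_meas unfolding X_def[symmetric] by (subst (asm) M.indep_vars_iff_distr_eq_PiM) auto
    then have "distr M (PiM UNIV (\<lambda>_. borel)) ?X = PiM UNIV input_law"
      by (simp add: law restrict_UNIV)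
    moreover have "distr M (PiM UNIV (\<lambda>_. borel)) ?X = distr M (PiM UNIV input_law) ?X"
      by (intro distr_cong refl sets_PiM_cong) simp
    ultimately show ?thesis by simp
  qed
  have X: "?X \<in> measurable M (PiM UNIV input_law)"
    by (rule measurable_abs_UNIV) (use X_meas in \<open>simp cong: measurable_cong_sets\<close>)
  have "distr M (SF \<Otimes>\<^sub>M A) (split_inputs \<circ> ?X) = distr (PiM UNIV input_law) (SF \<Otimes>\<^sub>M A) split_inputs"
    using distr_distr[OF measurable_split_inputs X] unfolding joint by simp
  also have "\<dots> = distr (SF \<Otimes>\<^sub>M A) (SF \<Otimes>\<^sub>M A) (split_inputs \<circ> merge_inputs)"
    using distr_distr[OF measurable_split_inputs measurable_merge_inputs] unfolding distr_merge_inputs by simp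
  also have "split_inputs \<circ> merge_inputs = (\<lambda>y. y)" by (simp add: fun_eq_iff split_merge_inputs)
  finally have canonical: "distr M (SF \<Otimes>\<^sub>M A) (split_inputs \<circ> ?X) = SF \<Otimes>\<^sub>M A"
    by (simp only: distr_id)
  have m: "split_inputs \<circ> ?X \<in> measurable M (SF \<Otimes>\<^sub>M A)"
    by (rule measurable_comp[OF X measurable_split_inputs])
  have space: "space (SF \<Otimes>\<^sub>M A) = UNIV" by (simp add: space_pair_measure)
  let ?E = "{(sf, t). x < sojourn_time t (\<lambda>i. fst (sf i)) (\<lambda>i. snd (sf i))}"
  have "(\<lambda>(sf, t). sojourn_time t (\<lambda>i. fst (sf i)) (\<lambda>i. snd (sf i))) -` {x<..} \<inter> space (SF \<Otimes>\<^sub>M A) \<in> sets (SF \<Otimes>\<^sub>M A)"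
    by (rule measurable_sets[OF measurable_canonical_sojourn]) simp
  then have E: "?E \<in> sets (SF \<Otimes>\<^sub>M A)"
    unfolding space by (simp add: vimage_def case_prod_beta')
  have "measure (SF \<Otimes>\<^sub>M A) ?E = measure (distr M (SF \<Otimes>\<^sub>M A) (split_inputs \<circ> ?X)) ?E"
    unfolding canonical ..
  also have "\<dots> = measure M ((split_inputs \<circ> ?X) -` ?E \<inter> space M)"
    by (rule measure_distr[OF m E])
  also have "(split_inputs \<circ> ?X) -` ?E \<inter> space M =
      {\<omega> \<in> space M. x < sojourn_time (\<lambda>n. T n \<omega>) (\<lambda>n. S n \<omega>) (\<lambda>n. F n \<omega>)}"
    by (auto simp: split_inputs_def X_def)
  finally show ?thesis unfolding canonical_sojourn_prob ..
qed

end

section \<open>Asymptotics of the sojourn time\<close>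

context feedback_law
begin

lemma limit_const_summable:
  "summable (\<lambda>k. p ^ k * ((1 - (p + r ^ k * lam * b)) / (1 - r)) powr \<tau>)"
proof -
  have "\<bar>((1 - (p + r ^ k * lam * b)) / (1 - r)) powr \<tau>\<bar> \<le> (1 + lam * b / (1 - r)) powr \<tau>" for k
    unfolding limit_const_terms using mean_others_le[of k] mean_others_nonneg[of k] index_gt_1
    by (auto intro!: powr_mono2)
  from summable_norm_cancel[OF summable_geometric_bounded[OF this]] show ?thesis .
qed

lemma limit_const_pos: "0 < (\<Sum>k. p ^ k * ((1 - (p + r ^ k * lam * b)) / (1 - r)) powr \<tau>)"
proof (rule suminf_pos[OF limit_const_summable])
  fix k
  have "0 < 1 + mean_others k" using mean_others_nonneg[of k] by simp
  then show "0 < p ^ k * ((1 - (p + r ^ k * lam * b)) / (1 - r)) powr \<tau>"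
    unfolding limit_const_terms using p_pos by simp
qed

text \<open>
  Conditioning on \<open>K\<close> leaves rescaled tails of \<open>G\<close>. The factors are bounded, so all ratios
  have a common bound and Tannery's theorem applies.
\<close>

lemma scaled_service_tail:
  assumes "prob_space N" and \<sigma>: "distr N borel \<sigma> = G"
    and indep: "prob_space.indep_var N borel \<sigma> borel (\<lambda>\<omega>. real (K \<omega>))"
    and K: "\<And>k. 1 \<le> k \<Longrightarrow> measure N {\<omega> \<in> space N. K \<omega> = k} = (1 - p) * p ^ (k - 1)"
  shows "((\<lambda>x. measure N {\<omega> \<in> space N. x < (1 + mean_others (K \<omega> - 1)) * \<sigma> \<omega>} / Gbar x) \<longlongrightarrow>
    (1 - p) * (\<Sum>k. p ^ k * ((1 - (p + r ^ k * lam * b)) / (1 - r)) powr \<tau>)) at_top"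
proof -
  interpret N: prob_space N by fact
  interpret G: real_distribution G
    by standard (use space_G in auto)
  have [measurable]: "\<sigma> \<in> borel_measurable N" "(\<lambda>\<omega>. real (K \<omega>)) \<in> borel_measurable N"
    using N.indep_var_rv1[OF indep] N.indep_var_rv2[OF indep] by auto
  have K_eq: "{\<omega> \<in> space N. K \<omega> = k} = {\<omega> \<in> space N. real (K \<omega>) = real k}" for k by auto
  have K_meas: "{\<omega> \<in> space N. K \<omega> = k} \<in> N.events" for k unfolding K_eq by measurable
  have geo: "(\<lambda>k. N.prob {\<omega> \<in> space N. K \<omega> = Suc k}) sums 1"
  proof -
    have "(\<lambda>k. (1 - p) * p ^ k) sums ((1 - p) * (1 / (1 - p)))"
      using p_pos p_less_1 by (intro sums_mult geometric_sums) auto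
    then show ?thesis using p_less_1 by (simp add: K)
  qed
  have total: "(\<lambda>k. N.prob {\<omega> \<in> space N. Q \<omega> \<and> K \<omega> = k}) sums N.prob {\<omega> \<in> space N. Q \<omega>}"
    if "{\<omega> \<in> space N. Q \<omega>} \<in> N.events" for Q
  proof -
    have eq: "{\<omega> \<in> space N. Q \<omega> \<and> K \<omega> = k} = {\<omega> \<in> space N. Q \<omega>} \<inter> {\<omega> \<in> space N. K \<omega> = k}" for k by auto
    have "(\<lambda>k. N.prob {\<omega> \<in> space N. Q \<omega> \<and> K \<omega> = k}) sums N.prob (\<Union>k. {\<omega> \<in> space N. Q \<omega> \<and> K \<omega> = k})"
      using that K_meas by (intro N.finite_measure_UNION) (auto simp: disjoint_family_on_def eq)
    also have "(\<Union>k. {\<omega> \<in> space N. Q \<omega> \<and> K \<omega> = k}) = {\<omega> \<in> space N. Q \<omega>}" by auto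
    finally show ?thesis .
  qed
  (* The probabilities for k \<ge> 1 already add up to 1. *)
  have zero: "N.prob {\<omega> \<in> space N. K \<omega> = 0} = 0"
  proof -
    have "(\<lambda>k. N.prob {\<omega> \<in> space N. K \<omega> = k}) sums 1"
      using total[of "\<lambda>_. True"] N.prob_space by simp
    moreover have "(\<lambda>k. N.prob {\<omega> \<in> space N. K \<omega> = k}) sums (1 + N.prob {\<omega> \<in> space N. K \<omega> = 0})"
      using geo by (subst (asm) sums_Suc_iff) simp
    ultimately show ?thesis using sums_unique2 by fastforce
  qed
  have term_eq: "N.prob {\<omega> \<in> space N. x < (1 + mean_others (K \<omega> - 1)) * \<sigma> \<omega> \<and> K \<omega> = Suc k} =
      (1 - p) * p ^ k * Gbar (1 / (1 + mean_others k) * x)" for x k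
  proof -
    have pos: "0 < 1 + mean_others k" using mean_others_nonneg[of k] by simp
    have "{\<omega> \<in> space N. x < (1 + mean_others (K \<omega> - 1)) * \<sigma> \<omega> \<and> K \<omega> = Suc k} =
        (\<lambda>\<omega>. (\<sigma> \<omega>, real (K \<omega>))) -` ({1 / (1 + mean_others k) * x<..} \<times> {real (Suc k)}) \<inter> space N"
    proof (rule set_eqI)
      fix \<omega>
      have "x < (1 + mean_others k) * \<sigma> \<omega> \<longleftrightarrow> 1 / (1 + mean_others k) * x < \<sigma> \<omega>"
        using pos by (simp add: pos_divide_less_eq mult.commute)
      then show "\<omega> \<in> {\<omega> \<in> space N. x < (1 + mean_others (K \<omega> - 1)) * \<sigma> \<omega> \<and> K \<omega> = Suc k} \<longleftrightarrow>
          \<omega> \<in> (\<lambda>\<omega>. (\<sigma> \<omega>, real (K \<omega>))) -` ({1 / (1 + mean_others k) * x<..} \<times> {real (Suc k)}) \<inter> space N"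
        by (cases "K \<omega> = Suc k") auto
    qed
    also have "N.prob \<dots> = N.prob (\<sigma> -` {1 / (1 + mean_others k) * x<..} \<inter> space N) *
        N.prob ((\<lambda>\<omega>. real (K \<omega>)) -` {real (Suc k)} \<inter> space N)"
      by (rule N.indep_varD[OF indep]) auto
    also have "N.prob ((\<lambda>\<omega>. real (K \<omega>)) -` {real (Suc k)} \<inter> space N) = (1 - p) * p ^ k"
    proof -
      have "(\<lambda>\<omega>. real (K \<omega>)) -` {real (Suc k)} \<inter> space N = {\<omega> \<in> space N. K \<omega> = Suc k}"
        by (auto simp del: of_nat_Suc)
      then show ?thesis using K[of "Suc k"] by simp
    qed
    also have "N.prob (\<sigma> -` {1 / (1 + mean_others k) * x<..} \<inter> space N) = measure G {1 / (1 + mean_others k) * x<..}"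
      unfolding \<sigma>[symmetric] by (rule measure_distr[symmetric]) auto
    also have "\<dots> = measure G (space G - {..1 / (1 + mean_others k) * x})"
      by (intro arg_cong[where f = "measure G"]) auto
    also have "\<dots> = Gbar (1 / (1 + mean_others k) * x)"
      by (subst prob_compl) (auto simp: cdf_def)
    finally show ?thesis by simp
  qed
  have main: "N.prob {\<omega> \<in> space N. x < (1 + mean_others (K \<omega> - 1)) * \<sigma> \<omega>} / Gbar x =
      (\<Sum>k. (1 - p) * p ^ k * (Gbar (1 / (1 + mean_others k) * x) / Gbar x))" for x
  proof -
    let ?Q = "\<lambda>\<omega>. x < (1 + mean_others (K \<omega> - 1)) * \<sigma> \<omega>"
    have "{\<omega> \<in> space N. ?Q \<omega>} \<in> N.events"
    proof -
      have "K \<in> measurable N (count_space UNIV)"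
      proof (rule measurable_count_space_eq2_countable[THEN iffD2, rule_format], safe)
        fix k show "K -` {k} \<inter> space N \<in> N.events"
          using K_meas[of k] by (simp add: vimage_def Int_def conj_commute)
      qed auto
      then have [measurable]: "(\<lambda>\<omega>. mean_others (K \<omega> - 1)) \<in> borel_measurable N"
        by (rule measurable_compose) simp
      show ?thesis by measurable
    qed
    from total[OF this] have s: "(\<lambda>k. N.prob {\<omega> \<in> space N. ?Q \<omega> \<and> K \<omega> = k}) sums N.prob {\<omega> \<in> space N. ?Q \<omega>}" .
    have "N.prob {\<omega> \<in> space N. ?Q \<omega> \<and> K \<omega> = 0} \<le> N.prob {\<omega> \<in> space N. K \<omega> = 0}"
      using K_meas by (intro N.finite_measure_mono) auto
    then have "N.prob {\<omega> \<in> space N. ?Q \<omega> \<and> K \<omega> = 0} = 0" using zero by (simp add: measure_le_0_iff)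
    with s have "(\<lambda>k. N.prob {\<omega> \<in> space N. ?Q \<omega> \<and> K \<omega> = Suc k}) sums N.prob {\<omega> \<in> space N. ?Q \<omega>}"
      by (subst sums_Suc_iff) simp
    from sums_unique[OF sums_divide[OF this, of "Gbar x"]] show ?thesis
      by (simp only: term_eq times_divide_eq_right)
  qed
  let ?c = "1 + lam * b / (1 - r)"
  have c: "0 < ?c" using stable lam_pos b_pos by (intro add_pos_nonneg) auto
  obtain B0 where B0: "0 < B0" "\<And>x. 0 \<le> x \<Longrightarrow> Gbar (1 / ?c * x) \<le> B0 * Gbar x"
    using scale_bounded[of "1 / ?c"] c by auto
  have "((\<lambda>x. \<Sum>k. (1 - p) * p ^ k * (Gbar (1 / (1 + mean_others k) * x) / Gbar x)) \<longlongrightarrow>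
      (\<Sum>k. (1 - p) * p ^ k * (1 / (1 + mean_others k)) powr - \<tau>)) at_top"
  proof (rule tannerys_theorem[THEN conjunct2, THEN conjunct2])
    show "((\<lambda>x. (1 - p) * p ^ k * (Gbar (1 / (1 + mean_others k) * x) / Gbar x)) \<longlongrightarrow>
        (1 - p) * p ^ k * (1 / (1 + mean_others k)) powr - \<tau>) at_top" for k
      using mean_others_nonneg[of k] by (intro tendsto_mult tendsto_const tail_scale) auto
    have "norm ((1 - p) * p ^ k * (Gbar (1 / (1 + mean_others k) * x) / Gbar x)) \<le> B0 * p ^ k" if "0 \<le> x" for k x
    proof -
      have "1 / ?c * x \<le> 1 / (1 + mean_others k) * x"
        using mean_others_nonneg[of k] mean_others_le[of k] c that
        by (intro mult_right_mono divide_left_mono) auto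
      then have "Gbar (1 / (1 + mean_others k) * x) \<le> Gbar (1 / ?c * x)" by (rule tail_antimono)
      also have "\<dots> \<le> B0 * Gbar x" by (rule B0(2)[OF that])
      finally have "Gbar (1 / (1 + mean_others k) * x) / Gbar x \<le> B0"
        using tail_pos[of x] by (simp add: divide_le_eq)
      moreover have "0 \<le> Gbar (1 / (1 + mean_others k) * x) / Gbar x"
        using tail_pos by (intro divide_nonneg_nonneg less_imp_le)
      moreover have weight: "0 \<le> (1 - p) * p ^ k" using p_pos p_less_1 by simp
      ultimately have "0 \<le> (1 - p) * p ^ k * (Gbar (1 / (1 + mean_others k) * x) / Gbar x)"
        "(1 - p) * p ^ k * (Gbar (1 / (1 + mean_others k) * x) / Gbar x) \<le> (1 - p) * p ^ k * B0"
        by (blast intro: mult_nonneg_nonneg mult_left_mono)+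
      then have "norm ((1 - p) * p ^ k * (Gbar (1 / (1 + mean_others k) * x) / Gbar x)) \<le> (1 - p) * p ^ k * B0"
        unfolding real_norm_def by (simp only: abs_of_nonneg)
      also have "\<dots> \<le> 1 * p ^ k * B0" using p_pos p_less_1 B0(1) by (intro mult_right_mono) auto
      finally show ?thesis by (simp add: mult.commute)
    qed
    note bound = this
    show "\<forall>\<^sub>F (k, x) in at_top \<times>\<^sub>F at_top. norm ((1 - p) * p ^ k * (Gbar (1 / (1 + mean_others k) * x) / Gbar x)) \<le> B0 * p ^ k"
      unfolding eventually_prod_filter
      by (intro exI[of _ "\<lambda>_. True"] exI[of _ "\<lambda>x. 0 \<le> x"]) (auto simp only: eventually_ge_at_top case_prod_conv eventually_True intro: bound)
    show "summable (\<lambda>k. B0 * p ^ k)" using p_pos p_less_1 by (intro summable_mult summable_geometric) auto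
  qed simp
  moreover have "(\<Sum>k. (1 - p) * p ^ k * (1 / (1 + mean_others k)) powr - \<tau>) =
      (1 - p) * (\<Sum>k. p ^ k * ((1 - (p + r ^ k * lam * b)) / (1 - r)) powr \<tau>)"
  proof -
    have "(1 / (1 + mean_others k)) powr - \<tau> = ((1 - (p + r ^ k * lam * b)) / (1 - r)) powr \<tau>" for k
      unfolding limit_const_terms using mean_others_nonneg[of k] by (simp add: powr_divide powr_minus field_simps)
    then show ?thesis using suminf_mult[OF limit_const_summable, of "1 - p"] by (simp add: mult.assoc)
  qed
  ultimately show ?thesis by (simp only: main)
qed

end

lemma asymp_equiv_of_ratio:
  fixes f g h :: "real \<Rightarrow> real"
  assumes "((\<lambda>x. f x / g x) \<longlongrightarrow> C) at_top" "C \<noteq> 0" "\<forall>\<^sub>F x in at_top. h x = C * g x"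
  shows "f \<sim>[at_top] h"
proof (rule asymp_equivI')
  have "((\<lambda>x. f x / g x / C) \<longlongrightarrow> C / C) at_top" by (intro tendsto_divide assms tendsto_const)
  then have "((\<lambda>x. f x / g x / C) \<longlongrightarrow> 1) at_top" using assms(2) by simp
  moreover have "\<forall>\<^sub>F x in at_top. f x / g x / C = f x / h x"
    using assms(3) by eventually_elim (simp add: mult.commute)
  ultimately show "((\<lambda>x. f x / h x) \<longlongrightarrow> 1) at_top"
    by (rule Lim_transform_eventually)
qed

text \<open>
  Positivity of the tail is implicit in slow variation: if the tail vanished somewhere, it would vanish
  beyond, and the ratio \<open>L (c x) / L x\<close> would be \<open>0\<close> there.
\<close>

lemma regularly_varying_tailI:
  fixes G :: "real measure"
  assumes "real_distribution G" and L: "slowly_varying L" and \<alpha>: "0 < \<alpha>"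
    and tail: "\<And>x. 0 < x \<Longrightarrow> 1 - cdf G x = L x / x powr (\<alpha> + 1)"
  shows "regularly_varying_tail (\<lambda>x. 1 - cdf G x) (\<alpha> + 1)"
proof
  interpret G: real_distribution G by fact
  show anti: "1 - cdf G y \<le> 1 - cdf G x" if "x \<le> y" for x y
    using G.cdf_nondecreasing[OF that] by simp
  show "1 - cdf G x \<le> 1" for x using G.cdf_nonneg[of x] by simp
  show "1 < \<alpha> + 1" using \<alpha> by simp
  have lim: "((\<lambda>x. L (c * x) / L x) \<longlongrightarrow> 1) at_top" if "0 < c" for c
    using L that by (simp add: slowly_varying_def)
  show pos: "0 < 1 - cdf G x" for x
  proof -
    have "\<forall>\<^sub>F x in at_top. 0 < L (1 * x) / L x" by (rule order_tendstoD(1)[OF lim]) auto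
    from eventually_conj[OF this eventually_ge_at_top[of "max x 1"]]
    obtain y where y: "0 < L (1 * y) / L y" "max x 1 \<le> y"
      by (auto simp: eventually_at_top_linorder)
    have "1 - cdf G y \<noteq> 0" using y tail[of y] by auto
    moreover have "0 \<le> 1 - cdf G y" using G.cdf_bounded_prob[of y] by simp
    moreover have "1 - cdf G y \<le> 1 - cdf G x" using y by (intro anti) auto
    ultimately show ?thesis by linarith
  qed
  show "((\<lambda>x. (1 - cdf G (c * x)) / (1 - cdf G x)) \<longlongrightarrow> c powr - (\<alpha> + 1)) at_top" if c: "0 < c" for c
  proof (rule Lim_transform_eventually)
    show "((\<lambda>x. c powr - (\<alpha> + 1) * (L (c * x) / L x)) \<longlongrightarrow> c powr - (\<alpha> + 1)) at_top"
      using tendsto_mult[OF tendsto_const lim[OF c]] by simp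
    show "\<forall>\<^sub>F x in at_top. c powr - (\<alpha> + 1) * (L (c * x) / L x) = (1 - cdf G (c * x)) / (1 - cdf G x)"
      using eventually_gt_at_top[of 0]
    proof eventually_elim
      case (elim x)
      have "(c * x) powr (\<alpha> + 1) = c powr (\<alpha> + 1) * x powr (\<alpha> + 1)" using c elim by (simp add: powr_mult)
      then show ?case
        unfolding tail[OF elim] tail[OF mult_pos_pos[OF c elim]] powr_minus
        using c elim by (simp add: divide_simps)
    qed
  qed
qed

theorem corollary2p2:
  fixes M :: "'a measure" and T S :: "nat \<Rightarrow> 'a \<Rightarrow> real" and F :: "nat \<Rightarrow> 'a \<Rightarrow> bool"
    and H G :: "real measure" and a b p q lam r \<alpha> :: real and L :: "real \<Rightarrow> real"
    and N :: "'b measure" and \<sigma> :: "'b \<Rightarrow> real" and K :: "'b \<Rightarrow> nat"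
  assumes queue: "feedback_queue M T S F H G a b p"
    and lam: "lam = 1 / a" and q: "q = 1 - p" and r: "r = p + lam * b"
    and stable: "lam * b / q < 1"
    and alpha: "\<alpha> > 0"
    and L: "slowly_varying L"
    and tail: "\<And>x. x > 0 \<Longrightarrow> 1 - cdf G x = L x / x powr (\<alpha> + 1)"
  shows "(prob_space N \<and> distr N borel \<sigma> = G
        \<and> prob_space.indep_var N borel \<sigma> borel (\<lambda>\<omega>. real (K \<omega>))
        \<and> (\<forall>k\<ge>1. measure N {\<omega> \<in> space N. K \<omega> = k} = q * p ^ (k - 1))
      \<longrightarrow> (\<lambda>x. measure N {\<omega> \<in> space N. (1 + m0 r lam b (K \<omega> - 1)) * \<sigma> \<omega> > x})
          \<sim>[at_top] (\<lambda>x. q * L x / x powr (\<alpha> + 1)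
             * (\<Sum>k. p ^ k * ((1 - (p + r ^ k * lam * b)) / (1 - r)) powr (\<alpha> + 1))))
    \<and> ((\<forall>n. distributed M lborel (T n) (exponential_density lam))
      \<longrightarrow> (\<lambda>x. measure M {\<omega> \<in> space M.
             sojourn_time (\<lambda>n. T n \<omega>) (\<lambda>n. S n \<omega>) (\<lambda>n. F n \<omega>) > x})
          \<sim>[at_top] (\<lambda>x. q * (1 + p) / ((1 - r) powr (\<alpha> + 1) * (1 - r * p))
             * (\<Sum>k. p ^ k * (1 - (p + r ^ k * lam * b)) powr (\<alpha> + 1))
             * L x * x powr (- (\<alpha> + 1))))"
proof -
  interpret Q: feedback_queue M T S F H G a b p by (rule queue)
  have S_meas: "S 0 \<in> borel_measurable M"
    using Q.indep unfolding Q.indep_vars_def by (auto dest!: conjunct1 spec[of _ "Service 0"])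
  have G: "real_distribution G"
    using Q.real_distribution_distr[OF S_meas] Q.service_distr[of 0] by simp
  then interpret G: real_distribution G .
  have q_pos: "0 < q" using q Q.feedback_prob by simp
  have r1: "r < 1" using stable q_pos by (simp add: q r field_simps)
  interpret FL: feedback_law G lam b p "\<alpha> + 1"
  proof (intro feedback_law.intro feedback_law_axioms.intro service_time_law.intro service_time_law_axioms.intro)
    show "prob_space G" by (rule G.prob_space_axioms)
    show "regularly_varying_tail (\<lambda>x. 1 - cdf G x) (\<alpha> + 1)" by (rule regularly_varying_tailI[OF G L alpha tail])
  qed (use Q.service_nonneg Q.service_integrable Q.service_mean Q.interarrival_mean Q.feedback_prob lam r r1 in auto)
  let ?C = "\<Sum>k. p ^ k * ((1 - (p + r ^ k * lam * b)) / (1 - r)) powr (\<alpha> + 1)"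
  have C_pos: "0 < ?C" unfolding r by (rule FL.limit_const_pos)
  have part_a: "(\<lambda>x. measure N {\<omega> \<in> space N. (1 + m0 r lam b (K \<omega> - 1)) * \<sigma> \<omega> > x})
      \<sim>[at_top] (\<lambda>x. q * L x / x powr (\<alpha> + 1) * ?C)"
    if "prob_space N" "distr N borel \<sigma> = G" "prob_space.indep_var N borel \<sigma> borel (\<lambda>\<omega>. real (K \<omega>))"
      "\<forall>k\<ge>1. measure N {\<omega> \<in> space N. K \<omega> = k} = q * p ^ (k - 1)"
  proof (rule asymp_equiv_of_ratio)
    show "((\<lambda>x. measure N {\<omega> \<in> space N. (1 + m0 r lam b (K \<omega> - 1)) * \<sigma> \<omega> > x} / (1 - cdf G x)) \<longlongrightarrow> q * ?C) at_top"
      unfolding r q by (rule FL.scaled_service_tail[OF that(1-3)]) (use that(4) q in simp)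
    show "q * ?C \<noteq> 0" using C_pos q_pos by simp
    show "\<forall>\<^sub>F x in at_top. q * L x / x powr (\<alpha> + 1) * ?C = q * ?C * (1 - cdf G x)"
      using eventually_gt_at_top[of 0] by eventually_elim (simp add: tail)
  qed
  have part_b: "(\<lambda>x. measure M {\<omega> \<in> space M. sojourn_time (\<lambda>n. T n \<omega>) (\<lambda>n. S n \<omega>) (\<lambda>n. F n \<omega>) > x})
      \<sim>[at_top] (\<lambda>x. q * (1 + p) / ((1 - r) powr (\<alpha> + 1) * (1 - r * p))
             * (\<Sum>k. p ^ k * (1 - (p + r ^ k * lam * b)) powr (\<alpha> + 1))
             * L x * x powr (- (\<alpha> + 1)))"
    if exp: "\<forall>n. distributed M lborel (T n) (exponential_density lam)"
  proof (rule asymp_equiv_of_ratio)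
    have T: "distr M borel (T n) = FL.pois.gap_law" for n
    proof -
      have "distr M lborel (T n) = density lborel (exponential_density lam)"
        using exp by (simp add: distributed_def)
      moreover have "distr M lborel (T n) = distr M borel (T n)" by (rule distr_cong) auto
      ultimately show ?thesis by (simp add: FL.pois.gap_law_def)
    qed
    have "measure M {\<omega> \<in> space M. sojourn_time (\<lambda>n. T n \<omega>) (\<lambda>n. S n \<omega>) (\<lambda>n. F n \<omega>) > x} =
        (\<Sum>k. FL.seq.P.prob {\<omega>. leaves (Suc k) 0 \<omega> x})" for x
      by (rule FL.sojourn_prob[OF Q.prob_space_axioms Q.indep T Q.service_distr Q.feedback_prob(1)])
    then show "((\<lambda>x. measure M {\<omega> \<in> space M. sojourn_time (\<lambda>n. T n \<omega>) (\<lambda>n. S n \<omega>) (\<lambda>n. F n \<omega>) > x} / (1 - cdf G x))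
        \<longlongrightarrow> q * ((1 + p) / (1 - r * p) * ?C)) at_top"
      using FL.sojourn_tail unfolding r q by (simp only:)
    have rp: "0 < 1 - r * p"
      using mult_strict_mono[of r 1 p 1] r1 FL.r_pos Q.feedback_prob unfolding r by simp
    then show "q * ((1 + p) / (1 - r * p) * ?C) \<noteq> 0"
      using C_pos q_pos Q.feedback_prob by simp
    have sum_eq: "(\<Sum>k. p ^ k * (1 - (p + r ^ k * lam * b)) powr (\<alpha> + 1)) = (1 - r) powr (\<alpha> + 1) * ?C"
    proof -
      have "(1 - r) powr (\<alpha> + 1) * (p ^ k * ((1 - (p + r ^ k * lam * b)) / (1 - r)) powr (\<alpha> + 1)) =
          p ^ k * (1 - (p + r ^ k * lam * b)) powr (\<alpha> + 1)" for k
      proof -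
        have "0 \<le> (1 - (p + r ^ k * lam * b)) / (1 - r)"
          using FL.limit_const_terms[of k] FL.mean_others_nonneg[of k] unfolding r by simp
        then have "0 \<le> 1 - (p + r ^ k * lam * b)" using r1 by (simp add: zero_le_divide_iff)
        then show ?thesis using r1 by (simp add: powr_divide)
      qed
      note eq = this[unfolded r]
      show ?thesis
        using suminf_mult[OF FL.limit_const_summable, of "(1 - r) powr (\<alpha> + 1)"] unfolding r by (simp only: eq)
    qed
    have cancel: "q * (1 + p) / (d * e) * (d * c) * l * inverse y = q * ((1 + p) / e * c) * (l / y)"
      if "d \<noteq> 0" for d e c l y :: real
      using that by (simp add: divide_inverse)
    have "(1 - r) powr (\<alpha> + 1) \<noteq> 0" using r1 by simp
    from cancel[OF this] show "\<forall>\<^sub>F x in at_top. q * (1 + p) / ((1 - r) powr (\<alpha> + 1) * (1 - r * p))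
             * (\<Sum>k. p ^ k * (1 - (p + r ^ k * lam * b)) powr (\<alpha> + 1)) * L x * x powr (- (\<alpha> + 1)) =
        q * ((1 + p) / (1 - r * p) * ?C) * (1 - cdf G x)"
      unfolding sum_eq powr_minus
      by (intro eventually_mono[OF eventually_gt_at_top[of 0]]) (simp only: tail)
  qed
  show ?thesis using part_a part_b by blast
qed

end
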